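(* Let $A_1,\dots,A_m\subset\mathbb R^q$ be Borel sets (not necessarily disjoint) such that, for every $j$, $p_{A_j}:=\mathbb P(\mathbf Z\in A_j)>0$ and Condition (C) holds for $A=A_j$. Then the process $$\vec{\mathbb C}_n(\vec{\mathbf u}|\mathcal A):=\big(\overline{\mathbb C}_n(\mathbf u_1|A_1),\dots,\overline{\mathbb C}_n(\mathbf u_m|A_m)\big),\quad \vec{\mathbf u}=(\mathbf u_1,\dots,\mathbf u_m)\in[0,1]^{mp},$$ converges weakly in $\ell^\infty([0,1]^{mp},\mathbb R^m)$ to the centered Gaussian process $\vec{\mathbb C}_\infty(\vec{\mathbf u}|\mathcal A):=\big(\mathbb C_\infty(\mathbf u_1|A_1),\dots,\mathbb C_\infty(\mathbf u_m|A_m)\big)$, where $$\mathbb C_\infty(\mathbf u|A_j):=\frac{\mathbb B(\mathbf u,A_j)}{p_{A_j}}-\sum_{i=1}^p\frac{\partial_iD(\mathbf u,A_j)}{p_{A_j}^2}\Big(\mathbb B\big((u_i,\mathbf 1_{-i}),A_j\big)-u_i\mathbb B(\mathbf 1,A_j)\Big)-\frac{D(\mathbf u,A_j)}{p_{A_j}^2}\mathbb B(\mathbf 1,A_j),$$ and $(\mathbb B(\cdot,A_1),\dots,\mathbb B(\cdot,A_m))$ is a centered Gaussian process with $$\mathbb E[\mathbb B(\mathbf u,A_j)\mathbb B(\mathbf v,A_k)]=\mathbb P(\mathbf U^{A_j}\le\mathbf u,\mathbf U^{A_k}\le\mathbf v,\mathbf Z\in A_j\cap A_k)-\mathbb P(\mathbf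 U^{A_j}\le\mathbf u,\mathbf Z\in A_j)\,\mathbb P(\mathbf U^{A_k}\le\mathbf v,\mathbf Z\in A_k).$$
   Context: Let $(\mathbf X,\mathbf Z)$ be a random vector in $\mathbb R^p\times\mathbb R^q$ and $(\mathbf X_1,\mathbf Z_1),\dots,(\mathbf X_n,\mathbf Z_n)$ i.i.d. copies. $\mathcal A:=\{A_1,\dots,A_m\}$. Vector inequalities are componentwise. For a Borel $A$ with $p_A>0$: the conditional margins $F_k(t|A):=\mathbb P(X_k\le t\mid\mathbf Z\in A)$ are assumed continuous (standing assumption); $C(\cdot|A)$ is the conditional copula of $\mathbf X$ given $\mathbf Z\in A$; $U^A_k:=F_k(X_k|A)$, $\mathbf U^A=(U^A_1,\dots,U^A_p)$; $D(\mathbf u,A):=\mathbb P(\mathbf U^A\le\mathbf u,\mathbf Z\in A)$. Empirical: $\hat p_A:=n^{-1}\sum_i\mathbf 1(\mathbf Z_i\in A)$, $F_{n,k}(t|A):=\frac1{n\hat p_A}\sum_i\mathbf 1(X_{i,k}\le t,\mathbf Z_i\in A)$ (set to $0$ if $\hat p_A=0$), generalized inverse $F^{-1}(u):=\inf\{t:F(t)\ge u\}$, $\overline C_n(\mathbf u|A):=\frac1{n\hat p_A}\sum_i\mathbf 1\big(X_{i,k}\le F_{n,k}^{-1}(u_k|A)\ \forall k,\ \mathbf Z_i\in A\big)$, and $\overline{\mathbb C}_n(\mathbf u|A):=\sqrt n(\overline C_n-C)(\mathbf u|A)$. $(u_i,\mathbf 1_{-i})$ denotes the vector with $i$-th coordinate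 $u_i$ and other coordinates $1$. Condition (C) for $A$: for every $k$, the partial derivative $\partial_kD(\mathbf u,A)$ w.r.t. $u_k$ exists and is continuous on $\{\mathbf u\in[0,1]^p:0<u_k<1\}$. *)

theory Defs
  imports "HOL-Probability.Probability"
begin

text \<open>Population quantities. P is the law of (X,Z) on real^'p \<times> real^'q.\<close>

definition unit_cube :: "(real^'p) set" where
  "unit_cube = {u. \<forall>k. 0 \<le> u $ k \<and> u $ k \<le> 1}"

definition pA :: "((real^'p) \<times> (real^'q)) measure \<Rightarrow> (real^'q) set \<Rightarrow> real" where
  "pA P A = measure P {w. snd w \<in> A}"

definition condF :: "((real^'p) \<times> (real^'q)) measure \<Rightarrow> (real^'q) set \<Rightarrow> 'p \<Rightarrow> real \<Rightarrow> real" where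
  "condF P A k t = measure P {w. fst w $ k \<le> t \<and> snd w \<in> A} / pA P A"

definition Dfun :: "((real^'p) \<times> (real^'q)) measure \<Rightarrow> (real^'q) set \<Rightarrow> real^'p \<Rightarrow> real" where
  "Dfun P A u = measure P {w. (\<forall>k. condF P A k (fst w $ k) \<le> u $ k) \<and> snd w \<in> A}"

text \<open>Conditional copula C(u|A) = P(U^A \<le> u | Z \<in> A) (margins continuous).\<close>
definition Ccop :: "((real^'p) \<times> (real^'q)) measure \<Rightarrow> (real^'q) set \<Rightarrow> real^'p \<Rightarrow> real" where
  "Ccop P A u = Dfun P A u / pA P A"

definition upd :: "real^'p \<Rightarrow> 'p \<Rightarrow> real \<Rightarrow> real^'p" where
  "upd u k t = (\<chi> l. if l = k then t else u $ l)"

definition pD :: "((real^'p) \<times> (real^'q)) measure \<Rightarrow> (real^'q) set \<Rightarrow> 'p \<Rightarrow> real^'p \<Rightarrow> real" where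
  "pD P A k u = deriv (\<lambda>t. Dfun P A (upd u k t)) (u $ k)"

definition condition_C :: "((real^'p) \<times> (real^'q)) measure \<Rightarrow> (real^'q) set \<Rightarrow> bool" where
  "condition_C P A \<longleftrightarrow> (\<forall>k.
     (\<forall>u \<in> unit_cube. 0 < u $ k \<and> u $ k < 1 \<longrightarrow>
        (\<lambda>t. Dfun P A (upd u k t)) differentiable (at (u $ k))) \<and>
     continuous_on {u \<in> unit_cube. 0 < u $ k \<and> u $ k < 1} (pD P A k))"

definition Gam :: "((real^'p) \<times> (real^'q)) measure \<Rightarrow> ('m \<Rightarrow> (real^'q) set)
                   \<Rightarrow> ((real^'p) \<times> 'm) \<Rightarrow> ((real^'p) \<times> 'm) \<Rightarrow> real" where
  "Gam P A s s' = (case s of (u, j) \<Rightarrow> case s' of (v, k) \<Rightarrow>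
     measure P {w. (\<forall>l. condF P (A j) l (fst w $ l) \<le> u $ l) \<and>
                   (\<forall>l. condF P (A k) l (fst w $ l) \<le> v $ l) \<and> snd w \<in> A j \<inter> A k}
     - Dfun P (A j) u * Dfun P (A k) v)"

definition phat :: "(nat \<Rightarrow> 'a \<Rightarrow> real^'q) \<Rightarrow> nat \<Rightarrow> (real^'q) set \<Rightarrow> 'a \<Rightarrow> real" where
  "phat Z n A \<omega> = (\<Sum>i<n. if Z i \<omega> \<in> A then 1 else 0) / real n"

definition Fn :: "(nat \<Rightarrow> 'a \<Rightarrow> real^'p) \<Rightarrow> (nat \<Rightarrow> 'a \<Rightarrow> real^'q) \<Rightarrow> nat \<Rightarrow> (real^'q) set
                  \<Rightarrow> 'p \<Rightarrow> 'a \<Rightarrow> real \<Rightarrow> real" where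
  "Fn X Z n A k \<omega> t = (if phat Z n A \<omega> = 0 then 0 else
     (\<Sum>i<n. if X i \<omega> $ k \<le> t \<and> Z i \<omega> \<in> A then 1 else 0) / (real n * phat Z n A \<omega>))"

text \<open>Generalized inverse F^{-1}(u) = inf{t. F t \<ge> u}, with values in the extended reals
  (inf of the empty set is +\<infinity>, of an unbounded-below set is -\<infinity>).\<close>
definition ginv :: "(real \<Rightarrow> real) \<Rightarrow> real \<Rightarrow> ereal" where
  "ginv F u = Inf {ereal t | t. u \<le> F t}"

definition Cbar :: "(nat \<Rightarrow> 'a \<Rightarrow> real^'p) \<Rightarrow> (nat \<Rightarrow> 'a \<Rightarrow> real^'q) \<Rightarrow> nat \<Rightarrow> (real^'q) set
                    \<Rightarrow> 'a \<Rightarrow> real^'p \<Rightarrow> real" where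
  "Cbar X Z n A \<omega> u =
     (\<Sum>i<n. if (\<forall>k. ereal (X i \<omega> $ k) \<le> ginv (Fn X Z n A k \<omega>) (u $ k)) \<and> Z i \<omega> \<in> A
             then 1 else 0) / (real n * phat Z n A \<omega>)"

text \<open>The index set [0,1]^{mp} and the space l^\<infinity>([0,1]^{mp}, R^m) (functions vanishing
  off the index set, bounded on it), with the sup distance.\<close>

definition Tset :: "('m \<Rightarrow> real^'p) set" where
  "Tset = {uv. \<forall>j. uv j \<in> unit_cube}"

definition lset :: "(('m \<Rightarrow> real^'p) \<Rightarrow> real^'m) set" where
  "lset = {f. (\<forall>t. t \<notin> Tset \<longrightarrow> f t = 0) \<and> bounded (f ` Tset)}"

definition supdist :: "(('m \<Rightarrow> real^'p) \<Rightarrow> real^'m) \<Rightarrow> (('m \<Rightarrow> real^'p) \<Rightarrow> real^'m) \<Rightarrow> real" where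
  "supdist f g = (SUP t\<in>Tset. norm (f t - g t))"

definition linf_open :: "(('m \<Rightarrow> real^'p) \<Rightarrow> real^'m) set \<Rightarrow> bool" where
  "linf_open S \<longleftrightarrow> S \<subseteq> lset \<and> (\<forall>f\<in>S. \<exists>e>0. \<forall>g\<in>lset. supdist f g < e \<longrightarrow> g \<in> S)"

definition linf_borel :: "(('m \<Rightarrow> real^'p) \<Rightarrow> real^'m) measure" where
  "linf_borel = sigma lset {S. linf_open S}"

definition linf_compact :: "(('m \<Rightarrow> real^'p) \<Rightarrow> real^'m) set \<Rightarrow> bool" where
  "linf_compact S \<longleftrightarrow> S \<subseteq> lset \<and>
     (\<forall>s::nat \<Rightarrow> _. (\<forall>n. s n \<in> S) \<longrightarrow> (\<exists>(r::nat \<Rightarrow> nat) g. strict_mono r \<and> g \<in> S \<and>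
          (\<lambda>n. supdist (s (r n)) g) \<longlonglongrightarrow> 0))"

definition linf_tight :: "(('m \<Rightarrow> real^'p) \<Rightarrow> real^'m) measure \<Rightarrow> bool" where
  "linf_tight L \<longleftrightarrow> (\<forall>e>0. \<exists>S. linf_compact S \<and> S \<in> sets L \<and> measure L S \<ge> 1 - e)"

definition linf_bcont :: "((('m \<Rightarrow> real^'p) \<Rightarrow> real^'m) \<Rightarrow> real) \<Rightarrow> bool" where
  "linf_bcont h \<longleftrightarrow> (\<exists>B. \<forall>f\<in>lset. \<bar>h f\<bar> \<le> B) \<and>
     (\<forall>f\<in>lset. \<forall>e>0. \<exists>d>0. \<forall>g\<in>lset. supdist f g < d \<longrightarrow> \<bar>h g - h f\<bar> < e)"

text \<open>Outer expectation E^* (for bounded integrands).\<close>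
definition outer_exp :: "'a measure \<Rightarrow> ('a \<Rightarrow> real) \<Rightarrow> real" where
  "outer_exp M Y = Inf {integral\<^sup>L M g | g. g \<in> borel_measurable M \<and> integrable M g \<and>
                                           (\<forall>\<omega>\<in>space M. Y \<omega> \<le> g \<omega>)}"

text \<open>Weak convergence in the Hoffmann-Jorgensen sense of maps Y n into l^\<infinity> towards a Borel law L.\<close>
definition linf_weak_conv :: "'a measure \<Rightarrow> (nat \<Rightarrow> 'a \<Rightarrow> (('m \<Rightarrow> real^'p) \<Rightarrow> real^'m))
                              \<Rightarrow> (('m \<Rightarrow> real^'p) \<Rightarrow> real^'m) measure \<Rightarrow> bool" where
  "linf_weak_conv M Y L \<longleftrightarrow> (\<forall>h. linf_bcont h \<longrightarrow>
     (\<lambda>n. outer_exp M (\<lambda>\<omega>. h (Y n \<omega>))) \<longlonglongrightarrow> integral\<^sup>L L h)"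

definition Cn_vec :: "((real^'p) \<times> (real^'q)) measure \<Rightarrow> ('m \<Rightarrow> (real^'q) set)
     \<Rightarrow> (nat \<Rightarrow> 'a \<Rightarrow> real^'p) \<Rightarrow> (nat \<Rightarrow> 'a \<Rightarrow> real^'q) \<Rightarrow> nat \<Rightarrow> 'a
     \<Rightarrow> (('m::finite) \<Rightarrow> real^'p) \<Rightarrow> real^'m" where
  "Cn_vec P A X Z n \<omega> = (\<lambda>uv. if uv \<in> Tset then
      (\<chi> j. sqrt (real n) * (Cbar X Z n (A j) \<omega> (uv j) - Ccop P (A j) (uv j))) else 0)"

text \<open>The limit \<vec>C_\<infinity> built from a realisation B of the process (B(u,A_j)), written B u j.\<close>
definition Cinf_vec :: "((real^'p) \<times> (real^'q)) measure \<Rightarrow> ('m \<Rightarrow> (real^'q) set)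
     \<Rightarrow> (real^'p \<Rightarrow> 'm \<Rightarrow> real) \<Rightarrow> (('m::finite) \<Rightarrow> real^'p) \<Rightarrow> real^'m" where
  "Cinf_vec P A B = (\<lambda>uv. if uv \<in> Tset then
      (\<chi> j. let u = uv j; p = pA P (A j); one = ((\<chi> k. 1) :: real^'p) in
         B u j / p
         - (\<Sum>i\<in>UNIV. pD P (A j) i u / p\<^sup>2 * (B (upd one i (u $ i)) j - u $ i * B one j))
         - Dfun P (A j) u / p\<^sup>2 * B one j)
      else 0)"

text \<open>B is a centered Gaussian process on the index set unit_cube \<times> 'm with covariance Gam:
  every finite linear combination is centered normal with the induced variance
  (expressed through its characteristic function, which includes degenerate variance 0).\<close>
definition gaussian_B :: "((real^'p) \<times> (real^'q)) measure \<Rightarrow> ('m \<Rightarrow> (real^'q) set)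
     \<Rightarrow> (real^'p \<Rightarrow> 'm \<Rightarrow> real) measure \<Rightarrow> bool" where
  "gaussian_B P A N \<longleftrightarrow> prob_space N \<and>
     (\<forall>u\<in>unit_cube. \<forall>j. (\<lambda>\<omega>. \<omega> u j) \<in> borel_measurable N) \<and>
     (\<forall>I c. finite I \<and> I \<subseteq> unit_cube \<times> UNIV \<longrightarrow>
        (\<forall>t. char (distr N borel (\<lambda>\<omega>. \<Sum>s\<in>I. c s * \<omega> (fst s) (snd s))) t =
             exp (- complex_of_real (t\<^sup>2 * (\<Sum>s\<in>I. \<Sum>s'\<in>I. c s * c s' * Gam P A s s') / 2))))"

end

theory Submission
  imports Defs "HOL-Complex_Analysis.Great_Picard"
begin

text \<open>Write G_n(u, j) for the empirical process sqrt n (D_n - D)(u, A_j) of the events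
  (U^{A_j} \<le> u, Z \<in> A_j). If v_k = F_k(F_{n,k}^{-1}(u_k)), then almost surely the empirical copula is
  D_n(v) / p_n, and the defining property of the quantile gives
  p sqrt n (v_k - u_k) = - (G_n(u_k, 1) - u_k G_n(1)) + o(1). Expanding D(v) around u (with a separate argument
  near u_k = 0 and u_k = 1, where the derivative is not controlled but the increment is small) shows that
  the copula process is, up to o(1) uniformly in u, the image of G_n under the bounded linear map that
  sends B to C_\<infinity>.

  The oscillation of G_n is controlled by exponential moments and chaining over dyadic grids down to the
  scale 1/n. The same chaining gives a version of B with continuous paths. Hence both processes
  are uniformly close to their values on a finite grid, where the central limit theorem applies, and it
  suffices to test weak convergence on Lipschitz functionals.\<close>

section \<open>Weak convergence in finitely many coordinates\<close>

text \<open>The natural distance on the index set is l1: continuous conditional margins make each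
  U^A_k uniform given Z in A, so the events of u and v differ by probability at most p_A l1 (u, v).
  This bounds the increment variances of G_n and of B alike, which is why one chaining argument with
  one set of constants serves both. For G_n the moment bound rests on exp y \<le> 1 + y + y^2 for
  \<bar>y\<bar> \<le> 1, and this is what stops the chaining at scale 1/n. Condition (C) is silent
  on the faces u_k = 0 and u_k = 1. The increment is small there because the bridge G_n(u_k, 1) -
  u_k G_n(1) vanishes at both ends, so v_k - u_k is o(1 / sqrt n) near a face, and D is Lipschitz.
  The same Lipschitz constant bounds the partial derivatives, so the map from B to C_\<infinity> is
  Lipschitz for the sup distance; tightness and discretisation are carried out for B and pushed
  forward. The copula process is not shown to be measurable. Measurability is asked only of finitely
  many values of G_n; the rest is absorbed into outer expectations, off an event of small
  probability.\<close>

lemma real_distribution_tilt: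
  fixes Y V :: "'a \<Rightarrow> real"
  assumes "prob_space M" and [measurable]: "Y \<in> borel_measurable M" "V \<in> borel_measurable M"
    and V: "\<And>x. x \<in> space M \<Longrightarrow> 0 \<le> V x" "\<And>x. x \<in> space M \<Longrightarrow> V x \<le> C"
    and c: "c = (\<integral>x. V x \<partial>M)" "c > 0"
  shows "real_distribution (distr (density M (\<lambda>x. V x / c)) borel Y)"
    and "\<And>f :: real \<Rightarrow> 'b::{banach,second_countable_topology}. f \<in> borel_measurable borel \<Longrightarrow>
          integral\<^sup>L (distr (density M (\<lambda>x. V x / c)) borel Y) f = (1 / c) *\<^sub>R (\<integral>x. V x *\<^sub>R f (Y x) \<partial>M)"
proof -
  interpret prob_space M by fact
  have iV: "integrable M V"
    using V by (intro integrable_const_bound[of _ C]) auto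
  have "emeasure (density M (\<lambda>x. V x / c)) (space M) = (\<integral>\<^sup>+x. ennreal (V x / c) \<partial>M)"
    by (subst emeasure_density) (auto intro!: nn_integral_cong)
  also have "\<dots> = ennreal (\<integral>x. V x / c \<partial>M)"
    using iV V c by (intro nn_integral_eq_integral) (auto intro!: AE_I2)
  also have "\<dots> = 1" using c by simp
  finally have "prob_space (density M (\<lambda>x. V x / c))"
    by (intro prob_spaceI) simp
  then show "real_distribution (distr (density M (\<lambda>x. V x / c)) borel Y)"
    by (intro prob_space.real_distribution_distr) auto
  show "integral\<^sup>L (distr (density M (\<lambda>x. V x / c)) borel Y) f = (1 / c) *\<^sub>R (\<integral>x. V x *\<^sub>R f (Y x) \<partial>M)"
    if [measurable]: "f \<in> borel_measurable borel" for f :: "real \<Rightarrow> 'b"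
  proof -
    have "integral\<^sup>L (distr (density M (\<lambda>x. V x / c)) borel Y) f = (\<integral>x. (V x / c) *\<^sub>R f (Y x) \<partial>M)"
      using V c by (subst integral_distr) (auto simp: integral_density intro!: AE_I2)
    also have "\<dots> = (\<integral>x. (1/c) *\<^sub>R (V x *\<^sub>R f (Y x)) \<partial>M)" by simp
    finally show ?thesis by (simp only: integral_scaleR_right)
  qed
qed

text \<open>Divided by the total weights, the integrals in \<open>ch\<close> are characteristic
  functions of the tilted laws. Levy's theorem gives weak convergence, and multiplying by the
  convergent totals undoes the normalisation. Positive totals make every tilted law a probability
  measure.\<close>

lemma weighted_char_conv_imp_integral_conv_pos:
  fixes Y V :: "nat \<Rightarrow> 'a \<Rightarrow> real" and Y' V' :: "'b \<Rightarrow> real"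
  assumes M: "prob_space M" and N: "prob_space N"
    and [measurable]: "\<And>n. Y n \<in> borel_measurable M" "\<And>n. V n \<in> borel_measurable M"
      "Y' \<in> borel_measurable N" "V' \<in> borel_measurable N"
    and V: "\<And>n x. x \<in> space M \<Longrightarrow> 0 \<le> V n x" "\<And>n x. x \<in> space M \<Longrightarrow> V n x \<le> C"
    and V': "\<And>x. x \<in> space N \<Longrightarrow> 0 \<le> V' x" "\<And>x. x \<in> space N \<Longrightarrow> V' x \<le> C"
    and ch: "\<And>t. (\<lambda>n. \<integral>x. V n x *\<^sub>R iexp (t * Y n x) \<partial>M) \<longlonglongrightarrow> (\<integral>x. V' x *\<^sub>R iexp (t * Y' x) \<partial>N)"
    and cc: "(\<lambda>n. \<integral>x. V n x \<partial>M) \<longlonglongrightarrow> (\<integral>x. V' x \<partial>N)"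
    and pos: "\<And>n. (\<integral>x. V n x \<partial>M) > 0" "(\<integral>x. V' x \<partial>N) > 0"
    and f: "\<And>x. isCont f x" "\<And>x. \<bar>f x\<bar> \<le> (B::real)"
  shows "(\<lambda>n. \<integral>x. V n x * f (Y n x) \<partial>M) \<longlonglongrightarrow> (\<integral>x. V' x * f (Y' x) \<partial>N)"
proof -
  have [measurable]: "f \<in> borel_measurable borel"
    using f(1) by (intro borel_measurable_continuous_onI continuous_at_imp_continuous_on) auto
  define c where "c n = (\<integral>x. V n x \<partial>M)" for n
  define c' where "c' = (\<integral>x. V' x \<partial>N)"
  have c: "c n > 0" "c' > 0" for n using pos by (auto simp: c_def c'_def)
  have cc: "c \<longlonglongrightarrow> c'" using cc by (simp add: c_def[abs_def] c'_def)
  define \<mu> where "\<mu> n = distr (density M (\<lambda>x. V n x / c n)) borel (Y n)" for n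
  define \<nu> where "\<nu> = distr (density N (\<lambda>x. V' x / c')) borel Y'"
  note tM = real_distribution_tilt[OF M, where Y="Y n" and V="V n" and C=C and c="c n" for n, OF _ _ V c_def c(1)]
  note tN = real_distribution_tilt[OF N, where Y=Y' and V=V' and C=C and c=c', OF _ _ V' c'_def c(2)]
  have rd: "real_distribution (\<mu> n)" "real_distribution \<nu>" for n
    unfolding \<mu>_def \<nu>_def by (auto intro!: tM tN)
  have chM: "char (\<mu> n) t = (1 / c n) *\<^sub>R (\<integral>x. V n x *\<^sub>R iexp (t * Y n x) \<partial>M)" for n t
    unfolding char_def \<mu>_def by (rule tM) auto
  have chN: "char \<nu> t = (1 / c') *\<^sub>R (\<integral>x. V' x *\<^sub>R iexp (t * Y' x) \<partial>N)" for t
    unfolding char_def \<nu>_def by (rule tN) auto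
  have "(\<lambda>n. char (\<mu> n) t) \<longlonglongrightarrow> char \<nu> t" for t
    unfolding chM chN using c(2) by (intro tendsto_scaleR tendsto_divide tendsto_const ch cc) auto
  then have "weak_conv_m \<mu> \<nu>"
    using rd by (intro levy_continuity) auto
  then have "(\<lambda>n. integral\<^sup>L (\<mu> n) f) \<longlonglongrightarrow> integral\<^sup>L \<nu> f"
    using f rd by (intro weak_conv_imp_integral_bdd_continuous_conv[where B=B]) auto
  then have "(\<lambda>n. c n * integral\<^sup>L (\<mu> n) f) \<longlonglongrightarrow> c' * integral\<^sup>L \<nu> f"
    by (intro tendsto_intros cc)
  moreover have "c n * integral\<^sup>L (\<mu> n) f = (\<integral>x. V n x * f (Y n x) \<partial>M)" for n
    unfolding \<mu>_def using c(1)[of n] by (subst tM) auto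
  moreover have "c' * integral\<^sup>L \<nu> f = (\<integral>x. V' x * f (Y' x) \<partial>N)"
    unfolding \<nu>_def using c by (subst tN) auto
  ultimately show ?thesis by simp
qed

lemma (in prob_space) weighted_integral_bound:
  fixes V f :: "'a \<Rightarrow> real"
  assumes [measurable]: "V \<in> borel_measurable M" "f \<in> borel_measurable M"
    and V: "\<And>x. x \<in> space M \<Longrightarrow> 0 \<le> V x" "\<And>x. x \<in> space M \<Longrightarrow> V x \<le> C" and f: "\<And>x. \<bar>f x\<bar> \<le> B"
  shows "\<bar>\<integral>x. V x * f x \<partial>M\<bar> \<le> B * (\<integral>x. V x \<partial>M)"
proof -
  have B: "B \<ge> 0" using f order_trans[OF abs_ge_zero] by blast
  have iV: "integrable M V" using V by (intro integrable_const_bound[of _ C]) auto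
  have i: "integrable M (\<lambda>x. V x * f x)"
    by (rule Bochner_Integration.integrable_bound[OF integrable_mult_right[OF iV, of B]])
       (auto intro!: AE_I2 simp: abs_mult B mult.commute[of B] mult_left_mono f)
  have "\<bar>\<integral>x. V x * f x \<partial>M\<bar> \<le> (\<integral>x. \<bar>V x * f x\<bar> \<partial>M)" by (rule integral_abs_bound)
  also have "\<dots> \<le> (\<integral>x. B * V x \<partial>M)"
    using integrable_abs[OF i] iV V f by (intro integral_mono) (auto simp: abs_mult mult.commute[of B] intro!: mult_left_mono)
  finally show ?thesis by simp
qed

text \<open>Normalising the weights turns them into probability densities, so that the one-dimensional
  continuity theorem of Levy applies.\<close>
lemma weighted_char_conv_imp_integral_conv:
  fixes Y V :: "nat \<Rightarrow> 'a \<Rightarrow> real" and Y' V' :: "'b \<Rightarrow> real"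
  assumes M: "prob_space M" and N: "prob_space N"
    and [measurable]: "\<And>n. Y n \<in> borel_measurable M" "\<And>n. V n \<in> borel_measurable M"
      "Y' \<in> borel_measurable N" "V' \<in> borel_measurable N"
    and V: "\<And>n x. x \<in> space M \<Longrightarrow> 0 \<le> V n x" "\<And>n x. x \<in> space M \<Longrightarrow> V n x \<le> C"
    and V': "\<And>x. x \<in> space N \<Longrightarrow> 0 \<le> V' x" "\<And>x. x \<in> space N \<Longrightarrow> V' x \<le> C"
    and ch: "\<And>t. (\<lambda>n. \<integral>x. V n x *\<^sub>R iexp (t * Y n x) \<partial>M) \<longlonglongrightarrow> (\<integral>x. V' x *\<^sub>R iexp (t * Y' x) \<partial>N)"
    and f: "\<And>x. isCont f x" "\<And>x. \<bar>f x\<bar> \<le> (B::real)"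
  shows "(\<lambda>n. \<integral>x. V n x * f (Y n x) \<partial>M) \<longlonglongrightarrow> (\<integral>x. V' x * f (Y' x) \<partial>N)"
proof -
  interpret M: prob_space M by fact
  interpret N: prob_space N by fact
  have [measurable]: "f \<in> borel_measurable borel"
    using f(1) by (intro borel_measurable_continuous_onI continuous_at_imp_continuous_on) auto
  have bM: "\<bar>\<integral>x. V n x * f (Y n x) \<partial>M\<bar> \<le> B * (\<integral>x. V n x \<partial>M)" for n
    by (rule M.weighted_integral_bound[OF _ _ V f(2)]) auto
  have bN: "\<bar>\<integral>x. V' x * f (Y' x) \<partial>N\<bar> \<le> B * (\<integral>x. V' x \<partial>N)"
    by (rule N.weighted_integral_bound[OF _ _ V' f(2)]) auto
  have R: "(\<integral>x. V x *\<^sub>R iexp (0 * Y x) \<partial>K) = complex_of_real (\<integral>x. V x \<partial>K)" for V Y :: "'c \<Rightarrow> real" and K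
    by (simp add: scaleR_conv_of_real)
  \<comment> \<open>Frequency 0 turns the hypothesis into convergence of the total weights.\<close>
  have cc: "(\<lambda>n. \<integral>x. V n x \<partial>M) \<longlonglongrightarrow> (\<integral>x. V' x \<partial>N)"
    using tendsto_Re[OF ch[of 0]] unfolding R by simp
  have nn: "(\<integral>x. V' x \<partial>N) \<ge> 0" by (intro integral_nonneg_AE AE_I2 V')
  show ?thesis
  proof (cases "(\<integral>x. V' x \<partial>N) = 0")
    case True
    \<comment> \<open>With zero limiting weight there is no limit law to normalise; both sides then
      tend to 0 because \<open>f\<close> is bounded.\<close>
    have l: "(\<lambda>n. B * (\<integral>x. V n x \<partial>M)) \<longlonglongrightarrow> 0" using tendsto_mult_left[OF cc, of B] True by simp
    have "(\<lambda>n. \<integral>x. V n x * f (Y n x) \<partial>M) \<longlonglongrightarrow> 0"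
      by (rule Lim_null_comparison[OF always_eventually l]) (simp add: bM)
    then show ?thesis using bN True by simp
  next
    case False
    with nn have p: "(\<integral>x. V' x \<partial>N) > 0" by simp
    from order_tendstoD(1)[OF cc this] obtain n0 where n0: "\<And>n. n \<ge> n0 \<Longrightarrow> (\<integral>x. V n x \<partial>M) > 0"
      by (auto simp: eventually_sequentially)
    have "(\<lambda>n. \<integral>x. V (n+n0) x * f (Y (n+n0) x) \<partial>M) \<longlonglongrightarrow> (\<integral>x. V' x * f (Y' x) \<partial>N)"
      by (rule weighted_char_conv_imp_integral_conv_pos[where V="\<lambda>n. V (n + n0)" and V'=V' and Y="\<lambda>n. Y (n + n0)" and Y'=Y' and f=f,
            OF M N _ _ _ _ V V' LIMSEQ_ignore_initial_segment[OF ch] LIMSEQ_ignore_initial_segment[OF cc] n0 p f]) auto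
    then show ?thesis by (rule LIMSEQ_offset)
  qed
qed

lemma (in prob_space) integrable_weighted:
  fixes V :: "'a \<Rightarrow> real" and z :: "'a \<Rightarrow> 'b::{banach,second_countable_topology}"
  assumes "V \<in> borel_measurable M" "\<And>x. x \<in> space M \<Longrightarrow> 0 \<le> V x" "\<And>x. x \<in> space M \<Longrightarrow> V x \<le> C"
    and "z \<in> borel_measurable M" "\<And>x. norm (z x) \<le> 1"
  shows "integrable M (\<lambda>x. V x *\<^sub>R z x)"
proof (intro integrable_const_bound[of _ C] AE_I2)
  show "norm (V x *\<^sub>R z x) \<le> C" if "x \<in> space M" for x
    using mult_mono[of "V x" C "norm (z x)" 1] assms(2,3)[OF that] assms(5)[of x] by simp
qed (use assms(1,4) in measurable)

text \<open>Since Re z = (z + cnj z) / 2, the tilt only shifts the frequency by S and by -S, so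
  characteristic integrals under the tilted weight are combinations of untilted ones.\<close>

lemma (in prob_space) tilted_char:
  fixes V S Y :: "'a \<Rightarrow> real"
  assumes [measurable]: "V \<in> borel_measurable M" "S \<in> borel_measurable M" "Y \<in> borel_measurable M"
    and V: "\<And>x. x \<in> space M \<Longrightarrow> 0 \<le> V x" "\<And>x. x \<in> space M \<Longrightarrow> V x \<le> C"
  shows "(\<integral>x. (V x * (1 + Re (\<kappa> * iexp (S x)))) *\<^sub>R iexp (Y x) \<partial>M) = (\<integral>x. V x *\<^sub>R iexp (Y x) \<partial>M)
    + \<kappa> / 2 * (\<integral>x. V x *\<^sub>R iexp (S x + Y x) \<partial>M) + cnj \<kappa> / 2 * (\<integral>x. V x *\<^sub>R iexp (- S x + Y x) \<partial>M)"
proof -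
  have i: "integrable M (\<lambda>x. V x *\<^sub>R iexp (T x))" if [measurable]: "T \<in> borel_measurable M" for T :: "'a \<Rightarrow> real"
    using V by (intro integrable_weighted) auto
  have R: "complex_of_real (Re z) = (z + cnj z) / 2" for z using complex_add_cnj[of z] by simp
  have gen: "v * (1 + (a * z + b * z') / 2) * y = v * y + a / 2 * (v * (z * y)) + b / 2 * (v * (z' * y))" for v a b z z' y :: complex
    by (simp add: algebra_simps add_divide_distrib)
  have pw: "(V x * (1 + Re (\<kappa> * iexp (S x)))) *\<^sub>R iexp (Y x)
    = V x *\<^sub>R iexp (Y x) + \<kappa> / 2 * (V x *\<^sub>R iexp (S x + Y x)) + cnj \<kappa> / 2 * (V x *\<^sub>R iexp (- S x + Y x))" for x
  proof -
    have "cnj (\<kappa> * iexp (S x)) = cnj \<kappa> * iexp (- S x)" by (simp add: exp_cnj)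
    moreover have "iexp (T + Y x) = iexp T * iexp (Y x)" for T by (simp add: exp_add distrib_left)
    ultimately show ?thesis by (simp only: scaleR_conv_of_real of_real_mult of_real_add of_real_1 R gen)
  qed
  have I1: "integrable M (\<lambda>x. V x *\<^sub>R iexp (Y x))" and I2: "integrable M (\<lambda>x. \<kappa> / 2 * (V x *\<^sub>R iexp (S x + Y x)))"
    and I3: "integrable M (\<lambda>x. cnj \<kappa> / 2 * (V x *\<^sub>R iexp (- S x + Y x)))"
    by (intro i integrable_mult_right; measurable)+
  show ?thesis
    by (simp only: pw Bochner_Integration.integral_add[OF Bochner_Integration.integrable_add[OF I1 I2] I3]
        Bochner_Integration.integral_add[OF I1 I2] integral_mult_right_zero)
qed

text \<open>One coordinate at a time, the exponential factor is replaced by a bounded continuous function;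
  the remaining exponential is absorbed into the nonnegative weight 1 + Re (k exp (i S)).\<close>
lemma prod_integral_conv:
  fixes Y :: "nat \<Rightarrow> 'i \<Rightarrow> 'a \<Rightarrow> real" and Y' :: "'i \<Rightarrow> 'b \<Rightarrow> real"
    and V :: "nat \<Rightarrow> 'a \<Rightarrow> real" and V' :: "'b \<Rightarrow> real"
  assumes M: "prob_space M" and N: "prob_space N" and I: "finite I"
    and mY: "\<And>n i. i \<in> I \<Longrightarrow> Y n i \<in> borel_measurable M"
      "\<And>i. i \<in> I \<Longrightarrow> Y' i \<in> borel_measurable N"
    and "\<And>n. V n \<in> borel_measurable M" "V' \<in> borel_measurable N"
    and "\<And>n x. x \<in> space M \<Longrightarrow> 0 \<le> V n x" "\<And>n x. x \<in> space M \<Longrightarrow> V n x \<le> C"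
    and "\<And>x. x \<in> space N \<Longrightarrow> 0 \<le> V' x" "\<And>x. x \<in> space N \<Longrightarrow> V' x \<le> C"
    and "\<And>t. (\<lambda>n. \<integral>x. V n x *\<^sub>R iexp (\<Sum>i\<in>I. t i * Y n i x) \<partial>M) \<longlonglongrightarrow> (\<integral>x. V' x *\<^sub>R iexp (\<Sum>i\<in>I. t i * Y' i x) \<partial>N)"
    and f: "\<And>i x. i \<in> I \<Longrightarrow> isCont (f i) x" "\<And>i x. i \<in> I \<Longrightarrow> 0 \<le> f i x" "\<And>i x. i \<in> I \<Longrightarrow> f i x \<le> (1::real)"
  shows "(\<lambda>n. \<integral>x. V n x * (\<Prod>i\<in>I. f i (Y n i x)) \<partial>M) \<longlonglongrightarrow> (\<integral>x. V' x * (\<Prod>i\<in>I. f i (Y' i x)) \<partial>N)"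
  using I mY assms(6-)
proof (induction I arbitrary: V V' C rule: finite_induct)
  case empty
  from tendsto_Re[OF empty(9)[of undefined]] show ?case by (simp add: scaleR_conv_of_real)
next
  case (insert a I V V' C)
  interpret M: prob_space M by fact
  interpret N: prob_space N by fact
  note [measurable] = insert.prems(1-4)
  note V = insert.prems(5,6) and V' = insert.prems(7,8) and chI = insert.prems(9)
  note f = insert.prems(10-12)
  have [measurable]: "f a \<in> borel_measurable borel"
    using f(1) by (intro borel_measurable_continuous_onI continuous_at_imp_continuous_on) auto
  have [measurable]: "i \<in> I \<Longrightarrow> Y n i \<in> borel_measurable M" "i \<in> I \<Longrightarrow> Y' i \<in> borel_measurable N" for n i by auto
  have [measurable]: "Y n a \<in> borel_measurable M" "Y' a \<in> borel_measurable N" for n by auto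
  define S where "S t n x = (\<Sum>i\<in>I. t i * Y n i x)" for t n x
  define S' where "S' t x = (\<Sum>i\<in>I. t i * Y' i x)" for t x
  have [measurable]: "S t n \<in> borel_measurable M" "S' t \<in> borel_measurable N" for t n
    unfolding S_def[abs_def] S'_def[abs_def] by auto
  have ins: "(\<Sum>i\<in>insert a I. (t(a := s)) i * y i) = (\<Sum>i\<in>I. t i * y i) + s * y a" for t y :: "'i \<Rightarrow> real" and s
  proof -
    have "(\<Sum>i\<in>I. (t(a := s)) i * y i) = (\<Sum>i\<in>I. t i * y i)" using insert.hyps by (intro sum.cong) auto
    then show ?thesis using insert.hyps by simp
  qed
  have chS: "(\<lambda>n. \<integral>x. V n x *\<^sub>R iexp (S t n x + s * Y n a x) \<partial>M) \<longlonglongrightarrow> (\<integral>x. V' x *\<^sub>R iexp (S' t x + s * Y' a x) \<partial>N)" for t s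
    using chI[of "t(a := s)"] unfolding ins S_def S'_def .
  have ch0: "(\<lambda>n. \<integral>x. V n x *\<^sub>R iexp (s * Y n a x) \<partial>M) \<longlonglongrightarrow> (\<integral>x. V' x *\<^sub>R iexp (s * Y' a x) \<partial>N)" for s
    using chS[of "\<lambda>_. 0"] by (simp add: S_def S'_def)
  have chm: "(\<lambda>n. \<integral>x. V n x *\<^sub>R iexp (- S t n x + s * Y n a x) \<partial>M) \<longlonglongrightarrow> (\<integral>x. V' x *\<^sub>R iexp (- S' t x + s * Y' a x) \<partial>N)" for t s
    using chS[of "\<lambda>i. - t i"] by (simp add: S_def S'_def sum_negf)
  have fa: "isCont (f a) x" "0 \<le> f a x" "f a x \<le> 1" "\<bar>f a x\<bar> \<le> 1" for x
    using f[of a x] by auto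
  have base: "(\<lambda>n. \<integral>x. V n x * f a (Y n a x) \<partial>M) \<longlonglongrightarrow> (\<integral>x. V' x * f a (Y' a x) \<partial>N)"
    by (rule weighted_char_conv_imp_integral_conv[where C=C and B=1 and V=V and V'=V' and Y="\<lambda>n. Y n a" and Y'="Y' a" and f="f a", OF M N _ _ _ _ V V' ch0 fa(1,4)]) auto
  have Vf: "0 \<le> V n x * f a (Y n a x)" "V n x * f a (Y n a x) \<le> C" if "x \<in> space M" for n x
    using V[OF that, of n] fa[of "Y n a x"] mult_mono[of "V n x" C "f a (Y n a x)" 1] by auto
  have Vf': "0 \<le> V' x * f a (Y' a x)" "V' x * f a (Y' a x) \<le> C" if "x \<in> space N" for x
    using V'[OF that] fa[of "Y' a x"] mult_mono[of "V' x" C "f a (Y' a x)" 1] by auto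
  have iM: "integrable M (\<lambda>x. (V n x * f a (Y n a x)) *\<^sub>R z x)" if "z \<in> borel_measurable M" "\<And>x. norm (z x) \<le> 1" for n and z :: "'a \<Rightarrow> 'c::{banach,second_countable_topology}"
    using that Vf by (intro M.integrable_weighted) auto
  have iN: "integrable N (\<lambda>x. (V' x * f a (Y' a x)) *\<^sub>R z x)" if "z \<in> borel_measurable N" "\<And>x. norm (z x) \<le> 1" for z :: "'b \<Rightarrow> 'c::{banach,second_countable_topology}"
    using that Vf' by (intro N.integrable_weighted) auto
  \<comment> \<open>Convergence under the weight 1 + Re (\<kappa> exp (i S)) minus convergence under
    the weight 1 leaves the signed weight. The values \<kappa> = 1 and \<kappa> = -i later give the
    real and the imaginary part of exp (i S).\<close>
  have tilted: "(\<lambda>n. \<integral>x. (V n x * f a (Y n a x)) *\<^sub>R Re (\<kappa> * iexp (S t n x)) \<partial>M) \<longlonglongrightarrow> (\<integral>x. (V' x * f a (Y' a x)) *\<^sub>R Re (\<kappa> * iexp (S' t x)) \<partial>N)"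
    if k: "cmod \<kappa> = 1" for t \<kappa>
  proof -
    have g1: "\<bar>Re (\<kappa> * iexp y)\<bar> \<le> 1" for y using abs_Re_le_cmod[of "\<kappa> * iexp y"] k by (simp add: norm_mult)
    then have g2: "0 \<le> 1 + Re (\<kappa> * iexp y)" "1 + Re (\<kappa> * iexp y) \<le> 2" for y
      unfolding abs_le_iff by (smt (verit))+
    have "(\<lambda>n. \<integral>x. (V n x * (1 + Re (\<kappa> * iexp (S t n x)))) * f a (Y n a x) \<partial>M) \<longlonglongrightarrow> (\<integral>x. (V' x * (1 + Re (\<kappa> * iexp (S' t x)))) * f a (Y' a x) \<partial>N)"
    proof (rule weighted_char_conv_imp_integral_conv[where C="C*2" and B=1 and V="\<lambda>n x. V n x * (1 + Re (\<kappa> * iexp (S t n x)))" and V'="\<lambda>x. V' x * (1 + Re (\<kappa> * iexp (S' t x)))" and Y="\<lambda>n. Y n a" and Y'="Y' a" and f="f a"])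
      fix s
      have "(\<integral>x. (V n x * (1 + Re (\<kappa> * iexp (S t n x)))) *\<^sub>R iexp (s * Y n a x) \<partial>M) = (\<integral>x. V n x *\<^sub>R iexp (s * Y n a x) \<partial>M)
        + \<kappa> / 2 * (\<integral>x. V n x *\<^sub>R iexp (S t n x + s * Y n a x) \<partial>M) + cnj \<kappa> / 2 * (\<integral>x. V n x *\<^sub>R iexp (- S t n x + s * Y n a x) \<partial>M)" for n
        by (rule M.tilted_char[OF _ _ _ V]) auto
      moreover have "(\<integral>x. (V' x * (1 + Re (\<kappa> * iexp (S' t x)))) *\<^sub>R iexp (s * Y' a x) \<partial>N) = (\<integral>x. V' x *\<^sub>R iexp (s * Y' a x) \<partial>N)
        + \<kappa> / 2 * (\<integral>x. V' x *\<^sub>R iexp (S' t x + s * Y' a x) \<partial>N) + cnj \<kappa> / 2 * (\<integral>x. V' x *\<^sub>R iexp (- S' t x + s * Y' a x) \<partial>N)"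
        by (rule N.tilted_char[OF _ _ _ V']) auto
      ultimately show "(\<lambda>n. \<integral>x. (V n x * (1 + Re (\<kappa> * iexp (S t n x)))) *\<^sub>R iexp (s * Y n a x) \<partial>M) \<longlonglongrightarrow> (\<integral>x. (V' x * (1 + Re (\<kappa> * iexp (S' t x)))) *\<^sub>R iexp (s * Y' a x) \<partial>N)"
        by (simp only:) (intro tendsto_add tendsto_mult tendsto_const ch0 chS chm)
    next
      show "0 \<le> V n x * (1 + Re (\<kappa> * iexp (S t n x)))" "V n x * (1 + Re (\<kappa> * iexp (S t n x))) \<le> C * 2" if "x \<in> space M" for n x
        using V[OF that, of n] g2[of "S t n x"] by (auto intro!: mult_mono mult_nonneg_nonneg)
      show "0 \<le> V' x * (1 + Re (\<kappa> * iexp (S' t x)))" "V' x * (1 + Re (\<kappa> * iexp (S' t x))) \<le> C * 2" if "x \<in> space N" for x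
        using V'[OF that] g2[of "S' t x"] by (auto intro!: mult_mono mult_nonneg_nonneg)
    qed (auto intro!: M N fa)
    from tendsto_diff[OF this base] have
      d: "(\<lambda>n. (\<integral>x. V n x * (1 + Re (\<kappa> * iexp (S t n x))) * f a (Y n a x) \<partial>M) - (\<integral>x. V n x * f a (Y n a x) \<partial>M)) \<longlonglongrightarrow>
        (\<integral>x. V' x * (1 + Re (\<kappa> * iexp (S' t x))) * f a (Y' a x) \<partial>N) - (\<integral>x. V' x * f a (Y' a x) \<partial>N)" .
    have e1: "(\<integral>x. V n x * (1 + Re (\<kappa> * iexp (S t n x))) * f a (Y n a x) \<partial>M) = (\<integral>x. V n x * f a (Y n a x) \<partial>M) + (\<integral>x. (V n x * f a (Y n a x)) *\<^sub>R Re (\<kappa> * iexp (S t n x)) \<partial>M)" for n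
      using iM[of "\<lambda>x. 1::real" n] iM[of "\<lambda>x. Re (\<kappa> * iexp (S t n x))" n] g1
      by (subst Bochner_Integration.integral_add[symmetric]) (auto simp: algebra_simps)
    have e2: "(\<integral>x. V' x * (1 + Re (\<kappa> * iexp (S' t x))) * f a (Y' a x) \<partial>N) = (\<integral>x. V' x * f a (Y' a x) \<partial>N) + (\<integral>x. (V' x * f a (Y' a x)) *\<^sub>R Re (\<kappa> * iexp (S' t x)) \<partial>N)"
      using iN[of "\<lambda>x. 1::real"] iN[of "\<lambda>x. Re (\<kappa> * iexp (S' t x))"] g1
      by (subst Bochner_Integration.integral_add[symmetric]) (auto simp: algebra_simps)
    show ?thesis using d unfolding e1 e2 by simp
  qed
  \<comment> \<open>The factor for \<open>a\<close> now sits in the weight, which stays between 0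
    and C, so the induction hypothesis applies to the remaining coordinates.\<close>
  have "(\<lambda>n. \<integral>x. (V n x * f a (Y n a x)) * (\<Prod>i\<in>I. f i (Y n i x)) \<partial>M) \<longlonglongrightarrow> (\<integral>x. (V' x * f a (Y' a x)) * (\<Prod>i\<in>I. f i (Y' i x)) \<partial>N)"
  proof (rule insert.IH[where C=C and V="\<lambda>n x. V n x * f a (Y n a x)" and V'="\<lambda>x. V' x * f a (Y' a x)"])
    fix t
    have "(\<lambda>n. Re (\<integral>x. (V n x * f a (Y n a x)) *\<^sub>R iexp (S t n x) \<partial>M)) \<longlonglongrightarrow> Re (\<integral>x. (V' x * f a (Y' a x)) *\<^sub>R iexp (S' t x) \<partial>N)"
      using tilted[of 1 t] by (simp add: iM iN flip: integral_Re)
    moreover have "(\<lambda>n. Im (\<integral>x. (V n x * f a (Y n a x)) *\<^sub>R iexp (S t n x) \<partial>M)) \<longlonglongrightarrow> Im (\<integral>x. (V' x * f a (Y' a x)) *\<^sub>R iexp (S' t x) \<partial>N)"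
      using tilted[of "- \<i>" t] by (simp add: iM iN flip: integral_Im)
    ultimately show "(\<lambda>n. \<integral>x. (V n x * f a (Y n a x)) *\<^sub>R iexp (\<Sum>i\<in>I. t i * Y n i x) \<partial>M) \<longlonglongrightarrow> (\<integral>x. (V' x * f a (Y' a x)) *\<^sub>R iexp (\<Sum>i\<in>I. t i * Y' i x) \<partial>N)"
      unfolding tendsto_complex_iff S_def S'_def by simp
  qed (use f Vf Vf' in auto)
  then show ?case using insert.hyps by (simp add: mult.assoc)
qed

section \<open>Product test functions and Stone-Weierstrass on a box\<close>

inductive_set prod_span :: "nat \<Rightarrow> ((nat \<Rightarrow> real) \<Rightarrow> real) set" for d where
  base: "(\<And>i x. isCont (f i) x) \<Longrightarrow> (\<And>i x. 0 \<le> f i x) \<Longrightarrow> (\<And>i x. f i x \<le> 1) \<Longrightarrow>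
    (\<lambda>x. c * (\<Prod>i<d. f i (x i))) \<in> prod_span d"
| add: "q \<in> prod_span d \<Longrightarrow> r \<in> prod_span d \<Longrightarrow> (\<lambda>x. q x + r x) \<in> prod_span d"

lemma prod_span_mult:
  assumes "q \<in> prod_span d" "r \<in> prod_span d" shows "(\<lambda>x. q x * r x) \<in> prod_span d"
  using assms(1)
proof induction
  case q: (base f c)
  show ?case using assms(2)
  proof induction
    case r: (base g c')
    have "(\<lambda>x. (c * c') * (\<Prod>i<d. f i (x i) * g i (x i))) \<in> prod_span d"
      using q r by (intro prod_span.base[of "\<lambda>i x. f i x * g i x"]) (auto intro!: continuous_intros mult_le_one)
    then show ?case by (simp add: prod.distrib mult_ac)
  next
    case (add r s)
    then show ?case using prod_span.add[OF add.IH] by (simp add: algebra_simps)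
  qed
next
  case (add q s)
  then show ?case using prod_span.add[OF add.IH] by (simp add: algebra_simps)
qed

lemma prod_span_const: "(\<lambda>x. c) \<in> prod_span d"
  using prod_span.base[of "\<lambda>_ _. 1" c d] by simp

lemma prod_span_continuous: "q \<in> prod_span d \<Longrightarrow> continuous_on UNIV q"
proof (induction rule: prod_span.induct)
  case (base f c)
  have "continuous_on UNIV (\<lambda>x::nat\<Rightarrow>real. f i (x i))" for i
    by (rule continuous_on_compose2[of UNIV "f i"])
       (auto intro!: base continuous_at_imp_continuous_on continuous_on_product_coordinates)
  then show ?case by (intro continuous_intros)
qed (auto intro!: continuous_intros)

text \<open>Projection onto a compact subset of the product space: fixing the coordinates from
  \<open>d\<close> on at 0 makes the image compact, and functions of the first \<open>d\<close>
  coordinates do not see it.\<close>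

definition clamp_box :: "nat \<Rightarrow> real \<Rightarrow> (nat \<Rightarrow> real) \<Rightarrow> nat \<Rightarrow> real" where
  "clamp_box d R x = (\<lambda>i. if i < d then max (-R) (min R (x i)) else 0)"

text \<open>Distinct points of the box differ in some coordinate a < d, and the ramp (x + R) / (2 R)
  in that coordinate, truncated to [0, 1], is injective on [-R, R]. Hence the algebra separates
  points and Stone-Weierstrass applies.\<close>

lemma prod_span_dense:
  fixes \<phi> :: "(nat \<Rightarrow> real) \<Rightarrow> real"
  assumes "continuous_on UNIV \<phi>" "R > 0" "e > 0"
  obtains q where "q \<in> prod_span d" "\<And>x. \<bar>\<phi> (clamp_box d R x) - q (clamp_box d R x)\<bar> < e"
proof -
  define S where "S = {x::nat\<Rightarrow>real. \<forall>i. x i \<in> (if i < d then {-R..R} else {0})}"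
  have S: "S = PiE UNIV (\<lambda>i. if i < d then {-R..R} else {0})" by (auto simp: S_def PiE_def Pi_def)
  have "compactin (product_topology (\<lambda>i::nat. euclidean) UNIV) S"
    unfolding S by (subst compactin_PiE) auto
  then have "compact S" by (simp add: euclidean_product_topology)
  interpret function_ring_on "prod_span d" S
  proof
    show "compact S" by fact
    show "continuous_on S f" if "f \<in> prod_span d" for f
      using prod_span_continuous[OF that] continuous_on_subset by blast
    show "\<exists>f\<in>prod_span d. f x \<noteq> f y" if xy: "x \<in> S" "y \<in> S" "x \<noteq> y" for x y
    proof -
      obtain a where a: "x a \<noteq> y a" using xy by auto
      then have ad: "a < d" using xy unfolding S_def mem_Collect_eq by (metis singletonD)
      define f where "f i z = (if i = a then max 0 (min 1 ((z + R) / (2*R))) else 1)" for i z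
      have "(\<lambda>x. 1 * (\<Prod>i<d. f i (x i))) \<in> prod_span d"
      proof (rule prod_span.base)
        show "isCont (f i) z" for i z
          unfolding f_def using assms(2) by (cases "i = a") (auto intro!: continuous_intros)
      qed (auto simp: f_def)
      moreover have "(\<Prod>i<d. f i (z i)) = (z a + R) / (2*R)" if "z \<in> S" for z
      proof -
        have "(\<Prod>i<d. f i (z i)) = (\<Prod>i<d. if i = a then f a (z a) else 1)"
          by (intro prod.cong) (auto simp: f_def)
        also have "\<dots> = f a (z a)" using ad by (simp add: prod.delta)
        also have "z a \<in> {-R..R}" using that ad by (auto simp: S_def split: if_splits)
        then have "f a (z a) = (z a + R) / (2*R)" using assms(2) by (auto simp: f_def max_def min_def divide_simps)
        finally show ?thesis .
      qed
      ultimately show ?thesis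
        using xy(1,2) a assms(2) by (intro bexI[of _ "\<lambda>x. 1 * (\<Prod>i<d. f i (x i))"]) auto
    qed
  qed (auto intro: prod_span.add prod_span_mult prod_span_const)
  have "continuous_on S \<phi>" using assms(1) continuous_on_subset by blast
  from Stone_Weierstrass_basic[OF this assms(3)] obtain q where q: "q \<in> prod_span d" "\<forall>x\<in>S. \<bar>\<phi> x - q x\<bar> < e" by auto
  have "clamp_box d R x \<in> S" for x using assms(2) by (auto simp: clamp_box_def S_def)
  then show ?thesis using q by (intro that[of q]) auto
qed

lemma lipschitz_coords_continuous:
  fixes \<phi> :: "(nat \<Rightarrow> real) \<Rightarrow> real"
  assumes "\<And>x y. \<bar>\<phi> x - \<phi> y\<bar> \<le> L * (\<Sum>i<d. \<bar>x i - y i\<bar>)"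
  shows "continuous_on UNIV \<phi>"
proof (intro continuous_at_imp_continuous_on ballI)
  fix x
  have c: "(\<lambda>y::nat\<Rightarrow>real. y i) \<midarrow>x\<rightarrow> x i" for i
  proof -
    have "continuous_on UNIV (\<lambda>y::nat\<Rightarrow>real. y i)" by simp
    then show ?thesis unfolding continuous_on_def by simp
  qed
  have "(\<lambda>y. L * (\<Sum>i<d. \<bar>y i - x i\<bar>)) \<midarrow>x\<rightarrow> L * (\<Sum>i<d. \<bar>x i - x i\<bar>)"
    by (intro tendsto_intros c)
  then have l: "(\<lambda>y. L * (\<Sum>i<d. \<bar>y i - x i\<bar>)) \<midarrow>x\<rightarrow> 0" by simp
  have "(\<lambda>y. \<phi> y - \<phi> x) \<midarrow>x\<rightarrow> 0"
    by (rule Lim_null_comparison[OF always_eventually l]) (simp add: assms)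
  then show "isCont \<phi> x" by (simp add: isCont_def LIM_zero_iff)
qed

text \<open>Cramer-Wold for bounded Lipschitz test functions. On a box \<phi> is approximated by
  \<open>prod_span\<close>, whose integrals converge by \<open>prod_integral_conv\<close>. Off the
  box the error is dominated by one minus a product of cutoffs; the integrals of this converge as
  well, so tightness is deduced and not assumed.\<close>

lemma findim_conv:
  fixes Y :: "nat \<Rightarrow> nat \<Rightarrow> 'a \<Rightarrow> real" and Y' :: "nat \<Rightarrow> 'b \<Rightarrow> real" and \<phi> :: "(nat \<Rightarrow> real) \<Rightarrow> real"
  assumes M: "prob_space M" and N: "prob_space N"
    and [measurable]: "\<And>n i. Y n i \<in> borel_measurable M" "\<And>i. Y' i \<in> borel_measurable N"
    and ch: "\<And>t. (\<lambda>n. \<integral>x. iexp (\<Sum>i<d. t i * Y n i x) \<partial>M) \<longlonglongrightarrow> (\<integral>x. iexp (\<Sum>i<d. t i * Y' i x) \<partial>N)"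
    and B: "\<And>x. \<bar>\<phi> x\<bar> \<le> B" and L: "\<And>x y. \<bar>\<phi> x - \<phi> y\<bar> \<le> L * (\<Sum>i<d. \<bar>x i - y i\<bar>)"
  shows "(\<lambda>n. \<integral>x. \<phi> (\<lambda>i. Y n i x) \<partial>M) \<longlonglongrightarrow> (\<integral>x. \<phi> (\<lambda>i. Y' i x) \<partial>N)"
proof -
  interpret M: prob_space M by fact
  interpret N: prob_space N by fact
  note cont = lipschitz_coords_continuous[OF L]
  have B0: "B \<ge> 0" using B[of undefined] by linarith
  have mM[measurable]: "(\<lambda>x i. Y n i x) \<in> measurable M borel" for n
    by (intro measurable_coordinatewise_then_product) auto
  have mN[measurable]: "(\<lambda>x i. Y' i x) \<in> measurable N borel"
    by (intro measurable_coordinatewise_then_product) auto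
  have [measurable]: "\<phi> \<in> borel_measurable borel" by (intro borel_measurable_continuous_onI cont)
  have prodc: "(\<lambda>n. \<integral>x. (\<Prod>i<d. f i (Y n i x)) \<partial>M) \<longlonglongrightarrow> (\<integral>x. (\<Prod>i<d. f i (Y' i x)) \<partial>N)"
    if "\<And>i x. isCont (f i) x" "\<And>i x. 0 \<le> f i x" "\<And>i x. f i x \<le> (1::real)" for f :: "nat \<Rightarrow> real \<Rightarrow> real"
  proof -
    have "(\<lambda>n. \<integral>x. (\<lambda>_ _. 1) n x * (\<Prod>i<d. f i (Y n i x)) \<partial>M) \<longlonglongrightarrow> (\<integral>x. (\<lambda>_. 1) x * (\<Prod>i<d. f i (Y' i x)) \<partial>N)"
      by (rule prod_integral_conv[OF M N, where C=1]) (use ch in \<open>auto intro!: that\<close>)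
    then show ?thesis by simp
  qed
  \<comment> \<open>Clamping acts coordinatewise, so it is absorbed into the factors, which stay
    continuous with values in [0, 1].\<close>
  have spanc: "\<exists>C. (\<forall>x. \<bar>q (clamp_box d R x)\<bar> \<le> C) \<and> (\<lambda>x. q (clamp_box d R x)) \<in> borel_measurable borel \<and> 
      (\<lambda>n. \<integral>x. q (clamp_box d R (\<lambda>i. Y n i x)) \<partial>M) \<longlonglongrightarrow> (\<integral>x. q (clamp_box d R (\<lambda>i. Y' i x)) \<partial>N)"
    if "q \<in> prod_span d" for q R
    using that
  proof induction
    case (base f c)
    define g where "g i z = f i (max (-R) (min R z))" for i z
    have g: "isCont (g i) x" "0 \<le> g i x" "g i x \<le> 1" for i x
      unfolding g_def[abs_def]
      by (rule isCont_o2[where g="f i" and f="\<lambda>z. max (-R) (min R z)"], intro continuous_intros) (rule base)+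
    have e: "(\<Prod>i<d. f i (clamp_box d R x i)) = (\<Prod>i<d. g i (x i))" for x
      by (intro prod.cong) (auto simp: g_def clamp_box_def)
    have "\<bar>\<Prod>i<d. g i (x i)\<bar> \<le> 1" for x :: "nat \<Rightarrow> real"
      using g by (auto simp: abs_prod intro!: prod_le_1)
    then have "\<bar>c * (\<Prod>i<d. g i (x i))\<bar> \<le> \<bar>c\<bar>" for x :: "nat \<Rightarrow> real"
      using mult_left_mono[of "\<bar>\<Prod>i<d. g i (x i)\<bar>" 1 "\<bar>c\<bar>"] by (simp add: abs_mult)
    moreover have "continuous_on UNIV (\<lambda>x. c * (\<Prod>i<d. g i (x i)))"
      by (intro prod_span_continuous[of _ d] prod_span.base g)
    moreover have "(\<lambda>n. c * (\<integral>x. (\<Prod>i<d. g i (Y n i x)) \<partial>M)) \<longlonglongrightarrow> c * (\<integral>x. (\<Prod>i<d. g i (Y' i x)) \<partial>N)"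
      by (intro tendsto_intros prodc g)
    ultimately show ?case unfolding e by (auto intro!: exI[of _ "\<bar>c\<bar>"] borel_measurable_continuous_onI)
  next
    case (add q r)
    obtain C1 where 1: "\<And>x. \<bar>q (clamp_box d R x)\<bar> \<le> C1" and [measurable]: "(\<lambda>x. q (clamp_box d R x)) \<in> borel_measurable borel" and
      c1: "(\<lambda>n. \<integral>x. q (clamp_box d R (\<lambda>i. Y n i x)) \<partial>M) \<longlonglongrightarrow> (\<integral>x. q (clamp_box d R (\<lambda>i. Y' i x)) \<partial>N)"
      using add.IH(1) by blast
    obtain C2 where 2: "\<And>x. \<bar>r (clamp_box d R x)\<bar> \<le> C2" and [measurable]: "(\<lambda>x. r (clamp_box d R x)) \<in> borel_measurable borel" and
      c2: "(\<lambda>n. \<integral>x. r (clamp_box d R (\<lambda>i. Y n i x)) \<partial>M) \<longlonglongrightarrow> (\<integral>x. r (clamp_box d R (\<lambda>i. Y' i x)) \<partial>N)"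
      using add.IH(2) by blast
    have [measurable]: "(\<lambda>x. q (clamp_box d R (\<lambda>i. Y n i x))) \<in> borel_measurable M" "(\<lambda>x. r (clamp_box d R (\<lambda>i. Y n i x))) \<in> borel_measurable M" for n
      by measurable
    have iM: "integrable M (\<lambda>x. q (clamp_box d R (\<lambda>i. Y n i x)))" "integrable M (\<lambda>x. r (clamp_box d R (\<lambda>i. Y n i x)))" for n
      by (rule M.integrable_const_bound[of _ C1], simp add: 1, simp, rule M.integrable_const_bound[of _ C2]) (simp_all add: 2)
    have iN: "integrable N (\<lambda>x. q (clamp_box d R (\<lambda>i. Y' i x)))" "integrable N (\<lambda>x. r (clamp_box d R (\<lambda>i. Y' i x)))"
      by (rule N.integrable_const_bound[of _ C1], simp add: 1, simp, rule N.integrable_const_bound[of _ C2]) (simp_all add: 2)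
    have "\<bar>q (clamp_box d R x) + r (clamp_box d R x)\<bar> \<le> C1 + C2" for x
      using 1[of x] 2[of x] by linarith
    then show ?case using iM iN tendsto_add[OF c1 c2] by (auto intro!: exI[of _ "C1+C2"])
  qed
  \<comment> \<open>A cutoff equal to 1 for \<bar>z\<bar> \<le> R - 1 and to 0 for \<bar>z\<bar>
    \<ge> R, so \<open>h R\<close> below is 1 outside the box.\<close>
  define g where "g R z = max 0 (min 1 (R - \<bar>z\<bar>))" for R z :: real
  have g: "isCont (g R) z" "0 \<le> g R z" "g R z \<le> 1" for R z
    by (auto simp: g_def[abs_def] intro!: continuous_intros)
  define h where "h R x = (1 - (\<Prod>i<d. g R (x i)))" for R and x :: "nat \<Rightarrow> real"
  have pg: "0 \<le> (\<Prod>i<d. g R (x i))" "(\<Prod>i<d. g R (x i)) \<le> 1" for R and x :: "nat \<Rightarrow> real"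
    using g by (auto intro!: prod_nonneg prod_le_1)
  have h01: "0 \<le> h R x" "h R x \<le> 1" for R x
    using pg[of R x] by (auto simp: h_def)
  have [measurable]: "h R \<in> borel_measurable borel" for R
  proof -
    have "(\<lambda>x. 1 * (\<Prod>i<d. g R (x i))) \<in> prod_span d" by (intro prod_span.base g)
    from continuous_on_diff[OF continuous_on_const prod_span_continuous[OF this], of 1]
    have "continuous_on UNIV (h R)" by (simp add: h_def[abs_def])
    then show ?thesis by (rule borel_measurable_continuous_onI)
  qed
  have iprod: "integrable M (\<lambda>x. (\<Prod>i<d. g R (Y n i x)))" "integrable N (\<lambda>x. (\<Prod>i<d. g R (Y' i x)))" for R n
    using pg by (auto intro!: M.integrable_const_bound[of _ 1] N.integrable_const_bound[of _ 1] simp: g_def)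
  have hc: "(\<lambda>n. \<integral>x. h R (\<lambda>i. Y n i x) \<partial>M) \<longlonglongrightarrow> (\<integral>x. h R (\<lambda>i. Y' i x) \<partial>N)" for R
    unfolding h_def using tendsto_diff[OF tendsto_const prodc[of "\<lambda>i. g R", OF g], of 1] iprod by (simp add: M.prob_space N.prob_space)
  have hlim: "(\<lambda>m. \<integral>x. h (real m) (\<lambda>i. Y' i x) \<partial>N) \<longlonglongrightarrow> 0"
  proof -
    have "(\<lambda>m. \<integral>x. h (real m) (\<lambda>i. Y' i x) \<partial>N) \<longlonglongrightarrow> (\<integral>x. 0 \<partial>N)"
    proof (rule integral_dominated_convergence[where w="\<lambda>_. 1"])
      show "AE x in N. (\<lambda>m. h (real m) (\<lambda>i. Y' i x)) \<longlonglongrightarrow> 0"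
      proof (rule AE_I2)
        fix x
        have "(\<lambda>m. g (real m) z) \<longlonglongrightarrow> 1" for z
        proof (rule tendsto_eventually)
          have "\<forall>\<^sub>F m in sequentially. real m \<ge> 1 + \<bar>z\<bar>" using filterlim_real_sequentially by (auto simp: filterlim_at_top)
          then show "\<forall>\<^sub>F m in sequentially. g (real m) z = 1" by eventually_elim (auto simp: g_def)
        qed
        then have "(\<lambda>m. 1 - (\<Prod>i<d. g (real m) (Y' i x))) \<longlonglongrightarrow> 1 - (\<Prod>i<d. 1)" by (intro tendsto_intros)
        then show "(\<lambda>m. h (real m) (\<lambda>i. Y' i x)) \<longlonglongrightarrow> 0" by (simp add: h_def)
      qed
    qed (use h01 in auto)
    then show ?thesis by simp
  qed
  have cb: "\<bar>\<phi> x - \<phi> (clamp_box d R x)\<bar> \<le> 2 * B * h R x" for R x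
  proof (cases "\<forall>i<d. \<bar>x i\<bar> \<le> R")
    case True
    then have "(\<Sum>i<d. \<bar>x i - clamp_box d R x i\<bar>) = (\<Sum>i<d. 0)" by (intro sum.cong) (auto simp: clamp_box_def abs_le_iff)
    then have "\<bar>\<phi> x - \<phi> (clamp_box d R x)\<bar> \<le> 0" using L[of x "clamp_box d R x"] by simp
    then show ?thesis using h01(1)[of R x] B0 by (meson mult_nonneg_nonneg order_trans zero_le_numeral)
  next
    case False
    then obtain i where "i < d" "g R (x i) = 0" by (auto simp: g_def not_le)
    then have "h R x = 1" by (auto simp: h_def)
    then show ?thesis using B[of x] B[of "clamp_box d R x"] by simp
  qed
  show ?thesis
  proof (rule LIMSEQ_I)
    fix r :: real assume "r > 0"
    \<comment> \<open>The total error stays below 5 e: twice (e + e) for replacing \<phi> by q under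
      \<open>M\<close> and under \<open>N\<close>, and e for the convergence of the integrals of
      q.\<close>
    define e where "e = r / 8"
    have e: "e > 0" using \<open>r > 0\<close> by (simp add: e_def)
    have "(\<lambda>m. 2 * B * (\<integral>x. h (real m) (\<lambda>i. Y' i x) \<partial>N)) \<longlonglongrightarrow> 2 * B * 0" by (intro tendsto_intros hlim)
    then have "\<forall>\<^sub>F m in sequentially. 2 * B * (\<integral>x. h (real m) (\<lambda>i. Y' i x) \<partial>N) < e" using e by (intro order_tendstoD) auto
    then obtain m where m: "m > 0" "2 * B * (\<integral>x. h (real m) (\<lambda>i. Y' i x) \<partial>N) < e"
      using eventually_happens'[OF sequentially_bot eventually_conj[OF _ eventually_gt_at_top[of 0]]] by (metis (lifting))
    define R where "R = real m"
    have R: "R > 0" using m by (simp add: R_def)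
    obtain q where q: "q \<in> prod_span d" "\<And>x. \<bar>\<phi> (clamp_box d R x) - q (clamp_box d R x)\<bar> < e"
      using prod_span_dense[OF cont R e] by blast
    obtain C where C: "\<And>x. \<bar>q (clamp_box d R x)\<bar> \<le> C" and [measurable]: "(\<lambda>x. q (clamp_box d R x)) \<in> borel_measurable borel" and
      c1: "(\<lambda>n. \<integral>x. q (clamp_box d R (\<lambda>i. Y n i x)) \<partial>M) \<longlonglongrightarrow> (\<integral>x. q (clamp_box d R (\<lambda>i. Y' i x)) \<partial>N)"
      using spanc[OF q(1)] by blast
    have pw: "\<bar>\<phi> x - q (clamp_box d R x)\<bar> \<le> e + 2 * B * h R x" for x
      using cb[of x R] q(2)[of x] by linarith
    have gen: "\<bar>(\<integral>x. \<phi> (\<lambda>i. W i x) \<partial>K) - (\<integral>x. q (clamp_box d R (\<lambda>i. W i x)) \<partial>K)\<bar> \<le> e + 2 * B * (\<integral>x. h R (\<lambda>i. W i x) \<partial>K)"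
      if K: "prob_space K" and [measurable]: "(\<lambda>x i. W i x) \<in> measurable K borel" for K :: "'c measure" and W
    proof -
      interpret K: prob_space K by fact
      have [measurable]: "(\<lambda>x. q (clamp_box d R (\<lambda>i. W i x))) \<in> borel_measurable K" by measurable
      have i1: "integrable K (\<lambda>x. \<phi> (\<lambda>i. W i x))" using B by (intro K.integrable_const_bound[of _ B]) auto
      have i2: "integrable K (\<lambda>x. q (clamp_box d R (\<lambda>i. W i x)))" using C by (intro K.integrable_const_bound[of _ C]) auto
      have i3: "integrable K (\<lambda>x. h R (\<lambda>i. W i x))" using h01 by (intro K.integrable_const_bound[of _ 1]) auto
      have "\<bar>(\<integral>x. \<phi> (\<lambda>i. W i x) \<partial>K) - (\<integral>x. q (clamp_box d R (\<lambda>i. W i x)) \<partial>K)\<bar> = \<bar>(\<integral>x. \<phi> (\<lambda>i. W i x) - q (clamp_box d R (\<lambda>i. W i x)) \<partial>K)\<bar>"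
        using i1 i2 by simp
      also have "\<dots> \<le> (\<integral>x. \<bar>\<phi> (\<lambda>i. W i x) - q (clamp_box d R (\<lambda>i. W i x))\<bar> \<partial>K)" by (rule integral_abs_bound)
      also have "\<dots> \<le> (\<integral>x. e + 2 * B * h R (\<lambda>i. W i x) \<partial>K)"
        using i1 i2 i3 pw by (intro integral_mono integrable_abs) auto
      also have "\<dots> = e + 2 * B * (\<integral>x. h R (\<lambda>i. W i x) \<partial>K)" using i3 by (simp add: K.prob_space)
      finally show ?thesis .
    qed
    have "(\<lambda>n. 2 * B * (\<integral>x. h R (\<lambda>i. Y n i x) \<partial>M)) \<longlonglongrightarrow> 2 * B * (\<integral>x. h R (\<lambda>i. Y' i x) \<partial>N)" by (intro tendsto_intros hc)
    then have ev1: "\<forall>\<^sub>F n in sequentially. 2 * B * (\<integral>x. h R (\<lambda>i. Y n i x) \<partial>M) < e"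
      using m(2) unfolding R_def by (intro order_tendstoD) auto
    have ev2: "\<forall>\<^sub>F n in sequentially. \<bar>(\<integral>x. q (clamp_box d R (\<lambda>i. Y n i x)) \<partial>M) - (\<integral>x. q (clamp_box d R (\<lambda>i. Y' i x)) \<partial>N)\<bar> < e"
      using tendstoD[OF c1 e] by (simp add: dist_real_def)
    have "\<forall>\<^sub>F n in sequentially. norm ((\<integral>x. \<phi> (\<lambda>i. Y n i x) \<partial>M) - (\<integral>x. \<phi> (\<lambda>i. Y' i x) \<partial>N)) < r"
      using ev1 ev2
    proof eventually_elim
      case (elim n)
      show ?case using elim gen[OF M mM[of n]] gen[OF N mN] m(2) e unfolding R_def[symmetric] e_def real_norm_def by linarith
    qed
    then show "\<exists>no. \<forall>n\<ge>no. norm ((\<integral>x. \<phi> (\<lambda>i. Y n i x) \<partial>M) - (\<integral>x. \<phi> (\<lambda>i. Y' i x) \<partial>N)) < r"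
      by (simp add: eventually_sequentially)
  qed
qed

section \<open>Gaussian sequences with prescribed covariance\<close>

definition qform :: "(nat \<Rightarrow> nat \<Rightarrow> real) \<Rightarrow> nat \<Rightarrow> (nat \<Rightarrow> real) \<Rightarrow> real" where
  "qform K n c = (\<Sum>i<n. \<Sum>j<n. c i * c j * K i j)"

lemma qform_upd:
  assumes sym: "\<And>i j. K i j = K j i" and k: "k < n"
  shows "qform K n (\<lambda>i. c i + (if i = k then t else 0)) = qform K n c + 2 * t * (\<Sum>i<n. c i * K i k) + t\<^sup>2 * K k k"
proof -
  define \<delta> where "\<delta> i = (if i = k then t else 0)" for i
  have "qform K n (\<lambda>i. c i + \<delta> i) = qform K n c + (\<Sum>i<n. \<Sum>j<n. c i * K i j * \<delta> j) + (\<Sum>i<n. \<Sum>j<n. \<delta> i * (c j * K i j)) + (\<Sum>i<n. \<Sum>j<n. \<delta> i * K i j * \<delta> j)"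
    unfolding qform_def by (simp add: sum.distrib[symmetric] algebra_simps)
  also have "(\<Sum>i<n. \<Sum>j<n. c i * K i j * \<delta> j) = t * (\<Sum>i<n. c i * K i k)"
    using k by (simp add: \<delta>_def if_distrib[of "\<lambda>z. _ * z"] sum.delta sum_distrib_left mult_ac cong: if_cong)
  also have "(\<Sum>i<n. \<Sum>j<n. \<delta> i * (c j * K i j)) = (\<Sum>i<n. \<delta> i * (\<Sum>j<n. c j * K i j))"
    by (simp add: sum_distrib_left)
  also have "\<dots> = t * (\<Sum>j<n. c j * K k j)"
    using k by (simp add: \<delta>_def if_distrib[of "\<lambda>z. z * _"] sum.delta cong: if_cong)
  also have "(\<Sum>j<n. c j * K k j) = (\<Sum>i<n. c i * K i k)" by (intro sum.cong) (simp_all add: sym[of k])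
  also have "(\<Sum>i<n. \<Sum>j<n. \<delta> i * K i j * \<delta> j) = (\<Sum>i<n. \<delta> i * K i k * t)"
    using k by (simp add: \<delta>_def[of j for j] if_distrib[of "\<lambda>z. _ * z"] sum.delta cong: if_cong)
  also have "\<dots> = t\<^sup>2 * K k k"
    using k by (simp add: \<delta>_def if_distrib[of "\<lambda>z. z * _"] sum.delta power2_eq_square cong: if_cong)
  finally show ?thesis by (simp add: \<delta>_def)
qed

lemma qform_extend:
  assumes "n \<le> n'"
  shows "qform K n' (\<lambda>i. if i < n then c i else 0) = qform K n c"
proof -
  have s: "(\<Sum>i<n'. if i < n then f i else 0) = (\<Sum>i<n. f i)" for f :: "nat \<Rightarrow> real"
    using assms by (subst sum.inter_filter[symmetric]) (auto intro!: sum.cong)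
  have "qform K n' (\<lambda>i. if i < n then c i else 0) = (\<Sum>i<n'. if i < n then (\<Sum>j<n'. if j < n then c i * c j * K i j else 0) else 0)"
    unfolding qform_def by (intro sum.cong refl) (auto intro!: sum.cong)
  also have "\<dots> = qform K n c" unfolding s qform_def ..
  finally show ?thesis .
qed

text \<open>With K k k = 0 the form at e_j + t e_k is affine in t with slope 2 K j k. Were the slope
  nonzero, the chosen t would make the value -1.\<close>

lemma psd_zero_row:
  assumes sym: "\<And>i j. K i j = K j i" and psd: "\<And>n c. 0 \<le> qform K n c" and z: "K k k = 0"
  shows "K j k = 0"
proof (rule ccontr)
  assume nz: "K j k \<noteq> 0"
  then have jk: "j \<noteq> k" using z by auto
  define n where "n = Suc (max j k)"
  define c where "c i = (if i = j then 1 else 0 :: real)" for i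
  define t where "t = - (K j j + 1) / (2 * K j k)"
  have j: "j < n" "k < n" by (auto simp: n_def)
  have s1: "(\<Sum>i<n. c i * f i) = f j" for f
    using j by (simp add: c_def if_distrib[of "\<lambda>z. z * _"] sum.delta cong: if_cong)
  have "qform K n c = (\<Sum>i<n. c i * (\<Sum>j<n. c j * K i j))" by (simp add: qform_def sum_distrib_left mult_ac)
  then have "qform K n c = K j j" by (simp only: s1)
  then have "qform K n (\<lambda>i. c i + (if i = k then t else 0)) = K j j + 2 * t * K j k"
    using qform_upd[where K=K and k=k and n=n and c=c and t=t, OF sym j(2)] s1 z by simp
  also have "\<dots> = -1" using nz by (simp add: t_def field_simps)
  finally show False using psd[of n "\<lambda>i. c i + (if i = k then t else 0)"] by simp
qed

text \<open>Cholesky factorisation by successive Schur complements. A zero pivot (where x / 0 = 0) is harmless: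
  the corresponding row of a positive semidefinite kernel vanishes.\<close>
fun schur :: "(nat \<Rightarrow> nat \<Rightarrow> real) \<Rightarrow> nat \<Rightarrow> nat \<Rightarrow> nat \<Rightarrow> real" where
  "schur K 0 i j = K i j"
| "schur K (Suc k) i j = schur K k i j - schur K k i k * schur K k j k / schur K k k k"

text \<open>The form of the Schur complement at c is the old form at c with coordinate k moved to
  its minimiser, hence nonnegative. Symmetry, positivity and the vanishing of the rows already
  eliminated are carried through one induction.\<close>

lemma schur_psd:
  assumes sym: "\<And>i j. K i j = K j i" and psd: "\<And>n c. 0 \<le> qform K n c"
  shows "schur K k i j = schur K k j i" "0 \<le> qform (schur K k) n c" "i < k \<Longrightarrow> schur K k i j = 0"
proof -
  have "(\<forall>i j. schur K k i j = schur K k j i) \<and> (\<forall>n c. 0 \<le> qform (schur K k) n c) \<and> (\<forall>i j. i < k \<longrightarrow> schur K k i j = 0)"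
  proof (induction k)
    case 0
    then show ?case using sym psd by (auto simp: qform_def)
  next
    case (Suc k)
    let ?S = "schur K k"
    have sy: "\<And>i j. ?S i j = ?S j i" and ps: "\<And>n c. 0 \<le> qform ?S n c" and z: "\<And>i j. i < k \<Longrightarrow> ?S i j = 0"
      using Suc by auto
    have "0 \<le> qform (schur K (Suc k)) n c" for n c
    proof (cases "?S k k = 0")
      case True
      then have "qform (schur K (Suc k)) n c = qform ?S n c" by (simp add: qform_def)
      then show ?thesis using ps by simp
    next
      case False
      \<comment> \<open>The range of c may stop before the pivot k; padding with zeros makes room to
        move coordinate k.\<close>
      define n' where "n' = max n (Suc k)"
      define c' where "c' i = (if i < n then c i else 0)" for i
      have k: "k < n'" and nn: "n \<le> n'" by (auto simp: n'_def)
      define s where "s = (\<Sum>i<n'. c' i * ?S i k)"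
      have "qform (schur K (Suc k)) n c = qform (schur K (Suc k)) n' c'"
        unfolding c'_def by (rule qform_extend[OF nn, symmetric])
      also have "\<dots> = qform ?S n' c' - (\<Sum>i<n'. \<Sum>j<n'. (c' i * ?S i k) * (c' j * ?S j k)) / ?S k k"
        unfolding qform_def by (simp add: algebra_simps sum_subtractf sum_divide_distrib)
      also have "(\<Sum>i<n'. \<Sum>j<n'. (c' i * ?S i k) * (c' j * ?S j k)) = s\<^sup>2"
        by (simp add: s_def power2_eq_square sum_product)
      also have "qform ?S n' c' - s\<^sup>2 / ?S k k = qform ?S n' (\<lambda>i. c' i + (if i = k then - s / ?S k k else 0))"
        using False by (subst qform_upd[OF sy k]) (simp add: s_def[symmetric] power2_eq_square field_simps)
      finally show ?thesis by (rule ssubst) (rule ps)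
    qed
    moreover have "schur K (Suc k) i j = schur K (Suc k) j i" for i j by (simp add: sy[of i j] mult.commute)
    moreover have "schur K (Suc k) i j = 0" if "i < Suc k" for i j
    proof (cases "i = k")
      case True
      show ?thesis
      proof (cases "?S k k = 0")
        case t: True
        then have "?S j k = 0" by (rule psd_zero_row[OF sy ps])
        then show ?thesis using t True sy[of k j] by simp
      next
        case False
        then show ?thesis using True sy[of k j] by simp
      qed
    next
      case False
      then show ?thesis using that z by simp
    qed
    ultimately show ?case by blast
  qed
  then show "schur K k i j = schur K k j i" "0 \<le> qform (schur K k) n c" "i < k \<Longrightarrow> schur K k i j = 0" by auto
qed

definition chol :: "(nat \<Rightarrow> nat \<Rightarrow> real) \<Rightarrow> nat \<Rightarrow> nat \<Rightarrow> real" where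
  "chol K i k = schur K k i k / sqrt (schur K k k k)"

text \<open>Each elimination step splits off one rank-one term. After n > i steps row i of the
  remainder is zero, so the finite sum is exact.\<close>

lemma chol_factorization:
  assumes sym: "\<And>i j. K i j = K j i" and psd: "\<And>n c. 0 \<le> qform K n c" and "i < n"
  shows "K i j = (\<Sum>k<n. chol K i k * chol K j k)"
proof -
  have d: "0 \<le> schur K k k k" for k
  proof -
    have "qform (schur K k) (Suc k) (\<lambda>i. if i = k then 1 else 0) = schur K k k k"
      by (simp add: qform_def if_distrib[of "\<lambda>z. z * _"] sum.delta cong: if_cong)
    then show ?thesis using schur_psd(2)[OF sym psd] by metis
  qed
  have "K i j = (\<Sum>k<m. chol K i k * chol K j k) + schur K m i j" for m
    by (induction m) (auto simp: chol_def d)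
  from this[of n] show ?thesis using schur_psd(3)[OF sym psd \<open>i < n\<close>] by simp
qed

section \<open>Independent standard normal variables and their linear combinations\<close>

abbreviation gauss_space :: "(nat \<Rightarrow> real) measure" where
  "gauss_space \<equiv> PiM UNIV (\<lambda>_. std_normal_distribution)"

lemma prob_space_gauss: "prob_space gauss_space"
  by (rule prob_space_PiM) (simp add: prob_space_normal_density)

lemma measurable_gauss_coord[measurable]: "(\<lambda>\<omega>. \<omega> k) \<in> borel_measurable gauss_space"
proof -
  have "(\<lambda>\<omega>. \<omega> k) \<in> measurable gauss_space std_normal_distribution" by (rule measurable_component_singleton) simp
  then show ?thesis by (simp cong: measurable_cong_sets)
qed

lemma distr_gauss_coord: "distr gauss_space borel (\<lambda>\<omega>. \<omega> k) = std_normal_distribution"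
proof -
  interpret product_prob_space "\<lambda>_::nat. std_normal_distribution" UNIV
    by (rule product_prob_spaceI) (simp add: prob_space_normal_density)
  have "distr gauss_space std_normal_distribution (\<lambda>\<omega>. \<omega> k) = std_normal_distribution" by (rule PiM_component) simp
  moreover have "distr gauss_space std_normal_distribution (\<lambda>\<omega>. \<omega> k) = distr gauss_space borel (\<lambda>\<omega>. \<omega> k)"
    by (intro distr_cong) auto
  ultimately show ?thesis by simp
qed

lemma indep_gauss_coords: "prob_space.indep_vars gauss_space (\<lambda>_. borel) (\<lambda>k \<omega>. \<omega> k) UNIV"
proof -
  interpret prob_space gauss_space by (rule prob_space_gauss)
  have s: "sets (PiM UNIV (\<lambda>_::nat. borel :: real measure)) = sets gauss_space"
    by (intro sets_PiM_cong) auto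
  have "distr gauss_space (PiM UNIV (\<lambda>_. borel)) (\<lambda>\<omega>. \<lambda>k\<in>UNIV. \<omega> k) = gauss_space"
    using s by (simp add: distr_id2 restrict_UNIV)
  then show ?thesis
    by (subst indep_vars_iff_distr_eq_PiM') (auto simp: distr_gauss_coord)
qed

definition gcomb :: "nat \<Rightarrow> (nat \<Rightarrow> real) \<Rightarrow> (nat \<Rightarrow> real) \<Rightarrow> real" where
  "gcomb n d \<omega> = (\<Sum>k<n. d k * \<omega> k)"

lemma gcomb_measurable[measurable]: "gcomb n d \<in> borel_measurable gauss_space"
  unfolding gcomb_def[abs_def] by measurable

lemma char_gcomb: "char (distr gauss_space borel (gcomb n d)) t = exp (- complex_of_real (t\<^sup>2 * (\<Sum>k<n. (d k)\<^sup>2) / 2))"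
proof -
  interpret prob_space gauss_space by (rule prob_space_gauss)
  have i: "indep_vars (\<lambda>_. borel) (\<lambda>k \<omega>. d k * \<omega> k) {..<n}"
    by (rule indep_vars_subset[OF indep_vars_compose2[OF indep_gauss_coords, of "\<lambda>k x. d k * x" "\<lambda>_. borel"]]) auto
  have c: "char (distr gauss_space borel (\<lambda>\<omega>. d k * \<omega> k)) t = exp (- complex_of_real (t\<^sup>2 * (d k)\<^sup>2 / 2))" for k
  proof -
    have "char (distr gauss_space borel (\<lambda>\<omega>. d k * \<omega> k)) t = char (distr gauss_space borel (\<lambda>\<omega>. \<omega> k)) (t * d k)"
      unfolding char_def by (simp add: integral_distr mult.assoc)
    also have "\<dots> = exp (- complex_of_real (t\<^sup>2 * (d k)\<^sup>2 / 2))"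
      unfolding distr_gauss_coord char_std_normal_distribution
      by (simp add: power_mult_distrib of_real_exp[symmetric] exp_of_real[symmetric])
    finally show ?thesis .
  qed
  have "char (distr gauss_space borel (gcomb n d)) t = (\<Prod>k<n. exp (- complex_of_real (t\<^sup>2 * (d k)\<^sup>2 / 2)))"
    unfolding gcomb_def[abs_def] char_distr_sum[OF i] c ..
  also have "\<dots> = exp (- complex_of_real (t\<^sup>2 * (\<Sum>k<n. (d k)\<^sup>2) / 2))"
    by (simp add: exp_sum[symmetric] sum_negf sum_distrib_left sum_divide_distrib)
  finally show ?thesis .
qed

text \<open>Completing the square turns the tilted density into exp (s^2 / 2) times the normal
  density with mean s.\<close>

lemma std_normal_mgf:
  "integrable std_normal_distribution (\<lambda>x. exp (s * x))" "(\<integral>x. exp (s * x) \<partial>std_normal_distribution) = exp (s\<^sup>2 / 2)"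
proof -
  have e: "std_normal_density x * exp (s * x) = exp (s\<^sup>2 / 2) * normal_density s 1 x" for x
  proof -
    have "- x\<^sup>2 / 2 + s * x = s\<^sup>2 / 2 + - (x - s)\<^sup>2 / 2" by (simp add: power2_eq_square algebra_simps diff_divide_distrib add_divide_distrib)
    then have "exp (- x\<^sup>2 / 2) * exp (s * x) = exp (s\<^sup>2 / 2) * exp (- (x - s)\<^sup>2 / 2)" by (simp only: exp_add[symmetric])
    then show ?thesis by (simp add: normal_density_def)
  qed
  show "integrable std_normal_distribution (\<lambda>x. exp (s * x))"
    by (subst integrable_density) (auto simp: e)
  show "(\<integral>x. exp (s * x) \<partial>std_normal_distribution) = exp (s\<^sup>2 / 2)"
    by (subst integral_density) (auto simp: e)
qed

lemma gcomb_mgf: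
  "integrable gauss_space (\<lambda>\<omega>. exp (s * gcomb n d \<omega>))"
  "(\<integral>\<omega>. exp (s * gcomb n d \<omega>) \<partial>gauss_space) = exp (s\<^sup>2 * (\<Sum>k<n. (d k)\<^sup>2) / 2)"
proof -
  interpret prob_space gauss_space by (rule prob_space_gauss)
  have i: "indep_vars (\<lambda>_. borel) (\<lambda>k \<omega>. exp (s * d k * \<omega> k)) {..<n}"
    by (rule indep_vars_subset[OF indep_vars_compose2[OF indep_gauss_coords, of "\<lambda>k x. exp (s * d k * x)" "\<lambda>_. borel"]]) auto
  have e: "exp (s * gcomb n d \<omega>) = (\<Prod>k<n. exp (s * d k * \<omega> k))" for \<omega>
    by (simp add: gcomb_def exp_sum[symmetric] sum_distrib_left mult.assoc)
  have c1: "integrable gauss_space (\<lambda>\<omega>. exp (a * \<omega> k))" for a k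
  proof -
    have "integrable (distr gauss_space borel (\<lambda>\<omega>. \<omega> k)) (\<lambda>x. exp (a * x))"
      unfolding distr_gauss_coord by (rule std_normal_mgf)
    then show ?thesis by (subst (asm) integrable_distr_eq) auto
  qed
  have c2: "(\<integral>\<omega>. exp (a * \<omega> k) \<partial>gauss_space) = exp (a\<^sup>2 / 2)" for a k
  proof -
    have "(\<integral>x. exp (a * x) \<partial>distr gauss_space borel (\<lambda>\<omega>. \<omega> k)) = exp (a\<^sup>2 / 2)"
      unfolding distr_gauss_coord by (rule std_normal_mgf)
    then show ?thesis by (subst (asm) integral_distr) auto
  qed
  show "integrable gauss_space (\<lambda>\<omega>. exp (s * gcomb n d \<omega>))"
    unfolding e by (rule indep_vars_integrable[OF _ i]) (auto intro!: c1)
  have "(\<integral>\<omega>. exp (s * gcomb n d \<omega>) \<partial>gauss_space) = (\<Prod>k<n. exp ((s * d k)\<^sup>2 / 2))"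
    unfolding e by (subst indep_vars_lebesgue_integral[OF _ i]) (auto intro!: c1 simp: c2)
  also have "\<dots> = exp (s\<^sup>2 * (\<Sum>k<n. (d k)\<^sup>2) / 2)"
    by (simp add: exp_sum[symmetric] sum_distrib_left sum_divide_distrib power_mult_distrib)
  finally show "(\<integral>\<omega>. exp (s * gcomb n d \<omega>) \<partial>gauss_space) = exp (s\<^sup>2 * (\<Sum>k<n. (d k)\<^sup>2) / 2)" .
qed

text \<open>\<open>chol\<close> is lower triangular, since eliminated rows vanish. The sum may
  therefore stop at k = i, and no infinite series of normal variables is needed.\<close>

definition gproc :: "(nat \<Rightarrow> nat \<Rightarrow> real) \<Rightarrow> nat \<Rightarrow> (nat \<Rightarrow> real) \<Rightarrow> real" where
  "gproc K i \<omega> = gcomb (Suc i) (chol K i) \<omega>"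

text \<open>Rewriting a combination of process values as a single \<open>gcomb\<close>, whose
  squared norm is the quadratic form of K, reduces characteristic functions and exponential moments
  of all finite-dimensional laws to those of \<open>gcomb\<close>.\<close>

lemma gproc_comb:
  assumes sym: "\<And>i j. K i j = K j i" and psd: "\<And>n c. 0 \<le> qform K n c" and I: "finite I"
  obtains n d where "\<And>\<omega>. (\<Sum>s\<in>I. c s * gproc K (f s) \<omega>) = gcomb n d \<omega>"
    "(\<Sum>k<n. (d k)\<^sup>2) = (\<Sum>s\<in>I. \<Sum>s'\<in>I. c s * c s' * K (f s) (f s'))"
proof -
  define n where "n = Suc (Max (f ` I \<union> {0}))"
  have fn: "f s < n" if "s \<in> I" for s
    using that I by (auto simp: n_def less_Suc_eq_le intro!: Max_ge)
  define d where "d k = (\<Sum>s\<in>I. c s * chol K (f s) k)" for k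
  have z: "chol K i k = 0" if "i < k" for i k
    using schur_psd(3)[OF sym psd that] by (simp add: chol_def)
  have g: "gproc K (f s) \<omega> = (\<Sum>k<n. chol K (f s) k * \<omega> k)" if "s \<in> I" for s \<omega>
    unfolding gproc_def gcomb_def using fn[OF that] z by (intro sum.mono_neutral_left) auto
  have "(\<Sum>s\<in>I. c s * gproc K (f s) \<omega>) = gcomb n d \<omega>" for \<omega>
  proof -
    have "(\<Sum>s\<in>I. c s * gproc K (f s) \<omega>) = (\<Sum>s\<in>I. \<Sum>k<n. c s * chol K (f s) k * \<omega> k)"
      by (intro sum.cong refl) (simp add: g sum_distrib_left mult.assoc)
    also have "\<dots> = gcomb n d \<omega>" unfolding gcomb_def d_def by (subst sum.swap) (simp add: sum_distrib_right)
    finally show ?thesis .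
  qed
  moreover have "(\<Sum>k<n. (d k)\<^sup>2) = (\<Sum>s\<in>I. \<Sum>s'\<in>I. c s * c s' * K (f s) (f s'))"
  proof -
    have "(\<Sum>k<n. (d k)\<^sup>2) = (\<Sum>k<n. \<Sum>s\<in>I. \<Sum>s'\<in>I. (c s * chol K (f s) k) * (c s' * chol K (f s') k))"
      by (simp add: d_def power2_eq_square sum_product)
    also have "\<dots> = (\<Sum>s\<in>I. \<Sum>k<n. \<Sum>s'\<in>I. (c s * chol K (f s) k) * (c s' * chol K (f s') k))" by (rule sum.swap)
    also have "\<dots> = (\<Sum>s\<in>I. \<Sum>s'\<in>I. \<Sum>k<n. (c s * chol K (f s) k) * (c s' * chol K (f s') k))"
      by (intro sum.cong refl sum.swap)
    also have "\<dots> = (\<Sum>s\<in>I. \<Sum>s'\<in>I. c s * c s' * K (f s) (f s'))"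
      by (intro sum.cong refl) (subst chol_factorization[OF sym psd fn], assumption, simp add: sum_distrib_left mult_ac)
    finally show ?thesis .
  qed
  ultimately show ?thesis by (rule that)
qed

section \<open>Chaining over dyadic grids\<close>

definition dy :: "nat \<Rightarrow> real^'p \<Rightarrow> real^'p" where
  "dy k u = (\<chi> i. real_of_int \<lfloor>2^k * u$i\<rfloor> / 2^k)"

definition grid :: "nat \<Rightarrow> (real^'p) set" where
  "grid k = {u \<in> unit_cube. \<forall>i. 2^k * u$i \<in> \<int>}"

text \<open>Diagonal moves and v = w are allowed, so that this covers both links of a chain: the
  roundings of one point at consecutive levels, and those of two close points at the same
  level.\<close>

definition near :: "nat \<Rightarrow> real^'p \<Rightarrow> real^'p \<Rightarrow> bool" where
  "near k v w \<longleftrightarrow> v \<in> grid k \<and> w \<in> grid k \<and> (\<forall>i. \<bar>v$i - w$i\<bar> \<le> 1 / 2^k)"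

lemma dy_bounds: "0 \<le> u$i - dy k u $ i" "u$i - dy k u $ i \<le> 1 / 2^k"
proof -
  define x where "x = 2^k * u$i"
  have e: "u$i - dy k u $ i = (x - real_of_int \<lfloor>x\<rfloor>) / 2^k" by (simp add: dy_def x_def diff_divide_distrib)
  have "0 \<le> x - real_of_int \<lfloor>x\<rfloor>" "x - real_of_int \<lfloor>x\<rfloor> \<le> 1" by linarith+
  then show "0 \<le> u$i - dy k u $ i" "u$i - dy k u $ i \<le> 1 / 2^k"
    unfolding e by (auto intro: divide_right_mono)
qed

lemma dy_grid: "u \<in> unit_cube \<Longrightarrow> dy k u \<in> grid k"
proof -
  assume u: "u \<in> unit_cube"
  have "\<lfloor>2^k * u$i\<rfloor> \<ge> 0" for i using u by (simp add: unit_cube_def)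
  moreover have "dy k u $ i \<le> 1" for i
    using dy_bounds(1)[of u i k] u by (auto simp: unit_cube_def intro: order_trans)
  ultimately show ?thesis by (auto simp: grid_def unit_cube_def dy_def)
qed

lemma grid_cube: "u \<in> grid k \<Longrightarrow> u \<in> unit_cube" by (simp add: grid_def)

lemma dy_cube: "u \<in> unit_cube \<Longrightarrow> dy k u \<in> unit_cube" using dy_grid grid_cube by blast

lemma grid_Suc: "u \<in> grid k \<Longrightarrow> u \<in> grid (Suc k)"
proof -
  assume u: "u \<in> grid k"
  have "2 * (2^k * u$i) \<in> \<int>" for i using u Ints_mult[of 2 "2^k * u$i"] by (simp add: grid_def)
  then show ?thesis using u unfolding grid_def power_Suc mult.assoc by blast
qed

lemma dy_tendsto: "(\<lambda>k. dy k u) \<longlonglongrightarrow> u"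
proof (rule vec_tendstoI)
  fix i
  have l: "(\<lambda>k. 1 / 2^k :: real) \<longlonglongrightarrow> 0"
    using LIMSEQ_divide_realpow_zero[of 2 1] by simp
  have "(\<lambda>k. dy k u $ i - u $ i) \<longlonglongrightarrow> 0"
  proof (rule Lim_null_comparison[OF always_eventually l], intro allI)
    fix k show "norm (dy k u $ i - u $ i) \<le> 1 / 2^k" using dy_bounds[of u i k] by simp
  qed
  then show "(\<lambda>k. dy k u $ i) \<longlonglongrightarrow> u $ i" by (simp add: LIM_zero_iff)
qed

text \<open>The floor of 2 x is twice the floor of x, or that plus 1, so a refinement moves each
  coordinate by at most one step of the finer grid.\<close>

lemma dy_Suc_near: "u \<in> unit_cube \<Longrightarrow> near (Suc k) (dy (Suc k) u) (dy k u)"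
proof -
  assume u: "u \<in> unit_cube"
  have "\<bar>dy (Suc k) u $ i - dy k u $ i\<bar> \<le> 1 / 2^Suc k" for i
  proof -
    define x where "x = 2^k * u$i"
    have "\<lfloor>2 * x\<rfloor> = 2 * \<lfloor>x\<rfloor> \<or> \<lfloor>2 * x\<rfloor> = 2 * \<lfloor>x\<rfloor> + 1" by linarith
    then have "real_of_int \<lfloor>2 * x\<rfloor> - 2 * real_of_int \<lfloor>x\<rfloor> \<in> {0, 1}" by auto
    then have "\<bar>real_of_int \<lfloor>2 * x\<rfloor> - 2 * real_of_int \<lfloor>x\<rfloor>\<bar> \<le> 1" by auto
    moreover have "dy (Suc k) u $ i - dy k u $ i = (real_of_int \<lfloor>2 * x\<rfloor> - 2 * real_of_int \<lfloor>x\<rfloor>) / 2^Suc k"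
      by (simp add: dy_def x_def mult.assoc field_simps)
    ultimately show ?thesis by (simp add: abs_divide divide_le_cancel)
  qed
  then show ?thesis using u dy_grid grid_Suc unfolding near_def by blast
qed

lemma dy_near:
  assumes "u \<in> unit_cube" "v \<in> unit_cube" "\<And>i. \<bar>u$i - v$i\<bar> \<le> 1 / 2^k"
  shows "near k (dy k u) (dy k v)"
proof -
  have "\<bar>dy k u $ i - dy k v $ i\<bar> \<le> 1 / 2^k" for i
  proof -
    have "2^k * \<bar>u$i - v$i\<bar> \<le> 1" using assms(3)[of i] by (simp add: field_simps)
    then have "\<bar>2^k * u$i - 2^k * v$i\<bar> \<le> 1" by (simp add: abs_mult right_diff_distrib[symmetric])
    then have "\<bar>\<lfloor>2^k * u$i\<rfloor> - \<lfloor>2^k * v$i\<rfloor>\<bar> \<le> 1" by linarith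
    then have "\<bar>real_of_int \<lfloor>2^k * u$i\<rfloor> - real_of_int \<lfloor>2^k * v$i\<rfloor>\<bar> \<le> 1" by linarith
    moreover have "dy k u $ i - dy k v $ i = (real_of_int \<lfloor>2^k * u$i\<rfloor> - real_of_int \<lfloor>2^k * v$i\<rfloor>) / 2^k"
      by (simp add: dy_def diff_divide_distrib)
    ultimately show ?thesis by (simp add: abs_divide divide_le_cancel)
  qed
  then show ?thesis using assms dy_grid unfolding near_def by blast
qed

lemma finite_grid: "finite (grid k :: (real^'p) set)"
  and card_grid: "card (grid k :: (real^'p) set) \<le> (2^k + 1)^CARD('p)"
proof -
  let ?F = "PiE (UNIV :: 'p set) (\<lambda>_. {..2^k::nat})"
  have fin: "finite ?F" by (intro finite_PiE) auto
  have sub: "(grid k :: (real^'p) set) \<subseteq> (\<lambda>f. \<chi> i. real (f i) / 2^k) ` ?F"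
  proof
    fix u :: "real^'p" assume u: "u \<in> grid k"
    define f where "f i = nat \<lfloor>2^k * u$i\<rfloor>" for i
    have r: "real (f i) = 2^k * u$i" for i
    proof -
      have "2^k * u$i \<ge> 0" "2^k * u$i \<in> \<int>" using u by (auto simp: grid_def unit_cube_def)
      then show ?thesis by (auto simp: f_def elim!: Ints_cases)
    qed
    have "real (f i) \<le> real (2^k)" for i unfolding r using u by (auto simp: grid_def unit_cube_def)
    then have "f \<in> ?F" by (auto simp: of_nat_le_iff simp del: of_nat_power)
    moreover have "u = (\<chi> i. real (f i) / 2^k)" by (simp add: r vec_eq_iff)
    ultimately show "u \<in> (\<lambda>f. \<chi> i. real (f i) / 2^k) ` ?F" by blast
  qed
  show "finite (grid k :: (real^'p) set)" using finite_subset[OF sub] fin by blast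
  have "card (grid k :: (real^'p) set) \<le> card ?F" using card_mono[OF finite_imageI[OF fin] sub] card_image_le[OF fin] by (rule order_trans)
  also have "card ?F = (2^k + 1)^CARD('p)" by (subst card_PiE) auto
  finally show "card (grid k :: (real^'p) set) \<le> (2^k + 1)^CARD('p)" .
qed

text \<open>By lam_cx below, Markov's inequality with rate lam k bounds the probability of an increment larger than
  cx k by a multiple of exp (- (2 CARD(p) + 1) (k + 1)); this beats the number of pairs of grid
  neighbours, which is at most exp (2 CARD(p) (k + 1)), and the thresholds cx k are summable.\<close>
definition cx :: "('p::finite) itself \<Rightarrow> nat \<Rightarrow> real" where
  "cx p k = 2 * (2 * real CARD('p) + 1) * real (Suc k) * sqrt (1/2) ^ k"

text \<open>Increments between neighbours of level k have variance of order 1 / 2^k, so this rate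
  keeps lam^2 times the variance bounded. The factor 1/2 gives lam k / sqrt n \<le> 1/2 once 2^k
  \<le> n, as the moment bound for bounded variables requires.\<close>

definition lam :: "nat \<Rightarrow> real" where "lam k = sqrt 2 ^ k / 2"

definition ceps :: "('p::finite) itself \<Rightarrow> nat \<Rightarrow> real" where
  "ceps p k = (\<Sum>i. cx TYPE('p) (i + k))"

lemma lam_cx: "lam k * cx TYPE('p::finite) k = (2 * real CARD('p) + 1) * real (Suc k)"
proof -
  have "sqrt 2 ^ k * sqrt (1/2) ^ k = (1::real)" by (simp add: power_mult_distrib[symmetric] real_sqrt_mult[symmetric])
  moreover have "lam k * cx TYPE('p) k = (2 * real CARD('p) + 1) * real (Suc k) * (sqrt 2 ^ k * sqrt (1/2) ^ k)"
    unfolding lam_def cx_def by (simp only: mult_ac times_divide_eq_left times_divide_eq_right nonzero_mult_div_cancel_left)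
  ultimately show ?thesis by simp
qed

lemma cx_nonneg: "0 \<le> cx TYPE('p::finite) k" by (simp add: cx_def)

lemma summable_cx: "summable (cx TYPE('p::finite))"
proof -
  have "summable (\<lambda>n. real (Suc n) * sqrt (1/2) ^ n)"
  \<comment> \<open>Here sqrt (1/2) \<le> 5/7, and 5/7 (n + 2) \<le> 3/4 (n + 1) as soon as n \<ge>
    19.\<close>
  proof (rule summable_ratio_test[where c="3/4" and N=20])
    fix n :: nat assume n: "20 \<le> n"
    have s: "sqrt (1/2) \<le> (5/7 :: real)" by (rule real_le_lsqrt) (auto simp: power2_eq_square)
    have "real (Suc (Suc n)) * sqrt (1/2) \<le> real (Suc (Suc n)) * (5/7)" using s by (intro mult_left_mono) auto
    also have "\<dots> \<le> 3/4 * real (Suc n)" using n by simp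
    finally have "(real (Suc (Suc n)) * sqrt (1/2)) * sqrt (1/2)^n \<le> (3/4 * real (Suc n)) * sqrt (1/2)^n" by (intro mult_right_mono) auto
    then show "norm (real (Suc (Suc n)) * sqrt (1/2) ^ Suc n) \<le> 3/4 * norm (real (Suc n) * sqrt (1/2) ^ n)"
      by (simp add: abs_mult mult_ac)
  qed auto
  from summable_mult[OF this, of "2 * (2 * real CARD('p) + 1)"] show ?thesis by (simp add: cx_def[abs_def] mult_ac)
qed

lemma ceps_tendsto: "ceps TYPE('p::finite) \<longlonglongrightarrow> 0"
  unfolding ceps_def[abs_def] using suminf_exist_split2[OF summable_cx] .

lemma cx_le_ceps: "k0 \<le> k \<Longrightarrow> cx TYPE('p::finite) k \<le> ceps TYPE('p) k0"
proof -
  assume "k0 \<le> k"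
  then have "cx TYPE('p) k = (\<Sum>i\<in>{k - k0}. cx TYPE('p) (i + k0))" by simp
  also have "\<dots> \<le> ceps TYPE('p) k0" unfolding ceps_def
    by (rule sum_le_suminf[OF summable_ignore_initial_segment[OF summable_cx]]) (auto simp: cx_nonneg)
  finally show ?thesis .
qed

lemma sum_cx_le_ceps: "(\<Sum>i<n. cx TYPE('p::finite) (Suc (i + k0))) \<le> ceps TYPE('p) k0"
proof -
  have "(\<Sum>i<n. cx TYPE('p::finite) (Suc (i + k0))) \<le> (\<Sum>i<Suc n. cx TYPE('p::finite) (i + k0))"
    by (subst sum.lessThan_Suc_shift) (simp add: cx_nonneg)
  also have "\<dots> \<le> ceps TYPE('p) k0" unfolding ceps_def
    using summable_ignore_initial_segment[OF summable_cx] by (rule sum_le_suminf) (auto simp: cx_nonneg)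
  finally show ?thesis .
qed

definition tame :: "(real^'p \<Rightarrow> real) \<Rightarrow> nat \<Rightarrow> bool" where
  "tame f k \<longleftrightarrow> (\<forall>v w. near k v w \<longrightarrow> \<bar>f v - f w\<bar> \<le> cx TYPE('p) k)"

text \<open>Consecutive roundings of one point are neighbours on the finer grid, so the increment
  telescopes into thresholds from level k0 + 1 on, whose sum is at most \<open>ceps\<close>.\<close>

lemma tame_chain:
  fixes f :: "real^'p \<Rightarrow> real"
  assumes t: "\<And>k. k0 \<le> k \<Longrightarrow> k \<le> k0 + n \<Longrightarrow> tame f k" and u: "u \<in> unit_cube"
  shows "\<bar>f (dy (k0 + n) u) - f (dy k0 u)\<bar> \<le> ceps TYPE('p) k0"
proof -
  have "\<bar>f (dy (k0 + n) u) - f (dy k0 u)\<bar> \<le> (\<Sum>i<n. cx TYPE('p) (Suc (i + k0)))" using t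
  proof (induction n)
    case (Suc n)
    have "\<bar>f (dy (Suc (k0 + n)) u) - f (dy (k0 + n) u)\<bar> \<le> cx TYPE('p) (Suc (k0 + n))"
      using Suc.prems[of "Suc (k0 + n)"] dy_Suc_near[OF u, of "k0+n"] by (auto simp: tame_def)
    moreover have "\<bar>f (dy (k0 + n) u) - f (dy k0 u)\<bar> \<le> (\<Sum>i<n. cx TYPE('p) (Suc (i + k0)))"
      using Suc by simp
    ultimately show ?case by (simp add: add.commute)
  qed simp
  then show ?thesis using sum_cx_le_ceps order_trans by blast
qed

text \<open>Both points are carried to level k0, where their roundings are neighbours: two chains
  and one link give the factor 3.\<close>

lemma tame_modulus:
  fixes f :: "real^'p \<Rightarrow> real"
  assumes t: "\<And>k. k0 \<le> k \<Longrightarrow> k \<le> K \<Longrightarrow> tame f k" and K: "k0 \<le> K" and u: "u \<in> unit_cube" "v \<in> unit_cube"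
    and d: "\<And>i. \<bar>u$i - v$i\<bar> \<le> 1 / 2^k0"
  shows "\<bar>f (dy K u) - f (dy K v)\<bar> \<le> 3 * ceps TYPE('p) k0"
proof -
  have "\<bar>f (dy k0 u) - f (dy k0 v)\<bar> \<le> ceps TYPE('p) k0"
    using t[of k0] K dy_near[OF u d] cx_le_ceps[of k0 k0, where 'p='p] by (force simp: tame_def)
  moreover have "\<bar>f (dy K u) - f (dy k0 u)\<bar> \<le> ceps TYPE('p) k0" "\<bar>f (dy K v) - f (dy k0 v)\<bar> \<le> ceps TYPE('p) k0"
    using tame_chain[of k0 "K - k0" f] t K u by auto
  ultimately show ?thesis by linarith
qed

text \<open>The only probabilistic input of the chaining, and its common interface: the Gaussian
  process satisfies it at every level, the empirical process at the levels with 2^k \<le> n.\<close>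

definition incr_mgf :: "'a measure \<Rightarrow> (real^'p \<Rightarrow> 'm \<Rightarrow> 'a \<Rightarrow> real) \<Rightarrow> nat \<Rightarrow> bool" where
  "incr_mgf M G k \<longleftrightarrow> (\<forall>j v w s. near k v w \<longrightarrow> s \<in> {-1, 1} \<longrightarrow>
     integrable M (\<lambda>\<omega>. exp (s * lam k * (G v j \<omega> - G w j \<omega>))) \<and>
     (\<integral>\<omega>. exp (s * lam k * (G v j \<omega> - G w j \<omega>)) \<partial>M) \<le> exp (real CARD('p)))"

definition bad :: "'a measure \<Rightarrow> (real^'p \<Rightarrow> 'm \<Rightarrow> 'a \<Rightarrow> real) \<Rightarrow> nat \<Rightarrow> 'a set" where
  "bad M G k = {\<omega>\<in>space M. \<exists>j. \<not> tame (\<lambda>u. G u j \<omega>) k}"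

lemma (in prob_space) exp_tail:
  assumes [measurable]: "Y \<in> borel_measurable M" and "integrable M (\<lambda>\<omega>. exp (l * Y \<omega>))" 
    "(\<integral>\<omega>. exp (l * Y \<omega>) \<partial>M) \<le> exp c" "l > 0"
  shows "prob {\<omega>\<in>space M. Y \<omega> > x} \<le> exp (c - l * x)"
proof -
  have "prob {\<omega>\<in>space M. Y \<omega> > x} \<le> prob {\<omega>\<in>space M. exp (l * Y \<omega>) \<ge> exp (l * x)}"
    using assms(4) by (intro finite_measure_mono) auto
  also have "\<dots> \<le> (\<integral>\<omega>. exp (l * Y \<omega>) \<partial>M) / exp (l * x)"
    by (rule integral_Markov_inequality_measure[OF assms(2), of "{}"]) auto
  also have "\<dots> \<le> exp c / exp (l * x)" using assms(3) by (intro divide_right_mono) auto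
  finally show ?thesis by (simp add: exp_diff)
qed

text \<open>Union bound over the index j, the pairs of neighbours and the two signs. With p
  coordinates the exponents add up to 2 p (k + 1) + p - (2 p + 1) (k + 1) = p - (k + 1).\<close>

lemma (in prob_space) bad_prob:
  fixes G :: "real^'p \<Rightarrow> ('m::finite) \<Rightarrow> 'a \<Rightarrow> real"
  assumes mg: "incr_mgf M G k" and [measurable]: "\<And>u j. u \<in> grid k \<Longrightarrow> G u j \<in> borel_measurable M"
  shows "bad M G k \<in> sets M" "prob (bad M G k) \<le> 2 * real CARD('m) * exp (real CARD('p)) * exp (- real (Suc k))"
proof -
  let ?p = "real CARD('p)"
  let ?I = "(UNIV :: 'm set) \<times> {(v,w). near k (v::real^'p) w}"
  have nsub: "{(v,w). near k (v::real^'p) w} \<subseteq> (grid k \<times> grid k :: ((real^'p) \<times> (real^'p)) set)" by (auto simp: near_def)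
  have finI: "finite ?I" by (intro finite_cartesian_product finite_subset[OF nsub] finite_grid finite)
  have cardI: "real (card ?I) \<le> real CARD('m) * exp (2 * ?p * real (Suc k))"
  proof -
    have "card {(v,w). near k (v::real^'p) w} \<le> card (grid k \<times> grid k :: ((real^'p) \<times> (real^'p)) set)"
      using nsub finite_grid by (intro card_mono) auto
    also have "\<dots> \<le> (2^k + 1)^CARD('p) * (2^k + 1)^CARD('p)"
      unfolding card_cartesian_product by (intro mult_mono card_grid) auto
    finally have "real (card {(v,w). near k (v::real^'p) w}) \<le> real ((2^k + 1)^CARD('p) * (2^k + 1)^CARD('p))"
      by (rule of_nat_mono)
    also have "\<dots> = (2^k + 1) ^ (2 * CARD('p))" by (simp add: power_add mult_2 add.commute)
    also have "\<dots> \<le> (exp (real (Suc k))) ^ (2 * CARD('p))"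
    proof (rule power_mono)
      have "2^k + 1 \<le> (2::real)^Suc k" by simp
      also have "\<dots> \<le> exp 1 ^ Suc k" using exp_ge_add_one_self[of 1] by (intro power_mono) auto
      also have "\<dots> = exp (real (Suc k))" by (simp only: exp_of_nat_mult[symmetric] mult_1_right)
      finally show "2^k + 1 \<le> exp (real (Suc k))" .
    qed simp
    also have "\<dots> = exp (2 * ?p * real (Suc k))" by (simp only: exp_of_nat_mult[symmetric]) simp
    finally show ?thesis by (simp add: card_cartesian_product)
  qed
  define E where "E i = {\<omega>\<in>space M. \<bar>G (fst (snd i)) (fst i) \<omega> - G (snd (snd i)) (fst i) \<omega>\<bar> > cx TYPE('p) k}" for i
  have meas: "G v j \<in> borel_measurable M" "G w j \<in> borel_measurable M" if "near k v w" for v w j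
    using that assms(2) by (auto simp: near_def)
  have Es: "E i \<in> sets M" if "i \<in> ?I" for i
  proof -
    have [measurable]: "G (fst (snd i)) (fst i) \<in> borel_measurable M" "G (snd (snd i)) (fst i) \<in> borel_measurable M"
      using that meas by auto
    show ?thesis unfolding E_def by measurable
  qed
  have eq: "bad M G k = (\<Union>i\<in>?I. E i)" by (force simp: bad_def tame_def E_def not_le)
  show "bad M G k \<in> sets M" unfolding eq using finI Es by (intro sets.finite_UN) auto
  have lp: "lam k > 0" by (simp add: lam_def)
  have PE: "prob (E i) \<le> 2 * exp (?p - (2 * ?p + 1) * real (Suc k))" if i: "i \<in> ?I" for i
  proof -
    obtain j v w where ijv: "i = (j,(v,w))" "near k v w" using i by auto
    define Y where "Y \<omega> = G v j \<omega> - G w j \<omega>" for \<omega>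
    have [measurable]: "Y \<in> borel_measurable M" unfolding Y_def[abs_def] using meas[OF ijv(2), of j] by measurable
    have m: "integrable M (\<lambda>\<omega>. exp (s * lam k * Y \<omega>))" "(\<integral>\<omega>. exp (s * lam k * Y \<omega>) \<partial>M) \<le> exp ?p" if "s \<in> {-1,1}" for s
      using mg ijv(2) that unfolding incr_mgf_def Y_def by blast+
    have "E i \<subseteq> {\<omega>\<in>space M. Y \<omega> > cx TYPE('p) k} \<union> {\<omega>\<in>space M. - Y \<omega> > cx TYPE('p) k}"
      unfolding E_def ijv Y_def by auto
    then have "prob (E i) \<le> prob ({\<omega>\<in>space M. Y \<omega> > cx TYPE('p) k} \<union> {\<omega>\<in>space M. - Y \<omega> > cx TYPE('p) k})"
      by (intro finite_measure_mono) auto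
    also have "\<dots> \<le> prob {\<omega>\<in>space M. Y \<omega> > cx TYPE('p) k} + prob {\<omega>\<in>space M. - Y \<omega> > cx TYPE('p) k}"
      by (intro measure_Un_le) auto
    also have "\<dots> \<le> exp (?p - lam k * cx TYPE('p) k) + exp (?p - lam k * cx TYPE('p) k)"
      using m[of 1] m[of "-1"] lp by (intro add_mono exp_tail) auto
    finally show ?thesis by (simp add: lam_cx)
  qed
  have "prob (bad M G k) \<le> (\<Sum>i\<in>?I. prob (E i))"
    unfolding eq using finI Es by (intro measure_UNION_le) auto
  also have "\<dots> \<le> real (card ?I) * (2 * exp (?p - (2 * ?p + 1) * real (Suc k)))"
    by (rule sum_bounded_above[OF PE])
  also have "\<dots> \<le> (real CARD('m) * exp (2 * ?p * real (Suc k))) * (2 * exp (?p - (2 * ?p + 1) * real (Suc k)))"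
    using cardI by (intro mult_right_mono) auto
  also have "\<dots> = 2 * real CARD('m) * (exp (2 * ?p * real (Suc k)) * exp (?p - (2 * ?p + 1) * real (Suc k)))" by simp
  also have "\<dots> = 2 * real CARD('m) * (exp ?p * exp (- real (Suc k)))"
    by (simp add: exp_add[symmetric] algebra_simps)
  finally show "prob (bad M G k) \<le> 2 * real CARD('m) * exp (real CARD('p)) * exp (- real (Suc k))" by simp
qed

definition ceta :: "real \<Rightarrow> nat \<Rightarrow> real" where
  "ceta c k0 = (\<Sum>i. c * exp (- real (Suc (i + k0))))"

lemma summable_exp_neg: "summable (\<lambda>i. c * exp (- real (Suc i)))"
proof -
  have "summable (\<lambda>i. exp (-1::real) ^ i)" by (intro summable_geometric) auto
  from summable_mult[OF this, of "c * exp (-1)"] show ?thesis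
    by (simp add: exp_of_nat_mult[symmetric] exp_add[symmetric] mult.assoc algebra_simps)
qed

lemma ceta_tendsto: "ceta c \<longlonglongrightarrow> 0"
  unfolding ceta_def[abs_def] using suminf_exist_split2[OF summable_exp_neg] by simp

lemma sum_le_ceta: "0 \<le> c \<Longrightarrow> (\<Sum>k=k0..<K. c * exp (- real (Suc k))) \<le> ceta c k0"
proof -
  assume c: "0 \<le> c"
  have "(\<Sum>k=k0..<K. c * exp (- real (Suc k))) = (\<Sum>i<K-k0. c * exp (- real (Suc (i + k0))))"
    by (rule sum.reindex_bij_witness[of _ "\<lambda>i. i + k0" "\<lambda>k. k - k0"]) auto
  also have "\<dots> \<le> ceta c k0" unfolding ceta_def
    using summable_ignore_initial_segment[OF summable_exp_neg] c by (intro sum_le_suminf) auto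
  finally show ?thesis .
qed

section \<open>Conditional margins and the function D\<close>

text \<open>By continuity and monotonicity the sublevel set is a closed half-line, and the
  intermediate value theorem shows that the level is attained at its right end. It can be empty only
  at t = 0, because the cdf tends to 0 at -\<infinity>.\<close>

lemma (in real_distribution) cdf_sublevel_eq:
  assumes c: "continuous_on UNIV (cdf M)" and t: "0 \<le> t" "t < 1"
  shows "{x. cdf M x \<le> t} = {} \<and> t = 0 \<or> (\<exists>s. cdf M s = t \<and> {x. cdf M x \<le> t} = {..s})"
proof (cases "{x. cdf M x \<le> t} = {}")
  case True
  have "t = 0"
  proof (rule ccontr)
    assume "t \<noteq> 0"
    then have "eventually (\<lambda>x. cdf M x < t) at_bot" using t by (intro order_tendstoD(2)[OF cdf_lim_at_bot]) auto
    then obtain x where "cdf M x < t" by (meson eventually_at_bot_linorder order_refl)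
    then show False using True by (auto dest: less_imp_le)
  qed
  then show ?thesis using True by simp
next
  case False
  let ?S = "{x. cdf M x \<le> t}"
  have "eventually (\<lambda>x. t < cdf M x) at_top" using t by (intro order_tendstoD(1)[OF cdf_lim_at_top_prob]) auto
  then obtain b where b: "t < cdf M b" by (meson eventually_at_top_linorder order_refl)
  have lt: "x < b" if "x \<in> ?S" for x
    using cdf_nondecreasing[of b x] that b by (intro not_le_imp_less notI) simp
  then have bdd: "bdd_above ?S" by (intro bdd_aboveI[of _ b]) (auto dest: less_imp_le)
  have cl: "closed ?S"
    using continuous_on_closed_Collect_le[OF c continuous_on_const, of t] by simp
  define s where "s = Sup ?S"
  have s: "s \<in> ?S" unfolding s_def by (rule closed_contains_Sup[OF False bdd cl])
  have S: "?S = {..s}"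
    using cSup_upper[OF _ bdd] s cdf_nondecreasing order_trans by (auto simp: s_def) blast
  obtain y where y: "s \<le> y" "cdf M y = t"
    using IVT'[of "cdf M" s t b] s b lt[OF s] c continuous_on_subset[OF c] by (metis less_imp_le mem_Collect_eq subset_UNIV)
  then have "y \<in> ?S" by simp
  then have "y = s" using S y by auto
  then show ?thesis using S y by blast
qed

text \<open>The probability integral transform: F(X) is uniform on [0, 1] although F may have flat
  pieces.\<close>

lemma (in real_distribution) prob_cdf_le:
  assumes c: "continuous_on UNIV (cdf M)"
  shows "prob {x. cdf M x \<le> t} = max 0 (min 1 t)"
proof -
  have b: "0 \<le> cdf M x" "cdf M x \<le> 1" for x by (auto simp: cdf_def)
  consider "t < 0" | "0 \<le> t" "t < 1" | "1 \<le> t" by linarith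
  then show ?thesis
  proof cases
    case 1
    then have "{x. cdf M x \<le> t} = {}" using b(1) by (auto simp: not_le intro: less_le_trans)
    then show ?thesis using 1 by simp
  next
    case 2
    from cdf_sublevel_eq[OF c 2] show ?thesis
    proof
      assume a: "{x. cdf M x \<le> t} = {} \<and> t = 0"
      have "prob {x. cdf M x \<le> t} = prob {}" by (rule arg_cong[OF conjunct1[OF a]])
      then show ?thesis using conjunct2[OF a] by simp
    next
      assume "\<exists>s. cdf M s = t \<and> {x. cdf M x \<le> t} = {..s}"
      then obtain s where "cdf M s = t" "{x. cdf M x \<le> t} = {..s}" by blast
      then show ?thesis using 2 by (simp add: cdf_def)
    qed
  next
    case 3
    then have "{x. cdf M x \<le> t} = UNIV" using b(2) order_trans by blast
    then show ?thesis using 3 prob_space by simp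
  qed
qed

text \<open>A flat piece carries no mass: by the uniform law of F(X), the points beyond q with F x
  \<le> F q form a null set. Countably many rational q suffice, since one lies between any t <
  x.\<close>

lemma (in real_distribution) AE_cdf_increase:
  assumes c: "continuous_on UNIV (cdf M)"
  shows "AE x in M. 0 < cdf M x \<and> (\<forall>t<x. cdf M t < cdf M x)"
proof -
  have [measurable]: "cdf M \<in> borel_measurable borel" by (rule borel_measurable_continuous_onI[OF c])
  have z: "AE x in M. \<not> cdf M x \<le> 0"
  proof (rule AE_I')
    show "{x. cdf M x \<le> 0} \<in> null_sets M"
      using prob_cdf_le[OF c, of 0] by (simp add: null_sets_def emeasure_eq_measure)
  qed auto
  have r: "AE x in M. \<not> (cdf M x \<le> cdf M q \<and> q < x)" for q
  proof (rule AE_I')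
    have "prob ({x. cdf M x \<le> cdf M q} - {..q}) = prob {x. cdf M x \<le> cdf M q} - prob {..q}"
      by (rule finite_measure_Diff) (auto intro: cdf_nondecreasing)
    also have "\<dots> = 0" using prob_cdf_le[OF c, of "cdf M q"] by (simp add: cdf_def)
    finally show "{x. cdf M x \<le> cdf M q} - {..q} \<in> null_sets M"
      by (simp add: null_sets_def emeasure_eq_measure)
  qed auto
  have "AE x in M. \<forall>q\<in>\<rat>. \<not> (cdf M x \<le> cdf M q \<and> q < x)"
    using r by (subst AE_ball_countable) (auto simp: countable_rat)
  with z show ?thesis
  proof eventually_elim
    case (elim x)
    have "cdf M t < cdf M x" if tx: "t < x" for t
    proof -
      obtain q where q: "q \<in> \<rat>" "t < q" "q < x" using Rats_dense_in_real[OF tx] by auto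
      then have "cdf M q < cdf M x" using elim by auto
      then show ?thesis using cdf_nondecreasing[of t q] q by auto
    qed
    then show ?case using elim by auto
  qed
qed

lemma lipschitz_deriv_bound:
  fixes f :: "real \<Rightarrow> real"
  assumes "\<And>s t. \<bar>f s - f t\<bar> \<le> L * \<bar>s - t\<bar>" "DERIV f x :> d"
  shows "\<bar>d\<bar> \<le> L"
proof -
  have "((\<lambda>h. \<bar>(f (x + h) - f x) / h\<bar>) \<longlongrightarrow> \<bar>d\<bar>) (at 0)"
    using assms(2) by (intro tendsto_rabs) (simp add: DERIV_def)
  moreover have "\<forall>\<^sub>F h in at 0. \<bar>(f (x + h) - f x) / h\<bar> \<le> L"
  proof (rule eventually_at_topological[THEN iffD2], intro exI[of _ UNIV] conjI ballI impI)
    fix h :: real assume "h \<noteq> 0"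
    then show "\<bar>(f (x + h) - f x) / h\<bar> \<le> L" using assms(1)[of "x + h" x] by (simp add: abs_divide divide_simps)
  qed auto
  ultimately show ?thesis by (intro tendsto_upperbound) auto
qed

locale cond_law =
  fixes P :: "((real^'p) \<times> (real^'q)) measure" and A :: "('m::finite) \<Rightarrow> (real^'q) set"
  assumes prob_P: "prob_space P" and sets_P[measurable_cong]: "sets P = sets borel"
    and A_borel[measurable]: "\<And>j. A j \<in> sets borel"
    and pA_pos: "\<And>j. pA P (A j) > 0"
    and F_cont: "\<And>j k. continuous_on UNIV (condF P (A j) k)"
begin

sublocale P: prob_space P by (rule prob_P)

lemma space_P: "space P = UNIV" using sets_eq_imp_space_eq[OF sets_P] by simp

abbreviation F where "F j k \<equiv> condF P (A j) k"
abbreviation p where "p j \<equiv> pA P (A j)"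

lemma F_meas[measurable]: "F j k \<in> borel_measurable borel"
  by (rule borel_measurable_continuous_onI[OF F_cont])

lemma fst_meas'[measurable]: "(fst :: _ \<Rightarrow> real^'p) \<in> borel_measurable P"
  by (subst measurable_cong_sets[OF sets_P refl], subst borel_prod[symmetric]) (rule measurable_fst)

lemma snd_meas[measurable]: "(snd :: _ \<Rightarrow> real^'q) \<in> borel_measurable P"
  by (subst measurable_cong_sets[OF sets_P refl], subst borel_prod[symmetric]) (rule measurable_snd)

lemma fst_meas[measurable]: "(\<lambda>w. fst w $ k) \<in> borel_measurable P"
  by (rule measurable_compose[OF fst_meas']) (auto intro!: borel_measurable_continuous_onI continuous_intros)

definition Hs :: "real^'p \<Rightarrow> 'm \<Rightarrow> ((real^'p) \<times> (real^'q)) set" where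
  "Hs u j = {w. (\<forall>k. F j k (fst w $ k) \<le> u $ k) \<and> snd w \<in> A j}"

definition Ts :: "'p \<Rightarrow> real \<Rightarrow> 'm \<Rightarrow> ((real^'p) \<times> (real^'q)) set" where
  "Ts k c j = {w. F j k (fst w $ k) \<le> c \<and> snd w \<in> A j}"

lemma B_sets[measurable]: "{w. snd w \<in> A j} \<in> sets P"
proof -
  have "{w\<in>space P. snd w \<in> A j} \<in> sets P" by measurable
  then show ?thesis by (simp add: space_P)
qed

lemma Ts_sets[measurable]: "Ts k c j \<in> sets P"
proof -
  have "{w\<in>space P. F j k (fst w $ k) \<le> c \<and> snd w \<in> A j} \<in> sets P" by measurable
  then show ?thesis by (simp add: space_P Ts_def)
qed

lemma Hs_sets[measurable]: "Hs u j \<in> sets P"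
proof -
  have "{w\<in>space P. (\<forall>k. F j k (fst w $ k) \<le> u $ k) \<and> snd w \<in> A j} \<in> sets P" by measurable
  then show ?thesis by (simp add: space_P Hs_def)
qed

lemma Dfun_Hs: "Dfun P (A j) u = measure P (Hs u j)"
  by (simp add: Dfun_def Hs_def)

lemma p_le1: "p j \<le> 1" by (simp add: pA_def)

text \<open>The conditional law of X_k given Z in A_j; its cdf is \<open>F j k\<close>, which makes
  the facts on real distributions available.\<close>

definition mu :: "'m \<Rightarrow> 'p \<Rightarrow> real measure" where
  "mu j k = distr (uniform_measure P {w. snd w \<in> A j}) borel (\<lambda>w. fst w $ k)"

lemma emB: "emeasure P {w. snd w \<in> A j} \<noteq> 0" "emeasure P {w. snd w \<in> A j} \<noteq> \<infinity>"
  using pA_pos[of j] by (auto simp: pA_def P.emeasure_eq_measure)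

lemma measure_mu: "E \<in> sets borel \<Longrightarrow> measure (mu j k) E = measure P {w. fst w $ k \<in> E \<and> snd w \<in> A j} / p j"
proof -
  assume [measurable]: "E \<in> sets borel"
  have s: "{w. fst w $ k \<in> E} \<in> sets P"
  proof -
    have "{w\<in>space P. fst w $ k \<in> E} \<in> sets P" by measurable
    then show ?thesis by (simp add: space_P)
  qed
  have "measure (mu j k) E = measure (uniform_measure P {w. snd w \<in> A j}) {w. fst w $ k \<in> E}"
    unfolding mu_def by (subst measure_distr) (auto simp: space_P vimage_def)
  also have "\<dots> = measure P ({w. snd w \<in> A j} \<inter> {w. fst w $ k \<in> E}) / p j"
    unfolding pA_def by (rule measure_uniform_measure[OF emB s])
  also have "{w. snd w \<in> A j} \<inter> {w. fst w $ k \<in> E} = {w. fst w $ k \<in> E \<and> snd w \<in> A j}" by auto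
  finally show ?thesis .
qed

lemma real_dist_mu: "real_distribution (mu j k)"
  unfolding mu_def by (intro prob_space.real_distribution_distr prob_space_uniform_measure emB) simp

lemma cdf_mu: "cdf (mu j k) = F j k"
  by (rule ext) (simp add: cdf_def measure_mu condF_def)

lemma F_bounds: "0 \<le> F j k x" "F j k x \<le> 1"
proof -
  interpret real_distribution "mu j k" by (rule real_dist_mu)
  show "0 \<le> F j k x" "F j k x \<le> 1" unfolding cdf_mu[symmetric] cdf_def by auto
qed

lemma F_mono: "x \<le> y \<Longrightarrow> F j k x \<le> F j k y"
proof -
  interpret real_distribution "mu j k" by (rule real_dist_mu)
  show "x \<le> y \<Longrightarrow> F j k x \<le> F j k y" unfolding cdf_mu[symmetric] by (rule cdf_nondecreasing)
qed

lemma measure_Ts: "measure P (Ts k c j) = p j * max 0 (min 1 c)"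
proof -
  interpret real_distribution "mu j k" by (rule real_dist_mu)
  have "measure (mu j k) {x. cdf (mu j k) x \<le> c} = max 0 (min 1 c)"
    by (rule prob_cdf_le) (simp add: cdf_mu F_cont)
  then have "measure P {w. F j k (fst w $ k) \<le> c \<and> snd w \<in> A j} / p j = max 0 (min 1 c)"
    unfolding cdf_mu by (subst (asm) measure_mu) auto
  then show ?thesis using pA_pos[of j] by (simp add: Ts_def field_simps)
qed

lemma AE_good: "AE w in P. snd w \<in> A j \<longrightarrow> 0 < F j k (fst w $ k) \<and> (\<forall>t < fst w $ k. F j k t < F j k (fst w $ k))"
proof -
  interpret real_distribution "mu j k" by (rule real_dist_mu)
  have "AE x in mu j k. 0 < F j k x \<and> (\<forall>t<x. F j k t < F j k x)"
    using AE_cdf_increase unfolding cdf_mu by (simp add: F_cont)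
  then have "AE w in uniform_measure P {w. snd w \<in> A j}. 0 < F j k (fst w $ k) \<and> (\<forall>t < fst w $ k. F j k t < F j k (fst w $ k))"
    unfolding mu_def by (rule AE_distrD[rotated]) simp
  then show ?thesis using emB[of j] by (subst (asm) AE_uniform_measure) (auto simp: less_top[symmetric])
qed

definition l1 :: "real^'p \<Rightarrow> real^'p \<Rightarrow> real" where "l1 u v = (\<Sum>k\<in>UNIV. \<bar>u$k - v$k\<bar>)"

text \<open>The symmetric difference is covered by one strip per coordinate, and the strip of
  coordinate k has mass at most p_j \<bar>u_k - v_k\<bar> because the margin is uniform. Both the
  Lipschitz bound for D and the variance bounds come from here.\<close>

lemma measure_Hs_symdiff: "measure P ((Hs u j - Hs v j) \<union> (Hs v j - Hs u j)) \<le> p j * l1 u v"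
proof -
  let ?R = "\<lambda>k. Ts k (max (u$k) (v$k)) j - Ts k (min (u$k) (v$k)) j"
  have "measure P ((Hs u j - Hs v j) \<union> (Hs v j - Hs u j)) \<le> measure P (\<Union>k\<in>UNIV. ?R k)"
    by (rule P.finite_measure_mono) (auto simp: Hs_def Ts_def not_le le_max_iff_disj min_less_iff_disj)
  also have "\<dots> \<le> (\<Sum>k\<in>UNIV. measure P (?R k))"
    by (rule measure_UNION_le) auto
  also have "\<dots> \<le> (\<Sum>k\<in>UNIV. p j * \<bar>u$k - v$k\<bar>)"
  proof (rule sum_mono)
    fix k
    have "measure P (?R k) = p j * max 0 (min 1 (max (u$k) (v$k))) - p j * max 0 (min 1 (min (u$k) (v$k)))"
      by (subst P.finite_measure_Diff) (auto simp: measure_Ts, auto simp: Ts_def)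
    also have "\<dots> = p j * (max 0 (min 1 (max (u$k) (v$k))) - max 0 (min 1 (min (u$k) (v$k))))" by (simp add: algebra_simps)
    also have "\<dots> \<le> p j * \<bar>u$k - v$k\<bar>"
      using pA_pos[of j] by (intro mult_left_mono) auto
    finally show "measure P (?R k) \<le> p j * \<bar>u$k - v$k\<bar>" .
  qed
  finally show ?thesis by (simp add: l1_def sum_distrib_left)
qed

lemma measure_symdiff_le:
  assumes [measurable]: "S \<in> sets P" "T \<in> sets P"
  shows "\<bar>measure P S - measure P T\<bar> \<le> measure P ((S - T) \<union> (T - S))"
proof -
  have "measure P S \<le> measure P (T \<union> ((S - T) \<union> (T - S)))" by (rule P.finite_measure_mono) auto
  also have "\<dots> \<le> measure P T + measure P ((S - T) \<union> (T - S))" by (rule measure_Un_le) auto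
  finally have 1: "measure P S - measure P T \<le> measure P ((S - T) \<union> (T - S))" by simp
  have "measure P T \<le> measure P (S \<union> ((S - T) \<union> (T - S)))" by (rule P.finite_measure_mono) auto
  also have "\<dots> \<le> measure P S + measure P ((S - T) \<union> (T - S))" by (rule measure_Un_le) auto
  finally show ?thesis using 1 by simp
qed

lemma D_lipschitz: "\<bar>Dfun P (A j) u - Dfun P (A j) v\<bar> \<le> p j * l1 u v"
  unfolding Dfun_Hs using measure_symdiff_le[OF Hs_sets Hs_sets] measure_Hs_symdiff by (rule order_trans)

abbreviation one :: "real^'p" where "one \<equiv> (\<chi> k. 1)"

text \<open>Conditional margins never exceed 1, so coordinates equal to 1 impose no constraint and
  (u_k, 1_{-k}) is a one-dimensional event.\<close>

lemma Hs_margin: "Hs (upd one k c) j = Ts k c j"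
proof -
  have "(\<forall>l. F j l (x l) \<le> upd one k c $ l) \<longleftrightarrow> F j k (x k) \<le> c" for x :: "'p \<Rightarrow> real"
    using F_bounds(2) by (auto simp: upd_def split: if_splits)
  then show ?thesis by (auto simp: Hs_def Ts_def)
qed

lemma Hs_one: "Hs one j = {w. snd w \<in> A j}"
  using F_bounds(2) by (auto simp: Hs_def)

lemma D_margin: "0 \<le> c \<Longrightarrow> c \<le> 1 \<Longrightarrow> Dfun P (A j) (upd one k c) = p j * c"
  by (simp add: Dfun_Hs Hs_margin measure_Ts)

lemma D_one: "Dfun P (A j) one = p j"
  by (simp add: Dfun_Hs Hs_one pA_def)

lemma D_bounds: "0 \<le> Dfun P (A j) u" "Dfun P (A j) u \<le> p j"
  unfolding D_one[symmetric] by (auto simp: Dfun_Hs Hs_one intro!: P.finite_measure_mono) (auto simp: Hs_def)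

lemma l1_upd: "l1 (upd u k s) (upd u k t) = \<bar>s - t\<bar>"
proof -
  have "l1 (upd u k s) (upd u k t) = (\<Sum>i\<in>UNIV. if i = k then \<bar>s - t\<bar> else 0)"
    unfolding l1_def by (intro sum.cong) (auto simp: upd_def)
  then show ?thesis by (simp add: sum.delta)
qed

text \<open>Condition (C) says nothing at u_k = 0 and u_k = 1, where D may fail to be differentiable. There deriv
  returns the fixed value SOME D. False, so pD is bounded on the whole cube.\<close>
definition pDc :: real where "pDc = 1 + \<bar>SOME D::real. False\<bar>"

lemma pDc_ge: "1 \<le> pDc" by (simp add: pDc_def)

lemma pD_bound: "\<bar>pD P (A j) k u\<bar> \<le> pDc"
proof (cases "\<exists>D. DERIV (\<lambda>t. Dfun P (A j) (upd u k t)) (u$k) :> D")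
  case True
  then obtain D where D: "DERIV (\<lambda>t. Dfun P (A j) (upd u k t)) (u$k) :> D" by blast
  have "\<bar>D\<bar> \<le> p j"
  proof (rule lipschitz_deriv_bound[OF _ D])
    show "\<bar>Dfun P (A j) (upd u k s) - Dfun P (A j) (upd u k t)\<bar> \<le> p j * \<bar>s - t\<bar>" for s t
      using D_lipschitz[of j "upd u k s" "upd u k t"] by (simp add: l1_upd)
  qed
  moreover have "pD P (A j) k u = D" unfolding pD_def by (rule DERIV_imp_deriv[OF D])
  ultimately show ?thesis using p_le1[of j] by (simp add: pDc_def)
next
  case False
  then have "(\<lambda>D. DERIV (\<lambda>t. Dfun P (A j) (upd u k t)) (u$k) :> D) = (\<lambda>D. False)" by auto
  then have "pD P (A j) k u = (SOME D. False)" unfolding pD_def deriv_def by simp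
  then show ?thesis by (simp add: pDc_def)
qed

end

section \<open>Condition (C) and the first-order expansion of D\<close>

lemma upd_upd[simp]: "upd (upd u k s) k t = upd u k t" by (simp add: upd_def vec_eq_iff)
lemma upd_nth: "upd u k t $ l = (if l = k then t else u $ l)" by (simp add: upd_def)
lemma upd_same[simp]: "upd u k (u$k) = u" by (simp add: upd_def vec_eq_iff)
lemma upd_cube: "u \<in> unit_cube \<Longrightarrow> 0 \<le> t \<Longrightarrow> t \<le> 1 \<Longrightarrow> upd u k t \<in> unit_cube"
  by (simp add: unit_cube_def upd_def)

lemma one_cube: "(\<chi> k. 1) \<in> unit_cube" by (simp add: unit_cube_def)

lemma compact_unit_cube: "compact (unit_cube :: (real^'p) set)"
proof -
  have "(unit_cube :: (real^'p) set) = cbox 0 (\<chi> k. 1)" by (auto simp: unit_cube_def mem_box_cart)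
  then show ?thesis by (metis compact_cbox)
qed

locale cond_law_C = cond_law P A for P :: "((real^'p) \<times> (real^'q)) measure" and A :: "('m::finite) \<Rightarrow> (real^'q) set" +
  assumes cond_C: "\<And>j. condition_C P (A j)"
begin

lemma has_deriv_D:
  assumes "u \<in> unit_cube" "0 < t" "t < 1"
  shows "DERIV (\<lambda>t. Dfun P (A j) (upd u k t)) t :> pD P (A j) k (upd u k t)"
proof -
  have c: "upd u k t \<in> unit_cube" using assms by (intro upd_cube) auto
  note cond_C[of j, unfolded condition_C_def, THEN spec, of k, THEN conjunct1, THEN bspec, OF c]
  then have "(\<lambda>s. Dfun P (A j) (upd (upd u k t) k s)) differentiable (at (upd u k t $ k))"
    using assms by (simp add: upd_nth)
  then have "(\<lambda>s. Dfun P (A j) (upd u k s)) differentiable (at t)" by (simp add: upd_nth)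
  then have "DERIV (\<lambda>s. Dfun P (A j) (upd u k s)) t :> deriv (\<lambda>s. Dfun P (A j) (upd u k s)) t"
    by (simp add: DERIV_deriv_iff_real_differentiable)
  then show ?thesis by (simp add: pD_def upd_nth)
qed

lemma D_increment_mvt:
  assumes w: "w \<in> unit_cube" and s: "0 < s" "s < 1" "0 < t" "t < 1"
  obtains \<xi> where "min s t \<le> \<xi>" "\<xi> \<le> max s t"
    "Dfun P (A j) (upd w k t) - Dfun P (A j) (upd w k s) = pD P (A j) k (upd w k \<xi>) * (t - s)"
proof -
  let ?g = "\<lambda>t. Dfun P (A j) (upd w k t)"
  consider "s = t" | "s < t" | "t < s" by linarith
  then show ?thesis
  proof cases
    case 1 then show ?thesis using that[of s] by simp
  next
    case 2
    have "\<exists>z. s < z \<and> z < t \<and> ?g t - ?g s = (t - s) * pD P (A j) k (upd w k z)"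
      by (rule MVT2[OF 2]) (rule has_deriv_D[OF w]; use s in linarith)
    then obtain \<xi> where "s < \<xi>" "\<xi> < t" "?g t - ?g s = (t - s) * pD P (A j) k (upd w k \<xi>)" by blast
    then show ?thesis using that[of \<xi>] by (simp add: mult.commute)
  next
    case 3
    have "\<exists>z. t < z \<and> z < s \<and> ?g s - ?g t = (s - t) * pD P (A j) k (upd w k z)"
      by (rule MVT2[OF 3]) (rule has_deriv_D[OF w]; use s in linarith)
    then obtain \<xi> where x: "t < \<xi>" "\<xi> < s" "?g s - ?g t = (s - t) * pD P (A j) k (upd w k \<xi>)" by blast
    have "?g t - ?g s = pD P (A j) k (upd w k \<xi>) * (t - s)" using x(3) by (simp add: algebra_simps)
    then show ?thesis using that[of \<xi>] x by simp
  qed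
qed

text \<open>Continuity is given on the open slab 0 < u_k < 1 only; keeping distance a from both
  faces leaves a compact set, where it becomes uniform.\<close>

lemma pD_uniform:
  assumes "0 < a" "0 < e"
  obtains d where "0 < d" "\<And>x y. x \<in> unit_cube \<Longrightarrow> y \<in> unit_cube \<Longrightarrow> a \<le> x$k \<Longrightarrow> x$k \<le> 1 - a \<Longrightarrow>
    a \<le> y$k \<Longrightarrow> y$k \<le> 1 - a \<Longrightarrow> l1 x y < d \<Longrightarrow> \<bar>pD P (A j) k x - pD P (A j) k y\<bar> < e"
proof -
  let ?S = "{u \<in> unit_cube. a \<le> u$k \<and> u$k \<le> 1 - a}"
  have "?S = unit_cube \<inter> {u. a \<le> u$k} \<inter> {u. u$k \<le> 1 - a}" by auto
  moreover have "closed {u::real^'p. a \<le> u$k}" "closed {u::real^'p. u$k \<le> 1 - a}"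
    by (intro closed_Collect_le continuous_intros)+
  ultimately have "compact ?S" using compact_unit_cube by (auto intro: compact_Int_closed)
  moreover have "continuous_on ?S (pD P (A j) k)"
    using cond_C[of j] assms unfolding condition_C_def by (auto intro: continuous_on_subset)
  ultimately have "uniformly_continuous_on ?S (pD P (A j) k)" by (intro compact_uniformly_continuous)
  then obtain d where d: "d > 0" "\<And>x y. x \<in> ?S \<Longrightarrow> y \<in> ?S \<Longrightarrow> dist y x < d \<Longrightarrow> dist (pD P (A j) k y) (pD P (A j) k x) < e"
    using uniformly_continuous_onE[OF _ assms(2)] by blast
  have "dist y x \<le> l1 x y" for x y :: "real^'p"
    using norm_le_l1_cart[of "y - x"] by (simp add: dist_norm l1_def abs_minus_commute)
  then have "\<bar>pD P (A j) k x - pD P (A j) k y\<bar> < e" if "x \<in> ?S" "y \<in> ?S" "l1 x y < d" for x y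
    using d(2)[OF that(1,2)] that(3) le_less_trans by (fastforce simp: dist_real_def abs_minus_commute)
  then show ?thesis using d(1) by (intro that[of d]) auto
qed

text \<open>Coordinates are switched from u to v one at a time. An inner coordinate is handled by
  the mean value theorem and uniform continuity, at cost e. A coordinate near a face has no usable
  derivative: the increment of D costs at most 1 per unit by the Lipschitz bound, and the linear
  term at most \<open>pDc\<close>.\<close>

lemma D_expand:
  assumes a: "0 < a" and e: "0 < e"
  shows "\<exists>d>0. \<forall>u\<in>unit_cube. \<forall>v\<in>unit_cube. (\<forall>i. \<bar>u$i - v$i\<bar> \<le> d) \<longrightarrow>
    \<bar>Dfun P (A j) v - Dfun P (A j) u - (\<Sum>i\<in>UNIV. pD P (A j) i u * (v$i - u$i))\<bar>
      \<le> (\<Sum>i\<in>UNIV. (if a \<le> u$i \<and> u$i \<le> 1 - a then e else 1 + pDc) * \<bar>v$i - u$i\<bar>)"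
proof -
  have "\<exists>d>0. \<forall>x\<in>unit_cube. \<forall>y\<in>unit_cube. a/2 \<le> x$k \<longrightarrow> x$k \<le> 1 - a/2 \<longrightarrow>
    a/2 \<le> y$k \<longrightarrow> y$k \<le> 1 - a/2 \<longrightarrow> l1 x y < d \<longrightarrow> \<bar>pD P (A j) k x - pD P (A j) k y\<bar> < e" for k
    using pD_uniform[of "a/2" e k j] a e by (metis half_gt_zero)
  then obtain dk where dk: "\<And>k. dk k > 0" "\<And>k x y. x \<in> unit_cube \<Longrightarrow> y \<in> unit_cube \<Longrightarrow> a/2 \<le> x$k \<Longrightarrow> x$k \<le> 1 - a/2 \<Longrightarrow>
    a/2 \<le> y$k \<Longrightarrow> y$k \<le> 1 - a/2 \<Longrightarrow> l1 x y < dk k \<Longrightarrow> \<bar>pD P (A j) k x - pD P (A j) k y\<bar> < e"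
    by metis
  \<comment> \<open>The bound a/2 keeps intermediate points at distance a/2 from the faces. The
    second bound makes CARD('p) d smaller than every \<open>dk k\<close>, strictly because of the +
    1.\<close>
  define d where "d = min (a/2) (Min (range dk) / (real CARD('p) + 1))"
  have "Min (range dk) > 0" using dk(1) by (subst Min_gr_iff) auto
  then have dpos: "d > 0" using a by (simp add: d_def)
  have dd: "real CARD('p) * d < dk k" for k
  proof -
    have "real CARD('p) * d < (real CARD('p) + 1) * d" using dpos by simp
    also have "\<dots> \<le> (real CARD('p) + 1) * (Min (range dk) / (real CARD('p) + 1))"
      unfolding d_def by (intro mult_left_mono min.cobounded2) auto
    also have "\<dots> = Min (range dk)" by simp
    also have "\<dots> \<le> dk k" by (rule Min_le) auto
    finally show ?thesis .
  qed
  have "\<bar>Dfun P (A j) v - Dfun P (A j) u - (\<Sum>i\<in>UNIV. pD P (A j) i u * (v$i - u$i))\<bar>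
      \<le> (\<Sum>i\<in>UNIV. (if a \<le> u$i \<and> u$i \<le> 1 - a then e else 1 + pDc) * \<bar>v$i - u$i\<bar>)"
    if u: "u \<in> unit_cube" and v: "v \<in> unit_cube" and uv: "\<And>i. \<bar>u$i - v$i\<bar> \<le> d" for u v
  proof -
    define w where "w S = (\<chi> i. if i \<in> S then v$i else u$i)" for S
    let ?r = "\<lambda>i. if a \<le> u$i \<and> u$i \<le> 1 - a then e else 1 + pDc"
    have "\<bar>Dfun P (A j) (w S) - Dfun P (A j) u - (\<Sum>i\<in>S. pD P (A j) i u * (v$i - u$i))\<bar> \<le> (\<Sum>i\<in>S. ?r i * \<bar>v$i - u$i\<bar>)" for S
    proof (induction S rule: infinite_finite_induct)
      case (infinite S) then show ?case by simp
    next
      case empty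
      have "w {} = u" by (simp add: w_def vec_eq_iff)
      then show ?case by simp
    next
      case (insert i S)
      have wc: "w S \<in> unit_cube" using u v by (auto simp: w_def unit_cube_def)
      have w1: "w (insert i S) = upd (w S) i (v$i)" by (auto simp: w_def upd_def vec_eq_iff)
      have w2: "w S = upd (w S) i (u$i)" using insert.hyps by (auto simp: w_def upd_def vec_eq_iff)
      have "\<bar>Dfun P (A j) (w (insert i S)) - Dfun P (A j) (w S) - pD P (A j) i u * (v$i - u$i)\<bar> \<le> ?r i * \<bar>v$i - u$i\<bar>"
      proof (cases "a \<le> u$i \<and> u$i \<le> 1 - a")
        case True
        have da: "d \<le> a/2" unfolding d_def by (rule min.cobounded1)
        have vb: "a/2 \<le> v$i" "v$i \<le> 1 - a/2" "a/2 \<le> u$i" "u$i \<le> 1 - a/2" using True uv[of i] da a by auto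
        have "0 < u$i" "u$i < 1" "0 < v$i" "v$i < 1" using vb a by auto
        from D_increment_mvt[OF wc this] obtain \<xi> where x: "min (u$i) (v$i) \<le> \<xi>" "\<xi> \<le> max (u$i) (v$i)"
          and eq: "Dfun P (A j) (upd (w S) i (v$i)) - Dfun P (A j) (upd (w S) i (u$i)) = pD P (A j) i (upd (w S) i \<xi>) * (v$i - u$i)" by metis
        have xb: "a/2 \<le> \<xi>" "\<xi> \<le> 1 - a/2" using x vb by (auto simp: min_def max_def split: if_splits)
        have xu: "\<bar>\<xi> - u$i\<bar> \<le> d" using x uv[of i] by (auto simp: min_def max_def split: if_splits)
        have "l1 (upd (w S) i \<xi>) u \<le> (\<Sum>k\<in>(UNIV::'p set). d)"
          unfolding l1_def using xu uv dpos by (intro sum_mono) (auto simp: upd_nth w_def abs_minus_commute less_imp_le)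
        then have "l1 (upd (w S) i \<xi>) u < dk i" using dd[of i] by simp
        then have "\<bar>pD P (A j) i (upd (w S) i \<xi>) - pD P (A j) i u\<bar> < e"
          using xb vb u upd_cube[OF wc, of \<xi> i] a by (intro dk(2)) (auto simp: upd_nth)
        then have "\<bar>pD P (A j) i (upd (w S) i \<xi>) - pD P (A j) i u\<bar> * \<bar>v$i - u$i\<bar> \<le> e * \<bar>v$i - u$i\<bar>"
          by (intro mult_right_mono) auto
        then show ?thesis using True eq w1 w2 by (simp add: abs_mult[symmetric] left_diff_distrib)
      next
        case False
        have "\<bar>Dfun P (A j) (w (insert i S)) - Dfun P (A j) (w S)\<bar> \<le> p j * \<bar>v$i - u$i\<bar>"
          unfolding w1 by (subst w2) (use D_lipschitz[of j "upd (w S) i (v$i)" "upd (w S) i (u$i)"] in \<open>simp only: l1_upd\<close>)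
        also have "\<dots> \<le> 1 * \<bar>v$i - u$i\<bar>" using p_le1 by (intro mult_right_mono) auto
        finally have 1: "\<bar>Dfun P (A j) (w (insert i S)) - Dfun P (A j) (w S)\<bar> \<le> \<bar>v$i - u$i\<bar>" by simp
        have 2: "\<bar>pD P (A j) i u * (v$i - u$i)\<bar> \<le> pDc * \<bar>v$i - u$i\<bar>"
          unfolding abs_mult using pD_bound by (intro mult_right_mono) auto
        have "\<bar>Dfun P (A j) (w (insert i S)) - Dfun P (A j) (w S) - pD P (A j) i u * (v$i - u$i)\<bar> \<le> \<bar>v$i - u$i\<bar> + pDc * \<bar>v$i - u$i\<bar>"
          using 1 2 by linarith
        then show ?thesis unfolding if_not_P[OF False] by (simp add: distrib_right)
      qed
      then show ?case using insert by simp
    qed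
    from this[of UNIV] show ?thesis by (simp add: w_def)
  qed
  then show ?thesis using dpos by blast
qed

end

section \<open>The empirical process\<close>

lemma exp_le_quadratic: "\<bar>y\<bar> \<le> 1 \<Longrightarrow> exp y \<le> 1 + y + y\<^sup>2" for y :: real
proof (cases "0 \<le> y")
  case True
  assume "\<bar>y\<bar> \<le> 1"
  then show ?thesis using exp_bound[of y] True by simp
next
  case False
  assume a: "\<bar>y\<bar> \<le> 1"
  define z where "z = - y"
  have z: "0 \<le> z" "z \<le> 1" using False a by (auto simp: z_def)
  have q: "0 < 1 + z + z\<^sup>2 / 2" using z by (simp add: add_pos_nonneg)
  have "1 \<le> 1 + z\<^sup>2/2 + z^3/2 + z^4/2" using z by simp
  also have "\<dots> = (1 - z + z\<^sup>2) * (1 + z + z\<^sup>2 / 2)" by (simp add: field_simps power2_eq_square power3_eq_cube power4_eq_xxxx)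
  \<comment> \<open>For y = -z the product (1 - z + z^2) (1 + z + z^2 / 2) is at least 1, and its
    second factor is a lower bound for exp z.\<close>
  finally have "1 / (1 + z + z\<^sup>2 / 2) \<le> 1 - z + z\<^sup>2" using q by (simp add: divide_simps)
  moreover have "1 / exp z \<le> 1 / (1 + z + z\<^sup>2 / 2)"
    using exp_lower_Taylor_quadratic[OF z(1)] q by (intro divide_left_mono) auto
  ultimately show ?thesis by (simp add: z_def exp_minus inverse_eq_divide)
qed

context cond_law
begin

definition Hx :: "(real^'p) \<times> 'm \<Rightarrow> ((real^'p) \<times> (real^'q)) set" where "Hx s = Hs (fst s) (snd s)"

definition cen :: "(real^'p) \<times> 'm \<Rightarrow> ((real^'p) \<times> (real^'q)) \<Rightarrow> real" where
  "cen s w = indicator (Hx s) w - measure P (Hx s)"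

lemma Hx_sets[measurable]: "Hx s \<in> sets P" by (simp add: Hx_def Hs_sets)

lemma cen_meas[measurable]: "cen s \<in> borel_measurable P" unfolding cen_def[abs_def] by measurable

lemma cen_bound: "\<bar>cen s w\<bar> \<le> 1"
proof -
  define m where "m = measure P (Hx s)"
  have "0 \<le> m" "m \<le> 1" by (auto simp: m_def)
  then show ?thesis unfolding cen_def m_def[symmetric] by (auto simp: indicator_def)
qed

lemma prob_UNIV[simp]: "measure P UNIV = 1" using P.prob_space by (simp add: space_P)

lemma cen_integrable: "integrable P (cen s)"
  by (rule P.integrable_const_bound[of _ 1]) (auto simp: cen_bound)

lemma cen_mean: "(\<integral>w. cen s w \<partial>P) = 0"
  unfolding cen_def by (subst Bochner_Integration.integral_diff) (auto simp: P.prob_space P.emeasure_eq_measure space_P)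

lemma Gam_Hx: "Gam P A s s' = measure P (Hx s \<inter> Hx s') - measure P (Hx s) * measure P (Hx s')"
proof -
  obtain u j v k where s: "s = (u,j)" "s' = (v,k)" by (metis surj_pair)
  have "{w. (\<forall>l. F j l (fst w $ l) \<le> u $ l) \<and> (\<forall>l. F k l (fst w $ l) \<le> v $ l) \<and> snd w \<in> A j \<inter> A k} = Hs u j \<inter> Hs v k"
    by (auto simp: Hs_def)
  then show ?thesis by (simp add: Gam_def s Hx_def Dfun_Hs)
qed

lemma Gam_sym: "Gam P A s s' = Gam P A s' s" by (simp add: Gam_Hx Int_commute)

lemma Gam_cov: "Gam P A s s' = (\<integral>w. cen s w * cen s' w \<partial>P)"
proof -
  let ?a = "measure P (Hx s)" and ?b = "measure P (Hx s')"
  have i: "integrable P (\<lambda>w. indicator S w :: real)" if "S \<in> sets P" for S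
    using that by (simp add: P.emeasure_eq_measure)
  have "(\<integral>w. cen s w * cen s' w \<partial>P) = (\<integral>w. indicator (Hx s \<inter> Hx s') w - ?b * indicator (Hx s) w - ?a * indicator (Hx s') w + ?a * ?b \<partial>P)"
    by (intro Bochner_Integration.integral_cong refl) (auto simp: cen_def indicator_def algebra_simps)
  also have "\<dots> = measure P (Hx s \<inter> Hx s') - ?b * ?a - ?a * ?b + ?a * ?b"
    using i[OF Hx_sets] i[OF sets.Int[OF Hx_sets Hx_sets]] by (simp add: P.prob_space space_P)
  finally show ?thesis by (simp add: Gam_Hx)
qed

lemma cen_mult_integrable: "integrable P (\<lambda>w. cen s w * cen s' w)"
  using mult_mono[OF cen_bound cen_bound] by (intro P.integrable_const_bound[of _ 1]) (auto simp: abs_mult)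

text \<open>Read as a second moment, the form is nonnegative, which yields the positive
  semidefiniteness needed for the construction of B; the same number is the variance in the central
  limit theorem.\<close>

lemma Gam_quad:
  "(\<Sum>s\<in>I. \<Sum>s'\<in>I. c s * c s' * Gam P A (f s) (f s')) = (\<integral>w. (\<Sum>s\<in>I. c s * cen (f s) w)\<^sup>2 \<partial>P)"
proof -
  have "(\<integral>w. (\<Sum>s\<in>I. c s * cen (f s) w)\<^sup>2 \<partial>P) = (\<integral>w. (\<Sum>s\<in>I. \<Sum>s'\<in>I. c s * c s' * (cen (f s) w * cen (f s') w)) \<partial>P)"
    by (intro Bochner_Integration.integral_cong refl) (simp add: power2_eq_square sum_product mult_ac)
  also have "\<dots> = (\<Sum>s\<in>I. \<Sum>s'\<in>I. c s * c s' * Gam P A (f s) (f s'))"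
    by (simp add: Gam_cov cen_mult_integrable)
  finally show ?thesis by simp
qed

text \<open>A variance is at most the second moment, and the squared difference of two indicators is
  the indicator of the symmetric difference.\<close>

lemma cen_incr: "(\<integral>w. (cen (u,j) w - cen (v,j) w)\<^sup>2 \<partial>P) \<le> l1 u v"
proof -
  let ?a = "Hs u j" and ?b = "Hs v j"
  define f where "f w = indicator ?a w - (indicator ?b w :: real)" for w
  have [measurable]: "f \<in> borel_measurable P" unfolding f_def[abs_def] by measurable
  have fi: "integrable P f" by (rule P.integrable_const_bound[of _ 1]) (auto simp: f_def indicator_def)
  have f2: "integrable P (\<lambda>w. (f w)\<^sup>2)" by (rule P.integrable_const_bound[of _ 1]) (auto simp: f_def indicator_def)
  have m: "P.expectation f = measure P ?a - measure P ?b"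
    unfolding f_def by (subst Bochner_Integration.integral_diff) (auto simp: P.emeasure_eq_measure space_P)
  have "cen (u,j) w - cen (v,j) w = f w - P.expectation f" for w
    unfolding m by (simp add: cen_def Hx_def f_def)
  then have "(\<integral>w. (cen (u,j) w - cen (v,j) w)\<^sup>2 \<partial>P) = P.variance f" by simp
  also have "\<dots> \<le> (\<integral>w. (f w)\<^sup>2 \<partial>P)" using P.variance_eq[OF fi f2] by simp
  also have "\<dots> = (\<integral>w. indicator ((?a - ?b) \<union> (?b - ?a)) w \<partial>P)"
    by (intro Bochner_Integration.integral_cong refl) (auto simp: f_def indicator_def)
  also have "\<dots> = measure P ((?a - ?b) \<union> (?b - ?a))" by (simp add: space_P)
  also have "\<dots> \<le> p j * l1 u v" by (rule measure_Hs_symdiff)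
  also have "\<dots> \<le> 1 * l1 u v" using p_le1 by (intro mult_right_mono) (auto simp: l1_def sum_nonneg)
  finally show ?thesis by simp
qed

lemma D_lipschitz1: "\<bar>measure P (Hs u j) - measure P (Hs v j)\<bar> \<le> l1 u v"
proof -
  have "\<bar>measure P (Hs u j) - measure P (Hs v j)\<bar> \<le> p j * l1 u v" using D_lipschitz by (simp add: Dfun_Hs)
  also have "\<dots> \<le> 1 * l1 u v" using p_le1 by (intro mult_right_mono) (auto simp: l1_def sum_nonneg)
  finally show ?thesis by simp
qed

lemma l1_tendsto: "un \<longlonglongrightarrow> u \<Longrightarrow> (\<lambda>n. l1 (un n) u) \<longlonglongrightarrow> 0"
proof -
  assume "un \<longlonglongrightarrow> u"
  then have "(\<lambda>n. l1 (un n) u) \<longlonglongrightarrow> (\<Sum>k\<in>UNIV. \<bar>u$k - u$k\<bar>)"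
    unfolding l1_def by (intro tendsto_intros)
  then show ?thesis by simp
qed

text \<open>Identifies the covariance of the limit process at points that are not dyadic. The
  symmetric difference of two intersections lies in the union of the symmetric differences.\<close>

lemma Gam_cont:
  assumes u: "un \<longlonglongrightarrow> u" and v: "vn \<longlonglongrightarrow> v"
  shows "(\<lambda>n. Gam P A (un n, j) (vn n, k)) \<longlonglongrightarrow> Gam P A (u,j) (v,k)"
proof -
  have 1: "(\<lambda>n. measure P (Hs (un n) i)) \<longlonglongrightarrow> measure P (Hs u i)" if "un \<longlonglongrightarrow> u" for un u i
  proof -
    have "(\<lambda>n. measure P (Hs (un n) i) - measure P (Hs u i)) \<longlonglongrightarrow> 0"
      by (rule Lim_null_comparison[OF always_eventually l1_tendsto[OF that]]) (simp add: D_lipschitz1)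
    then show ?thesis by (simp add: LIM_zero_iff)
  qed
  have 2: "\<bar>measure P (Hs a j \<inter> Hs b k) - measure P (Hs a' j \<inter> Hs b' k)\<bar> \<le> l1 a a' + l1 b b'" for a a' b b'
  proof -
    let ?A = "(Hs a j - Hs a' j) \<union> (Hs a' j - Hs a j)" and ?B = "(Hs b k - Hs b' k) \<union> (Hs b' k - Hs b k)"
    have "\<bar>measure P (Hs a j \<inter> Hs b k) - measure P (Hs a' j \<inter> Hs b' k)\<bar>
        \<le> measure P ((Hs a j \<inter> Hs b k - Hs a' j \<inter> Hs b' k) \<union> (Hs a' j \<inter> Hs b' k - Hs a j \<inter> Hs b k))"
      by (rule measure_symdiff_le) auto
    also have "\<dots> \<le> measure P (?A \<union> ?B)" by (rule P.finite_measure_mono) auto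
    also have "\<dots> \<le> measure P ?A + measure P ?B" by (rule measure_Un_le) auto
    also have "\<dots> \<le> p j * l1 a a' + p k * l1 b b'" by (intro add_mono measure_Hs_symdiff)
    also have "\<dots> \<le> 1 * l1 a a' + 1 * l1 b b'" using p_le1 by (intro add_mono mult_right_mono) (auto simp: l1_def sum_nonneg)
    finally show ?thesis by simp
  qed
  have "(\<lambda>n. l1 (un n) u + l1 (vn n) v) \<longlonglongrightarrow> 0 + 0" by (intro tendsto_intros l1_tendsto u v)
  then have l: "(\<lambda>n. l1 (un n) u + l1 (vn n) v) \<longlonglongrightarrow> 0" by simp
  have "(\<lambda>n. measure P (Hs (un n) j \<inter> Hs (vn n) k) - measure P (Hs u j \<inter> Hs v k)) \<longlonglongrightarrow> 0"
    by (rule Lim_null_comparison[OF always_eventually l]) (simp add: 2)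
  then have "(\<lambda>n. measure P (Hs (un n) j \<inter> Hs (vn n) k)) \<longlonglongrightarrow> measure P (Hs u j \<inter> Hs v k)" by (simp add: LIM_zero_iff)
  then show ?thesis unfolding Gam_Hx Hx_def fst_conv snd_conv by (intro tendsto_intros 1 u v)
qed

lemma near_l1: "near k v w \<Longrightarrow> l1 v w \<le> real CARD('p) / 2^k"
proof -
  assume "near k v w"
  then have "l1 v w \<le> (\<Sum>i\<in>(UNIV::'p set). 1 / 2^k)" unfolding l1_def near_def by (intro sum_mono) auto
  then show ?thesis by simp
qed

lemma lam_sq: "(lam k)\<^sup>2 = 2^k / 4"
  by (simp add: lam_def power_divide power_mult[symmetric] mult.commute[of k] power_mult)

text \<open>Component j of the limit map as an operator on a single path; it is applied to G_n in
  the expansion and to B in the limit, and \<open>Cinf_comp\<close> ties it to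
  \<open>Cinf_vec\<close>.\<close>

definition Lop :: "'m \<Rightarrow> (real^'p \<Rightarrow> real) \<Rightarrow> real^'p \<Rightarrow> real" where
  "Lop j B u = B u / p j - (\<Sum>i\<in>UNIV. pD P (A j) i u / (p j)\<^sup>2 * (B (upd one i (u$i)) - u$i * B one)) - Dfun P (A j) u / (p j)\<^sup>2 * B one"

end

locale emp_sample = cond_law_C P A for P :: "((real^'p) \<times> (real^'q)) measure" and A :: "('m::finite) \<Rightarrow> (real^'q) set" +
  fixes M :: "'a measure" and W :: "nat \<Rightarrow> 'a \<Rightarrow> (real^'p) \<times> (real^'q)"
  assumes prob_M: "prob_space M"
    and W_indep: "prob_space.indep_vars M (\<lambda>_. borel) W UNIV"
    and W_distr: "\<And>i. distr M borel (W i) = P"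
begin

sublocale M: prob_space M by (rule prob_M)

lemma W_meas[measurable]: "W i \<in> measurable M borel"
  using W_indep unfolding M.indep_vars_def by simp

lemma W_measP[measurable]: "W i \<in> measurable M P"
  using W_meas by (subst measurable_cong_sets[OF refl sets_P])

lemma W_comp_meas: "f \<in> borel_measurable P \<Longrightarrow> (\<lambda>\<omega>. f (W i \<omega>)) \<in> borel_measurable M" for f :: "_ \<Rightarrow> real"
  using W_measP by (rule measurable_compose)

lemma W_integral: "f \<in> borel_measurable P \<Longrightarrow> (\<integral>\<omega>. f (W i \<omega>) \<partial>M) = (\<integral>w. f w \<partial>P)" for f :: "_ \<Rightarrow> real"
proof -
  assume f: "f \<in> borel_measurable P"
  have "(\<integral>w. f w \<partial>distr M borel (W i)) = (\<integral>\<omega>. f (W i \<omega>) \<partial>M)"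
    using f by (subst integral_distr) (auto simp: measurable_cong_sets[OF sets_P refl])
  then show ?thesis by (simp add: W_distr)
qed

lemma W_AE: "AE w in P. Q w \<Longrightarrow> AE \<omega> in M. Q (W i \<omega>)"
  using AE_distrD[OF W_meas[of i], where P=Q] unfolding W_distr .

definition Gn :: "nat \<Rightarrow> real^'p \<Rightarrow> 'm \<Rightarrow> 'a \<Rightarrow> real" where
  "Gn n u j \<omega> = (\<Sum>i<n. cen (u,j) (W i \<omega>)) / sqrt (real n)"

lemma Gn_meas[measurable]: "Gn n u j \<in> borel_measurable M"
  unfolding Gn_def[abs_def] using W_comp_meas[OF cen_meas] by measurable

text \<open>By independence the moment is an n-th power. The bounds give \<bar>s f\<bar> \<le> 1,
  where exp y \<le> 1 + y + y^2; the linear term has mean zero, and 1 + x \<le> exp x.\<close>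

lemma mgf_bound:
  assumes f[measurable]: "f \<in> borel_measurable P" and b: "\<And>w. \<bar>f w\<bar> \<le> 2" and z: "(\<integral>w. f w \<partial>P) = 0" and s: "\<bar>s\<bar> \<le> 1/2"
  shows "integrable M (\<lambda>\<omega>. exp (s * (\<Sum>i<n. f (W i \<omega>))))"
    "(\<integral>\<omega>. exp (s * (\<Sum>i<n. f (W i \<omega>))) \<partial>M) \<le> exp (real n * s\<^sup>2 * (\<integral>w. (f w)\<^sup>2 \<partial>P))"
proof -
  have fb[measurable]: "f \<in> borel_measurable borel" using f by (simp add: measurable_cong_sets[OF sets_P refl])
  have i: "M.indep_vars (\<lambda>_. borel) (\<lambda>i \<omega>. exp (s * f (W i \<omega>))) {..<n}"
    by (rule M.indep_vars_subset[OF M.indep_vars_compose2[OF W_indep, of "\<lambda>_ w. exp (s * f w)" "\<lambda>_. borel"]]) auto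
  have sf: "\<bar>s * f w\<bar> \<le> 1" for w using mult_mono[OF s b[of w]] by (simp add: abs_mult)
  have int1: "integrable P (\<lambda>w. exp (s * f w))"
    using sf by (intro P.integrable_const_bound[of _ "exp 1"]) (auto simp: abs_le_iff)
  have intM: "integrable M (\<lambda>\<omega>. exp (s * f (W i \<omega>)))" for i
    using sf W_comp_meas[of "\<lambda>w. exp (s * f w)"] by (intro M.integrable_const_bound[of _ "exp 1"]) (auto simp: abs_le_iff)
  have intf: "integrable P f" using b by (intro P.integrable_const_bound[of _ 2]) auto
  have intf2: "integrable P (\<lambda>w. (f w)\<^sup>2)"
  proof (rule P.integrable_const_bound[of _ 4])
    have "(f w)\<^sup>2 \<le> 4" for w using power_mono[OF b[of w], of 2] by simp
    then show "AE w in P. norm ((f w)\<^sup>2) \<le> 4" by simp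
  qed simp
  have e: "exp (s * (\<Sum>i<n. f (W i \<omega>))) = (\<Prod>i<n. exp (s * f (W i \<omega>)))" for \<omega>
    by (simp add: exp_sum[symmetric] sum_distrib_left)
  show "integrable M (\<lambda>\<omega>. exp (s * (\<Sum>i<n. f (W i \<omega>))))"
    unfolding e by (rule M.indep_vars_integrable[OF _ i]) (auto intro: intM)
  have "(\<integral>\<omega>. exp (s * (\<Sum>i<n. f (W i \<omega>))) \<partial>M) = (\<Prod>i<n. \<integral>\<omega>. exp (s * f (W i \<omega>)) \<partial>M)"
    unfolding e by (rule M.indep_vars_lebesgue_integral[OF _ i]) (auto intro: intM)
  also have "\<dots> = (\<integral>w. exp (s * f w) \<partial>P) ^ n"
    by (simp add: W_integral[of "\<lambda>w. exp (s * f w)"])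
  also have "\<dots> \<le> exp (s\<^sup>2 * (\<integral>w. (f w)\<^sup>2 \<partial>P)) ^ n"
  proof (rule power_mono)
    have "(\<integral>w. exp (s * f w) \<partial>P) \<le> (\<integral>w. 1 + s * f w + s\<^sup>2 * (f w)\<^sup>2 \<partial>P)"
    proof (rule integral_mono[OF int1])
      show "integrable P (\<lambda>w. 1 + s * f w + s\<^sup>2 * (f w)\<^sup>2)" using intf intf2 by simp
      show "exp (s * f w) \<le> 1 + s * f w + s\<^sup>2 * (f w)\<^sup>2" for w
        using exp_le_quadratic[OF sf[of w]] by (simp add: power_mult_distrib)
    qed
    also have "\<dots> = 1 + s\<^sup>2 * (\<integral>w. (f w)\<^sup>2 \<partial>P)" using intf intf2 z by (simp add: P.prob_space)
    also have "\<dots> \<le> exp (s\<^sup>2 * (\<integral>w. (f w)\<^sup>2 \<partial>P))" by (rule exp_ge_add_one_self)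
    finally show "(\<integral>w. exp (s * f w) \<partial>P) \<le> exp (s\<^sup>2 * (\<integral>w. (f w)\<^sup>2 \<partial>P))" .
  qed (auto intro!: integral_nonneg_AE)
  also have "\<dots> = exp (real n * s\<^sup>2 * (\<integral>w. (f w)\<^sup>2 \<partial>P))" by (simp add: exp_of_nat_mult[symmetric] mult.assoc)
  finally show "(\<integral>\<omega>. exp (s * (\<Sum>i<n. f (W i \<omega>))) \<partial>M) \<le> exp (real n * s\<^sup>2 * (\<integral>w. (f w)\<^sup>2 \<partial>P))" .
qed

text \<open>The rate for the sum is lam k / sqrt n, which is at most 1/2 exactly because 2^k \<le>
  n. The exponent is then lam^2 times the increment variance, at most CARD('p) / 4.\<close>

lemma Gn_incr_mgf:
  assumes n: "2^k \<le> n"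
  shows "incr_mgf M (Gn n) k"
  unfolding incr_mgf_def
proof (intro allI impI)
  fix j :: 'm and v w :: "real^'p" and s :: real assume nr: "near k v w" and s: "s \<in> {-1, 1}"
  let ?f = "\<lambda>x. cen (v,j) x - cen (w,j) x"
  have npos: "0 < n" using n by (metis gr0I le_zero_eq power_not_zero zero_neq_numeral)
  let ?s = "s * lam k / sqrt (real n)"
  have e: "s * lam k * (Gn n v j \<omega> - Gn n w j \<omega>) = ?s * (\<Sum>i<n. ?f (W i \<omega>))" for \<omega>
    by (simp add: Gn_def sum_subtractf diff_divide_distrib[symmetric])
  have nr2: "(2::real)^k \<le> real n" using n by (metis of_nat_le_iff of_nat_numeral of_nat_power)
  have "sqrt 2 ^ k \<le> sqrt (real n)" using nr2 by (simp add: real_sqrt_power[symmetric])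
  then have s1: "\<bar>?s\<bar> \<le> 1/2" using s npos by (auto simp: lam_def abs_mult divide_simps)
  have b: "\<bar>?f x\<bar> \<le> 2" for x using cen_bound[of "(v,j)" x] cen_bound[of "(w,j)" x] by linarith
  have z: "(\<integral>x. ?f x \<partial>P) = 0" by (simp add: cen_integrable cen_mean)
  note mg = mgf_bound[of ?f ?s n, OF _ b z s1]
  have "real n * ?s\<^sup>2 * (\<integral>x. (?f x)\<^sup>2 \<partial>P) = (lam k)\<^sup>2 * (\<integral>x. (?f x)\<^sup>2 \<partial>P)"
    using s npos by (auto simp: power_divide power_mult_distrib)
  also have "\<dots> \<le> (lam k)\<^sup>2 * (real CARD('p) / 2^k)"
    using order_trans[OF cen_incr near_l1[OF nr]] by (intro mult_left_mono) auto
  also have "\<dots> \<le> real CARD('p)" by (simp add: lam_sq)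
  finally have le: "real n * ?s\<^sup>2 * (\<integral>x. (?f x)\<^sup>2 \<partial>P) \<le> real CARD('p)" .
  show "integrable M (\<lambda>\<omega>. exp (s * lam k * (Gn n v j \<omega> - Gn n w j \<omega>))) \<and>
     (\<integral>\<omega>. exp (s * lam k * (Gn n v j \<omega> - Gn n w j \<omega>)) \<partial>M) \<le> exp (real CARD('p))"
    unfolding e using mg le by (auto intro: order_trans)
qed

lemma Gn_tail:
  assumes n: "0 < n"
  shows "M.prob {\<omega>\<in>space M. \<bar>Gn n u j \<omega>\<bar> > x} \<le> 2 * exp (1 - x / 2)"
proof -
  have *: "integrable M (\<lambda>\<omega>. exp (1/2 * (s * Gn n u j \<omega>)))" "(\<integral>\<omega>. exp (1/2 * (s * Gn n u j \<omega>)) \<partial>M) \<le> exp 1"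
    if s: "s \<in> {-1,1}" for s
  proof -
    let ?s = "s / (2 * sqrt (real n))"
    have e: "1/2 * (s * Gn n u j \<omega>) = ?s * (\<Sum>i<n. cen (u,j) (W i \<omega>))" for \<omega> by (simp add: Gn_def)
    have "sqrt (real n) \<ge> 1" using n by simp
    then have s1: "\<bar>?s\<bar> \<le> 1/2" using s by (auto simp: divide_simps)
    have b: "\<bar>cen (u,j) w\<bar> \<le> 2" for w using cen_bound[of "(u,j)" w] by linarith
    note mg = mgf_bound[of "cen (u,j)" ?s n, OF _ b cen_mean s1]
    have "(\<integral>w. (cen (u,j) w)\<^sup>2 \<partial>P) \<le> (\<integral>w. 1 \<partial>P)"
      using cen_mult_integrable[of "(u,j)" "(u,j)"] cen_bound
      by (intro integral_mono) (auto simp: power2_eq_square[symmetric] abs_square_le_1)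
    then have "real n * ?s\<^sup>2 * (\<integral>w. (cen (u,j) w)\<^sup>2 \<partial>P) \<le> 1" 
      using s n by (auto simp: power_divide power_mult_distrib P.prob_space)
    then have le: "exp (real n * ?s\<^sup>2 * (\<integral>w. (cen (u,j) w)\<^sup>2 \<partial>P)) \<le> exp 1" by simp
    show "integrable M (\<lambda>\<omega>. exp (1/2 * (s * Gn n u j \<omega>)))" "(\<integral>\<omega>. exp (1/2 * (s * Gn n u j \<omega>)) \<partial>M) \<le> exp 1"
      unfolding e using mg(1) order_trans[OF mg(2) le] by auto
  qed
  have "M.prob {\<omega>\<in>space M. \<bar>Gn n u j \<omega>\<bar> > x} \<le> M.prob ({\<omega>\<in>space M. 1 * Gn n u j \<omega> > x} \<union> {\<omega>\<in>space M. -1 * Gn n u j \<omega> > x})"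
    by (intro M.finite_measure_mono) auto
  also have "\<dots> \<le> M.prob {\<omega>\<in>space M. 1 * Gn n u j \<omega> > x} + M.prob {\<omega>\<in>space M. -1 * Gn n u j \<omega> > x}"
    by (intro measure_Un_le) auto
  also have "\<dots> \<le> exp (1 - 1/2 * x) + exp (1 - 1/2 * x)"
    using *[of 1] *[of "-1"] by (intro add_mono M.exp_tail) auto
  finally show ?thesis by simp
qed

text \<open>Below the scale 1/n chaining is replaced by monotonicity of the empirical and the true distribution
  function.\<close>
lemma Gn_bracket:
  assumes K: "2^K \<le> n" "n < 2^Suc K" and t: "tame (\<lambda>u. Gn n u j \<omega>) K" and u: "u \<in> unit_cube"
  shows "\<bar>Gn n u j \<omega> - Gn n (dy K u) j \<omega>\<bar> \<le> cx TYPE('p) K + 2 * real CARD('p) / sqrt (real n)"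
proof -
  define lo where "lo = dy K u"
  \<comment> \<open>The upper corner of the dyadic cell of u; truncation at 1 keeps it in the cube
    and on the grid.\<close>
  define up where "up = (\<chi> i. min 1 (lo $ i + 1 / 2^K))"
  have lo: "lo \<in> grid K" unfolding lo_def by (rule dy_grid[OF u])
  have upg: "up \<in> grid K"
  proof -
    have "2^K * up $ i \<in> \<int>" for i
    proof (cases "lo $ i + 1 / 2^K \<le> 1")
      case True
      then have "2^K * up $ i = 2^K * lo $ i + 1" by (simp add: up_def distrib_left)
      then show ?thesis using lo by (simp add: grid_def)
    next
      case False
      then have "2^K * up $ i = 2^K" by (simp add: up_def)
      then show ?thesis by simp
    qed
    moreover have "0 \<le> up $ i" "up $ i \<le> 1" for i using lo by (auto simp: up_def grid_def unit_cube_def)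
    ultimately show ?thesis by (simp add: grid_def unit_cube_def)
  qed
  have lou: "lo $ i \<le> u $ i" for i using dy_bounds(1)[of u i K] by (simp add: lo_def)
  have uup: "u $ i \<le> up $ i" for i using dy_bounds(2)[of u i K] u by (auto simp: lo_def up_def unit_cube_def)
  have d: "0 \<le> up $ i - lo $ i" "up $ i - lo $ i \<le> 1 / 2^K" for i
    using lou[of i] uup[of i] by (auto simp: up_def)
  have nr: "near K up lo" using lo upg d by (auto simp: near_def abs_le_iff)
  have npos: "0 < n" using K by (metis gr0I le_zero_eq power_not_zero zero_neq_numeral)
  have tm: "\<bar>Gn n up j \<omega> - Gn n lo j \<omega>\<bar> \<le> cx TYPE('p) K" using t nr by (auto simp: tame_def)
  let ?D = "\<lambda>u. measure P (Hs u j)"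
  define N where "N u = (\<Sum>i<n. indicator (Hs u j) (W i \<omega>) :: real)" for u
  have G: "Gn n u j \<omega> = (N u - real n * ?D u) / sqrt (real n)" for u
    by (simp add: Gn_def cen_def Hx_def sum_subtractf N_def)
  have mono: "Hs a j \<subseteq> Hs b j" if "\<And>i. a $ i \<le> b $ i" for a b using that by (auto simp: Hs_def intro: order_trans)
  have "N a \<le> N b" if "\<And>i. a $ i \<le> b $ i" for a b
    unfolding N_def using mono[OF that] by (intro sum_mono) (auto simp: indicator_def)
  then have Nm: "N lo \<le> N u" "N u \<le> N up" using lou uup by auto
  have Dm: "?D lo \<le> ?D u" "?D u \<le> ?D up"
    using mono[OF lou] mono[OF uup] by (auto intro!: P.finite_measure_mono)
  \<comment> \<open>The drift over one cell is of order 1 / n by n < 2^Suc K, so after scaling by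
    sqrt n it is of order 1 / sqrt n.\<close>
  have "?D up - ?D lo \<le> real CARD('p) / 2^K" using D_lipschitz1[of up j lo] near_l1[OF nr] by linarith
  also have "\<dots> \<le> 2 * real CARD('p) / real n"
  proof -
    have "real n \<le> 2 * 2^K" using K(2) by (metis less_imp_le of_nat_le_iff of_nat_numeral of_nat_power power_Suc)
    then have "real n * real CARD('p) \<le> 2 * 2^K * real CARD('p)" by (rule mult_right_mono) simp
    then show ?thesis using npos by (simp add: divide_simps mult_ac)
  qed
  finally have "real n * (?D up - ?D lo) \<le> 2 * real CARD('p)" using npos by (simp add: field_simps)
  then have q: "real n * (?D up - ?D lo) / sqrt (real n) \<le> 2 * real CARD('p) / sqrt (real n)" by (rule divide_right_mono) simp
  have "Gn n u j \<omega> - Gn n lo j \<omega> = (N u - N lo - real n * (?D u - ?D lo)) / sqrt (real n)"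
    by (simp add: G diff_divide_distrib right_diff_distrib)
  moreover have "(N u - N lo - real n * (?D u - ?D lo)) / sqrt (real n) \<le> (N up - N lo) / sqrt (real n)"
  proof (rule divide_right_mono)
    have "0 \<le> real n * (?D u - ?D lo)" using Dm by simp
    then show "N u - N lo - real n * (?D u - ?D lo) \<le> N up - N lo" using Nm by linarith
  qed simp
  moreover have "(N up - N lo) / sqrt (real n) = Gn n up j \<omega> - Gn n lo j \<omega> + real n * (?D up - ?D lo) / sqrt (real n)"
    by (simp add: G diff_divide_distrib right_diff_distrib)
  moreover have "(N u - N lo - real n * (?D u - ?D lo)) / sqrt (real n) \<ge> - (real n * (?D up - ?D lo) / sqrt (real n))"
    unfolding minus_divide_left
  proof (rule divide_right_mono)
    have "real n * (?D u - ?D lo) \<le> real n * (?D up - ?D lo)" using Dm by (intro mult_left_mono) auto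
    then show "- (real n * (?D up - ?D lo)) \<le> N u - N lo - real n * (?D u - ?D lo)" using Nm by (simp add: algebra_simps)
  qed simp
  ultimately have "Gn n u j \<omega> - Gn n lo j \<omega> \<le> cx TYPE('p) K + 2 * real CARD('p) / sqrt (real n)"
    "- (cx TYPE('p) K + 2 * real CARD('p) / sqrt (real n)) \<le> Gn n u j \<omega> - Gn n lo j \<omega>"
    using q tm cx_nonneg[of K, where 'p='p] by linarith+
  then show ?thesis unfolding lo_def[symmetric] by (simp add: abs_le_iff)
qed

lemma Gn_modulus:
  assumes K: "2^K \<le> n" "n < 2^Suc K" "k0 \<le> K" and t: "\<And>k. k0 \<le> k \<Longrightarrow> k \<le> K \<Longrightarrow> tame (\<lambda>u. Gn n u j \<omega>) k"
    and u: "u \<in> unit_cube" "v \<in> unit_cube" and d: "\<And>i. \<bar>u$i - v$i\<bar> \<le> 1 / 2^k0"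
  shows "\<bar>Gn n u j \<omega> - Gn n v j \<omega>\<bar> \<le> 5 * ceps TYPE('p) k0 + 4 * real CARD('p) / sqrt (real n)"
proof -
  have 3: "\<bar>Gn n (dy K u) j \<omega> - Gn n (dy K v) j \<omega>\<bar> \<le> 3 * ceps TYPE('p) k0"
    using tame_modulus[of k0 K "\<lambda>u. Gn n u j \<omega>" u v] t K u d by auto
  have *: "\<bar>Gn n x j \<omega> - Gn n (dy K x) j \<omega>\<bar> \<le> ceps TYPE('p) k0 + 2 * real CARD('p) / sqrt (real n)" if "x \<in> unit_cube" for x
    using Gn_bracket[OF K(1,2) t[OF K(3) order_refl] that] cx_le_ceps[OF K(3), where 'p='p] by linarith
  have "4 * real CARD('p) / sqrt (real n) = 2 * (2 * real CARD('p) / sqrt (real n))" by simp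
  then show ?thesis using 3 *[OF u(1)] *[OF u(2)] by linarith
qed

lemma Gn_sup:
  assumes K: "2^K \<le> n" "n < 2^Suc K" "k0 \<le> K" and t: "\<And>k. k0 \<le> k \<Longrightarrow> k \<le> K \<Longrightarrow> tame (\<lambda>u. Gn n u j \<omega>) k"
    and u: "u \<in> unit_cube" and b: "\<And>v. v \<in> grid k0 \<Longrightarrow> \<bar>Gn n v j \<omega>\<bar> \<le> x"
  shows "\<bar>Gn n u j \<omega>\<bar> \<le> x + 2 * ceps TYPE('p) k0 + 2 * real CARD('p) / sqrt (real n)"
proof -
  have "\<bar>Gn n (dy K u) j \<omega> - Gn n (dy k0 u) j \<omega>\<bar> \<le> ceps TYPE('p) k0"
    using tame_chain[of k0 "K - k0" "\<lambda>u. Gn n u j \<omega>" u] t K u by auto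
  moreover have "\<bar>Gn n u j \<omega> - Gn n (dy K u) j \<omega>\<bar> \<le> ceps TYPE('p) k0 + 2 * real CARD('p) / sqrt (real n)"
    using Gn_bracket[OF K(1,2) t[OF K(3) order_refl] u] cx_le_ceps[OF K(3), where 'p='p] by linarith
  moreover have "\<bar>Gn n (dy k0 u) j \<omega>\<bar> \<le> x" by (rule b[OF dy_grid[OF u]])
  ultimately show ?thesis by linarith
qed

end

context emp_sample
begin

text \<open>The order of the quantifiers matters: the bound K is fixed by \<eta> before \<epsilon>
  is chosen, because the tolerance \<epsilon> demanded by the expansion of the copula depends on
  K.\<close>

lemma Gn_good_event:
  assumes eta: "\<eta> > 0"
  obtains K where "K > 0" "\<And>\<epsilon>. \<epsilon> > 0 \<Longrightarrow> \<exists>\<delta>>0. \<exists>n0. \<forall>n\<ge>n0. \<exists>E\<in>sets M. M.prob E \<le> \<eta> \<and>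
    (\<forall>\<omega>\<in>space M - E. (\<forall>j. \<forall>u\<in>unit_cube. \<bar>Gn n u j \<omega>\<bar> \<le> K) \<and>
      (\<forall>j. \<forall>u\<in>unit_cube. \<forall>v\<in>unit_cube. (\<forall>i. \<bar>u$i - v$i\<bar> \<le> \<delta>) \<longrightarrow> \<bar>Gn n u j \<omega> - Gn n v j \<omega>\<bar> \<le> \<epsilon>))"
proof -
  let ?p = "real CARD('p)"
  define c where "c = 2 * real CARD('m) * exp ?p"
  have c0: "0 \<le> c" by (simp add: c_def)
  have "\<forall>\<^sub>F k in sequentially. ceta c k < \<eta>/2 \<and> ceps TYPE('p) k < 1"
    using eta by (intro eventually_conj order_tendstoD(2)[OF ceta_tendsto] order_tendstoD(2)[OF ceps_tendsto]) auto
  then obtain k1 where k1: "ceta c k1 < \<eta>/2" "ceps TYPE('p) k1 < 1" by (auto simp: eventually_sequentially)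
  let ?I = "(grid k1 :: (real^'p) set) \<times> (UNIV :: 'm set)"
  have finI: "finite ?I" by (intro finite_cartesian_product finite_grid finite)
  define N where "N = real (card ?I)"
  have N0: "0 \<le> N" by (simp add: N_def)
  \<comment> \<open>Solves exp (1 - x / 2) = \<eta> / (4 (N + 1)), so the union bound over the N
    grid values costs at most \<eta> / 2.\<close>
  define x where "x = 2 * (1 - ln (\<eta> / (4 * (N + 1))))"
  have ex: "N * (2 * exp (1 - x / 2)) \<le> \<eta>/2"
  proof -
    have "x / 2 = 1 - ln (\<eta> / (4 * (N + 1)))" unfolding x_def by (rule nonzero_mult_div_cancel_left) simp
    then have "1 - x / 2 = 1 - (1 - ln (\<eta> / (4 * (N + 1))))" by (simp only:)
    also have "\<dots> = ln (\<eta> / (4 * (N + 1)))" by simp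
    finally have "1 - x / 2 = ln (\<eta> / (4 * (N + 1)))" .
    then have "exp (1 - x / 2) = \<eta> / (4 * (N + 1))" using eta N0 by (simp only:) (rule exp_ln, simp)
    then have "N * (2 * exp (1 - x / 2)) = (2 * N * \<eta>) / (4 * (N + 1))" by (simp only:) simp
    also have "\<dots> \<le> \<eta>/2" using eta N0 by (subst pos_divide_le_eq) (auto simp: algebra_simps)
    finally show ?thesis .
  qed
  \<comment> \<open>The value at level k1 is at most x, the chaining adds at most 2 because
    \<open>ceps\<close> is below 1 there, and the bracketing adds at most 2 CARD('p) because sqrt n
    \<ge> 1.\<close>
  define K where "K = \<bar>x\<bar> + 2 + 2 * ?p"
  have "\<exists>\<delta>>0. \<exists>n0. \<forall>n\<ge>n0. \<exists>E\<in>sets M. M.prob E \<le> \<eta> \<and>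
    (\<forall>\<omega>\<in>space M - E. (\<forall>j. \<forall>u\<in>unit_cube. \<bar>Gn n u j \<omega>\<bar> \<le> K) \<and>
      (\<forall>j. \<forall>u\<in>unit_cube. \<forall>v\<in>unit_cube. (\<forall>i. \<bar>u$i - v$i\<bar> \<le> \<delta>) \<longrightarrow> \<bar>Gn n u j \<omega> - Gn n v j \<omega>\<bar> \<le> \<epsilon>))"
    if eps: "\<epsilon> > 0" for \<epsilon>
  proof -
    have "\<forall>\<^sub>F k in sequentially. ceps TYPE('p) k < \<epsilon>/10 \<and> k1 \<le> k"
      using eps by (intro eventually_conj order_tendstoD(2)[OF ceps_tendsto] eventually_ge_at_top) auto
    then obtain k0 where k0: "ceps TYPE('p) k0 < \<epsilon>/10" "k1 \<le> k0" by (auto simp: eventually_sequentially)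
    have "(\<lambda>n. 4 * ?p / sqrt (real n)) \<longlonglongrightarrow> 0"
      by (intro tendsto_divide_0[OF tendsto_const] filterlim_at_top_imp_at_infinity filterlim_compose[OF sqrt_at_top filterlim_real_sequentially])
    then have "\<forall>\<^sub>F n in sequentially. 4 * ?p / sqrt (real n) < \<epsilon>/2" using eps by (intro order_tendstoD) auto
    then obtain n1 where n1: "\<And>n. n \<ge> n1 \<Longrightarrow> 4 * ?p / sqrt (real n) < \<epsilon>/2" by (auto simp: eventually_sequentially)
    have main: "\<exists>E\<in>sets M. M.prob E \<le> \<eta> \<and>
      (\<forall>\<omega>\<in>space M - E. (\<forall>j. \<forall>u\<in>unit_cube. \<bar>Gn n u j \<omega>\<bar> \<le> K) \<and>
      (\<forall>j. \<forall>u\<in>unit_cube. \<forall>v\<in>unit_cube. (\<forall>i. \<bar>u$i - v$i\<bar> \<le> 1 / 2^k0) \<longrightarrow> \<bar>Gn n u j \<omega> - Gn n v j \<omega>\<bar> \<le> \<epsilon>))"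
      if n: "n \<ge> max n1 (2^k0)" for n
    proof -
      have nn: "1 \<le> n" using n by (meson max.boundedE one_le_numeral one_le_power order_trans)
      \<comment> \<open>L is the finest level the moment bound reaches for this n: chaining uses the
        levels from k1 to L and bracketing takes over below.\<close>
      obtain L where L: "2^L \<le> n" "n < 2^Suc L" using ex_power_ivl1[of 2 n] nn by auto
      have "(2::nat)^k0 < 2^Suc L" using n L by linarith
      then have kL: "k0 \<le> L" using power_less_imp_less_exp[of "2::nat" k0 "Suc L"] by simp
      let ?B = "\<Union>k\<in>{k1..<Suc L}. bad M (Gn n) k"
      let ?T = "\<lambda>s. {\<omega>\<in>space M. \<bar>Gn n (fst s) (snd s) \<omega>\<bar> > x}"
      have mg: "incr_mgf M (Gn n) k" if "k \<in> {k1..<Suc L}" for k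
      proof (rule Gn_incr_mgf)
        have "(2::nat)^k \<le> 2^L" using that by (intro power_increasing) auto
        then show "2^k \<le> n" using L by linarith
      qed
      have bs: "bad M (Gn n) k \<in> sets M" "M.prob (bad M (Gn n) k) \<le> c * exp (- real (Suc k))" if "k \<in> {k1..<Suc L}" for k
        using M.bad_prob[OF mg[OF that]] by (auto simp: c_def)
      have B: "?B \<in> sets M" using bs(1) by (intro sets.finite_UN) auto
      have "M.prob ?B \<le> (\<Sum>k=k1..<Suc L. M.prob (bad M (Gn n) k))" using bs by (intro measure_UNION_le) auto
      also have "\<dots> \<le> (\<Sum>k=k1..<Suc L. c * exp (- real (Suc k)))" by (intro sum_mono bs)
      also have "\<dots> \<le> ceta c k1" by (rule sum_le_ceta[OF c0])
      finally have PB: "M.prob ?B \<le> \<eta>/2" using k1 by linarith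
      have T: "(\<Union>s\<in>?I. ?T s) \<in> sets M" using finI by (intro sets.finite_UN) auto
      have "M.prob (\<Union>s\<in>?I. ?T s) \<le> (\<Sum>s\<in>?I. M.prob (?T s))" using finI by (intro measure_UNION_le) auto
      also have "\<dots> \<le> (\<Sum>s\<in>?I. 2 * exp (1 - x / 2))" using nn by (intro sum_mono Gn_tail) auto
      also have "\<dots> \<le> \<eta>/2" using ex by (simp add: N_def)
      finally have PT: "M.prob (\<Union>s\<in>?I. ?T s) \<le> \<eta>/2" .
      have PU: "M.prob (?B \<union> (\<Union>s\<in>?I. ?T s)) \<le> \<eta>" using measure_Un_le[OF B T] PB PT by linarith
      have good: "(\<forall>j. \<forall>u\<in>unit_cube. \<bar>Gn n u j \<omega>\<bar> \<le> K) \<and>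
        (\<forall>j. \<forall>u\<in>unit_cube. \<forall>v\<in>unit_cube. (\<forall>i. \<bar>u$i - v$i\<bar> \<le> 1 / 2^k0) \<longrightarrow> \<bar>Gn n u j \<omega> - Gn n v j \<omega>\<bar> \<le> \<epsilon>)"
        if w: "\<omega> \<in> space M - (?B \<union> (\<Union>s\<in>?I. ?T s))" for \<omega>
      proof -
        have tm: "tame (\<lambda>u. Gn n u j \<omega>) k" if "k1 \<le> k" "k \<le> L" for k j
          using w that by (auto simp: bad_def)
        have gb: "\<bar>Gn n v j \<omega>\<bar> \<le> x" if "v \<in> grid k1" for v j
          using w that by (auto simp: not_less)
        have s1: "2 * ?p / sqrt (real n) \<le> 2 * ?p" using nn by (intro divide_le_eq[THEN iffD2]) (auto simp: mult_le_cancel_left1)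
        have "\<bar>Gn n u j \<omega>\<bar> \<le> K" if "u \<in> unit_cube" for u j
        proof -
          have "\<bar>Gn n u j \<omega>\<bar> \<le> x + 2 * ceps TYPE('p) k1 + 2 * ?p / sqrt (real n)"
            by (rule Gn_sup[OF L order_trans[OF k0(2) kL] _ that]) (auto intro: tm gb)
          then show ?thesis using k1(2) s1 unfolding K_def by linarith
        qed
        moreover have "\<bar>Gn n u j \<omega> - Gn n v j \<omega>\<bar> \<le> \<epsilon>" if "u \<in> unit_cube" "v \<in> unit_cube" "\<And>i. \<bar>u$i - v$i\<bar> \<le> 1 / 2^k0" for u v j
        proof -
          have "\<bar>Gn n u j \<omega> - Gn n v j \<omega>\<bar> \<le> 5 * ceps TYPE('p) k0 + 4 * ?p / sqrt (real n)"
            by (rule Gn_modulus[OF L kL _ that]) (use tm k0(2) in auto)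
          moreover have "4 * ?p / sqrt (real n) < \<epsilon>/2" using n by (intro n1) simp
          ultimately show ?thesis using k0(1) by linarith
        qed
        ultimately show ?thesis by blast
      qed
      show ?thesis by (rule bexI[where x="?B \<union> (\<Union>s\<in>?I. ?T s)"], rule conjI[OF PU], rule ballI, erule good, rule sets.Un[OF B T])
    qed
    show ?thesis
      by (intro exI[of _ "1 / 2^k0"] conjI exI[of _ "max n1 (2^k0)"] allI impI main) auto
  qed
  moreover have "K > 0" by (simp add: K_def add_pos_nonneg)
  ultimately show ?thesis by (intro that[of K]) blast+
qed

text \<open>A combination of values of G_n is a normalised sum of i.i.d. copies of one bounded
  centred variable Y, with the quadratic form of \<open>Gam\<close> as its variance; the
  one-dimensional central limit theorem applies to it.\<close>

lemma Gn_comb_char: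
  fixes t :: "nat \<Rightarrow> real" and s :: "nat \<Rightarrow> (real^'p) \<times> 'm"
  shows "(\<lambda>n. char (distr M borel (\<lambda>\<omega>. \<Sum>i<d. t i * Gn n (fst (s i)) (snd (s i)) \<omega>)) 1)
    \<longlonglongrightarrow> exp (- complex_of_real ((\<Sum>i<d. \<Sum>i'<d. t i * t i' * Gam P A (s i) (s i')) / 2))"
proof -
  define Y where "Y w = (\<Sum>i<d. t i * cen (s i) w)" for w
  define v where "v = (\<integral>w. (Y w)\<^sup>2 \<partial>P)"
  have v: "(\<Sum>i<d. \<Sum>i'<d. t i * t i' * Gam P A (s i) (s i')) = v" unfolding v_def Y_def by (rule Gam_quad)
  have Ym[measurable]: "Y \<in> borel_measurable P" unfolding Y_def[abs_def] by measurable
  have Yb[measurable]: "Y \<in> borel_measurable borel" using Ym by (simp add: measurable_cong_sets[OF sets_P refl])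
  have Yi: "integrable P Y" unfolding Y_def[abs_def] by (intro Bochner_Integration.integrable_sum integrable_mult_right cen_integrable)
  have Y0: "(\<integral>w. Y w \<partial>P) = 0" unfolding Y_def by (subst Bochner_Integration.integral_sum) (auto simp: cen_integrable cen_mean)
  have Y2: "integrable P (\<lambda>w. (Y w)\<^sup>2)"
  proof -
    have "(Y w)\<^sup>2 = (\<Sum>i<d. \<Sum>i'<d. t i * t i' * (cen (s i) w * cen (s i') w))" for w
      by (simp add: Y_def power2_eq_square sum_product mult_ac)
    then show ?thesis by (simp add: cen_mult_integrable)
  qed
  have S: "(\<Sum>i<d. t i * Gn n (fst (s i)) (snd (s i)) \<omega>) = (\<Sum>l<n. Y (W l \<omega>)) / sqrt (real n)" for n \<omega>
  proof -
    have "(\<Sum>l<n. Y (W l \<omega>)) = (\<Sum>i<d. \<Sum>l<n. t i * cen (s i) (W l \<omega>))" unfolding Y_def by (rule sum.swap)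
    then show ?thesis by (simp add: Gn_def sum_distrib_left sum_divide_distrib)
  qed
  have v0: "v \<ge> 0" unfolding v_def by simp
  have "(\<lambda>n. char (distr M borel (\<lambda>\<omega>. (\<Sum>l<n. Y (W l \<omega>)) / sqrt (real n))) 1) \<longlonglongrightarrow> exp (- complex_of_real (v / 2))"
  proof (cases "v = 0")
    case True
    \<comment> \<open>The degenerate case is separate, since the central limit theorem divides by
      the standard deviation: here all summands vanish almost surely.\<close>
    then have "AE w in P. (Y w)\<^sup>2 = 0" using integral_nonneg_eq_0_iff_AE[OF Y2] by (simp add: v_def)
    then have "AE w in P. Y w = 0" by simp
    from W_AE[OF this] have AE1: "AE \<omega> in M. \<forall>l\<in>UNIV. Y (W l \<omega>) = 0" by (subst AE_ball_countable) auto
    have "char (distr M borel (\<lambda>\<omega>. (\<Sum>l<n. Y (W l \<omega>)) / sqrt (real n))) 1 = 1" for n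
    proof -
      have "distr M borel (\<lambda>\<omega>. (\<Sum>l<n. Y (W l \<omega>)) / sqrt (real n)) = distr M borel (\<lambda>\<omega>. 0 :: real)"
        using AE1 by (intro distr_cong_AE) (auto intro!: AE_mp[OF AE1 AE_I2])
      moreover have "char (distr M borel (\<lambda>\<omega>. 0 :: real)) 1 = 1"
        unfolding char_def by (subst integral_distr) (auto simp: M.prob_space)
      ultimately show ?thesis by (simp only:)
    qed
    then show ?thesis using True by simp
  next
    case False
    then have vp: "v > 0" using v0 by simp
    define \<sigma> where "\<sigma> = sqrt v"
    have sp: "\<sigma> > 0" "\<sigma>\<^sup>2 = v" using vp by (auto simp: \<sigma>_def)
    have "weak_conv_m (\<lambda>n. distr M borel (\<lambda>\<omega>. (\<Sum>l<n. Y (W l \<omega>)) / sqrt (real n * \<sigma>\<^sup>2))) std_normal_distribution"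
    proof (rule M.central_limit_theorem_zero_mean[where \<mu>="distr P borel Y"])
      show "M.indep_vars (\<lambda>i. borel) (\<lambda>l \<omega>. Y (W l \<omega>)) UNIV"
        by (rule M.indep_vars_compose2[OF W_indep]) auto
      show e0: "M.expectation (\<lambda>\<omega>. Y (W l \<omega>)) = 0" for l by (simp add: W_integral Y0)
      show "0 < \<sigma>" by fact
      show i2: "integrable M (\<lambda>\<omega>. (Y (W l \<omega>))\<^sup>2)" for l
      proof -
        have "integrable (distr M borel (W l)) (\<lambda>w. (Y w)\<^sup>2)" unfolding W_distr by (rule Y2)
        then show ?thesis by (subst (asm) integrable_distr_eq) auto
      qed
      show "M.variance (\<lambda>\<omega>. Y (W l \<omega>)) = \<sigma>\<^sup>2" for l
        by (simp add: e0 sp W_integral[of "\<lambda>w. (Y w)\<^sup>2"] v_def)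
      show "distr M borel (\<lambda>\<omega>. Y (W l \<omega>)) = distr P borel Y" for l
      proof -
        have "distr (distr M borel (W l)) borel Y = distr M borel (Y \<circ> W l)" by (rule distr_distr) auto
        then show ?thesis by (simp add: W_distr comp_def)
      qed
    qed
    \<comment> \<open>Frequency \<sigma> for the standardised sum is frequency 1 for the sum scaled
      by sqrt n alone.\<close>
    then have "(\<lambda>n. char (distr M borel (\<lambda>\<omega>. (\<Sum>l<n. Y (W l \<omega>)) / sqrt (real n * \<sigma>\<^sup>2))) \<sigma>) \<longlonglongrightarrow> char std_normal_distribution \<sigma>"
      using W_comp_meas[OF Ym]
      by (intro levy_continuity1 M.real_distribution_distr real_dist_normal_dist) auto
    moreover have "char (distr M borel (\<lambda>\<omega>. (\<Sum>l<n. Y (W l \<omega>)) / sqrt (real n * \<sigma>\<^sup>2))) \<sigma> = char (distr M borel (\<lambda>\<omega>. (\<Sum>l<n. Y (W l \<omega>)) / sqrt (real n))) 1" for n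
    proof -
      have "\<sigma> * (x / sqrt (real n * \<sigma>\<^sup>2)) = x / sqrt (real n)" for x
        using sp(1) by (simp add: real_sqrt_mult)
      then show ?thesis using W_comp_meas[OF Ym] unfolding char_def by (subst (1 2) integral_distr) auto
    qed
    moreover have "char std_normal_distribution \<sigma> = exp (- complex_of_real (v / 2))"
    proof -
      have "(complex_of_real \<sigma>)\<^sup>2 = complex_of_real v" unfolding of_real_power[symmetric] sp ..
      then show ?thesis by (simp add: char_std_normal_distribution exp_of_real[symmetric])
    qed
    ultimately show ?thesis by simp
  qed
  then show ?thesis unfolding S v .
qed

end

section \<open>Expansion of the empirical copula\<close>

lemma sum_if_card: "(\<Sum>i<n. if Q i then 1 else 0 :: real) = real (card {i. i < n \<and> Q i})" for n :: nat
proof -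
  have "(\<Sum>i<n. if Q i then 1 else 0 :: real) = (\<Sum>i\<in>{i. i < n \<and> Q i}. 1)"
    by (rule sum.mono_neutral_cong_right) auto
  then show ?thesis by simp
qed

text \<open>Replaces the empirical quantile q by v = \<Phi> q. Since no observation lies in a flat
  piece of \<Phi>, x_i \<le> q is equivalent to \<Phi> (x_i) \<le> v, so events in terms of X become
  events in terms of the transformed variables. The last two conclusions say that the count reaches
  u N at v and not before.\<close>

lemma ginv_step:
  fixes x :: "nat \<Rightarrow> real" and \<Phi> :: "real \<Rightarrow> real"
  assumes I: "finite I" "I \<noteq> {}" and mono: "\<And>s t. s \<le> t \<Longrightarrow> \<Phi> s \<le> \<Phi> t" and b: "\<And>t. 0 \<le> \<Phi> t" "\<And>t. \<Phi> t \<le> 1"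
    and g: "\<And>i. i \<in> I \<Longrightarrow> 0 < \<Phi> (x i)" "\<And>i t. i \<in> I \<Longrightarrow> t < x i \<Longrightarrow> \<Phi> t < \<Phi> (x i)"
    and N: "N = real (card I)" and Fe: "\<And>t. Fe t = real (card {i\<in>I. x i \<le> t}) / N" and u: "0 \<le> u" "u \<le> 1"
  shows "\<exists>v. 0 \<le> v \<and> v \<le> 1 \<and> (\<forall>i\<in>I. ereal (x i) \<le> ginv Fe u \<longleftrightarrow> \<Phi> (x i) \<le> v) \<and>
    u * N \<le> real (card {i\<in>I. \<Phi> (x i) \<le> v}) \<and> (\<forall>v'<v. real (card {i\<in>I. \<Phi> (x i) \<le> v'}) \<le> u * N)"
proof (cases "u = 0")
  case True
  \<comment> \<open>For u = 0 the generalized inverse is -\<infinity> and selects no observation; v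
    = 0 does the same, as \<Phi> is positive at the observations.\<close>
  have "Inf {ereal t |t. u \<le> Fe t} \<le> ereal r" for r
    by (rule Inf_lower) (auto simp: True Fe N)
  then have q: "ginv Fe u \<le> ereal r" for r by (simp add: ginv_def)
  have gi: "ginv Fe u = -\<infinity>" by (rule ereal_bot) (rule q)
  have e: "{i\<in>I. \<Phi> (x i) \<le> v'} = {}" if "v' < 0" for v'
  proof -
    have "\<not> \<Phi> (x i) \<le> v'" for i using b(1)[of "x i"] that by auto
    then show ?thesis by blast
  qed
  have "real (card {i\<in>I. \<Phi> (x i) \<le> v'}) \<le> u * N" if "v' < 0" for v' unfolding e[OF that] True by simp
  moreover have "\<not> \<Phi> (x i) \<le> 0" if "i \<in> I" for i using g(1)[OF that] by simp
  ultimately show ?thesis using gi True by (intro exI[of _ 0]) simp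
next
  case False
  then have up: "0 < u" using u by simp
  have Np: "N > 0" using I N by (simp add: card_gt_0_iff)
  have Fm: "Fe s \<le> Fe t" if "s \<le> t" for s t
    unfolding Fe using that Np I by (intro divide_right_mono of_nat_mono card_mono) auto
  define J where "J = {i\<in>I. u \<le> Fe (x i)}"
  have Jne: "J \<noteq> {}"
  proof -
    have "Max (x ` I) \<in> x ` I" using I by (intro Max_in) auto
    then obtain i where i: "i \<in> I" "x i = Max (x ` I)" by auto
    then have "{i'\<in>I. x i' \<le> x i} = I" using I by auto
    then have "Fe (x i) = 1" using Np by (simp add: Fe N)
    then show ?thesis using i u by (auto simp: J_def)
  qed
  have Jf: "finite J" using I by (simp add: J_def)
  \<comment> \<open>The quantile is the smallest observation at which \<open>Fe\<close> reaches u;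
    as \<open>Fe\<close> jumps only at observations, {t. u \<le> Fe t} is the half-line from q
    on.\<close>
  define q where "q = Min (x ` J)"
  have "q \<in> x ` J" unfolding q_def using Jf Jne by (intro Min_in) auto
  then obtain i0 where i0: "i0 \<in> I" "u \<le> Fe q" "q = x i0" by (auto simp: J_def)
  have qle: "q \<le> x i" if "i \<in> J" for i unfolding q_def using that Jf by (intro Min_le) auto
  have S: "u \<le> Fe t \<longleftrightarrow> q \<le> t" for t
  proof
    assume "q \<le> t" then show "u \<le> Fe t" using Fm[of q t] i0 by simp
  next
    assume t: "u \<le> Fe t"
    let ?T = "{i\<in>I. x i \<le> t}"
    have "?T \<noteq> {}"
    proof
      assume "?T = {}"
      then have "Fe t = 0" by (simp only: Fe) simp
      then show False using t up by simp
    qed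
    then have "Max (x ` ?T) \<in> x ` ?T" using I by (intro Max_in) auto
    then obtain i1 where i1: "i1 \<in> I" "x i1 \<le> t" "x i1 = Max (x ` ?T)" by auto
    have "{i\<in>I. x i \<le> x i1} = ?T" using i1 I by (auto simp: i1(3) intro!: Max_ge)
    then have "Fe (x i1) = Fe t" by (simp only: Fe)
    then have "i1 \<in> J" using t i1 by (simp add: J_def)
    then show "q \<le> t" using qle i1 by fastforce
  qed
  have gi: "ginv Fe u = ereal q"
    unfolding ginv_def S by (rule antisym) (auto intro!: Inf_lower Inf_greatest)
  have iff: "x i \<le> q \<longleftrightarrow> \<Phi> (x i) \<le> \<Phi> q" if "i \<in> I" for i
    using mono g(2)[OF that, of q] by (meson not_le)
  have "u * N \<le> real (card {i\<in>I. \<Phi> (x i) \<le> \<Phi> q})"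
  proof -
    have "{i\<in>I. \<Phi> (x i) \<le> \<Phi> q} = {i\<in>I. x i \<le> q}" using iff by auto
    then show ?thesis using i0(2) Np by (simp add: Fe field_simps)
  qed
  moreover have "real (card {i\<in>I. \<Phi> (x i) \<le> v'}) \<le> u * N" if v': "v' < \<Phi> q" for v'
  proof (cases "{i\<in>I. \<Phi> (x i) \<le> v'} = {}")
    case True
    show ?thesis unfolding True using up Np by simp
  next
    case False
    let ?T = "{i\<in>I. \<Phi> (x i) \<le> v'}"
    have "Max (x ` ?T) \<in> x ` ?T" using I False by (intro Max_in) auto
    then obtain i1 where i1: "i1 \<in> I" "\<Phi> (x i1) \<le> v'" "x i1 = Max (x ` ?T)" by auto
    \<comment> \<open>The largest observation with \<Phi> \<le> v' lies strictly left of q, where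
      \<open>Fe\<close> is still below u.\<close>
    have "x i1 < q" using mono[of q "x i1"] i1 v' by (meson leD not_le order_le_less_trans)
    then have "Fe (x i1) < u" using S[of "x i1"] by (meson not_le)
    moreover have "card ?T \<le> card {i\<in>I. x i \<le> x i1}"
      using I by (intro card_mono) (auto simp: i1(3) intro!: Max_ge)
    ultimately show ?thesis using Np by (simp add: Fe field_simps)
  qed
  ultimately show ?thesis using b iff gi by (intro exI[of _ "\<Phi> q"]) auto
qed

context emp_sample
begin

abbreviation Xs where "Xs \<equiv> (\<lambda>i \<omega>. fst (W i \<omega>))"
abbreviation Zs where "Zs \<equiv> (\<lambda>i \<omega>. snd (W i \<omega>))"

text \<open>No observation lies in a flat piece of its conditional margin, so that X \<le> t iff F(X) \<le> F(t).\<close>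
definition good :: "'a \<Rightarrow> bool" where
  "good \<omega> \<longleftrightarrow> (\<forall>i j k. Zs i \<omega> \<in> A j \<longrightarrow> 0 < F j k (Xs i \<omega> $ k) \<and> (\<forall>t < Xs i \<omega> $ k. F j k t < F j k (Xs i \<omega> $ k)))"

lemma AE_good_sample: "AE \<omega> in M. good \<omega>"
  unfolding good_def AE_all_countable using W_AE[OF AE_good] by simp

definition Dn :: "nat \<Rightarrow> real^'p \<Rightarrow> 'm \<Rightarrow> 'a \<Rightarrow> real" where
  "Dn n u j \<omega> = real (card {i. i < n \<and> W i \<omega> \<in> Hs u j}) / real n"

lemma Gn_Dn: "0 < n \<Longrightarrow> Gn n u j \<omega> = sqrt (real n) * (Dn n u j \<omega> - Dfun P (A j) u)"
proof -
  assume n: "0 < n"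
  have "(\<Sum>i<n. indicator (Hs u j) (W i \<omega>) :: real) = real (card {i. i < n \<and> W i \<omega> \<in> Hs u j})"
    unfolding sum_if_card[symmetric] by (intro sum.cong) auto
  then have "Gn n u j \<omega> = (real (card {i. i < n \<and> W i \<omega> \<in> Hs u j}) - real n * Dfun P (A j) u) / sqrt (real n)"
    by (simp add: Gn_def cen_def Hx_def sum_subtractf Dfun_Hs)
  also have "\<dots> = sqrt (real n) * (Dn n u j \<omega> - Dfun P (A j) u)"
  proof -
    have "(c - s * s * x) / s = s * (c / (s * s) - x)" if "s > 0" for c s x :: real using that by (simp add: field_simps)
    from this[of "sqrt (real n)"] show ?thesis using n by (simp add: Dn_def)
  qed
  finally show ?thesis .
qed

lemma phat_Dn: "phat Zs n (A j) \<omega> = Dn n one j \<omega>"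
  by (simp add: phat_def Dn_def sum_if_card Hs_one)

text \<open>The coordinatewise quantile reduction assembled into one vector: the empirical copula
  becomes a ratio of two values of the empirical distribution function \<open>Dn\<close>, and the
  quantile property is kept as two inequalities for its margins.\<close>

lemma quantile_vec:
  assumes n: "0 < n" and good: "good \<omega>" and ph: "0 < Dn n one j \<omega>" and u: "u \<in> unit_cube"
  obtains v where "v \<in> unit_cube" "Cbar Xs Zs n (A j) \<omega> u = Dn n v j \<omega> / Dn n one j \<omega>"
    "\<And>k. Dn n one j \<omega> * u$k \<le> Dn n (upd one k (v$k)) j \<omega>"
    "\<And>k v'. v' < v$k \<Longrightarrow> Dn n (upd one k v') j \<omega> \<le> Dn n one j \<omega> * u$k"
proof -
  define I where "I = {i. i < n \<and> Zs i \<omega> \<in> A j}"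
  have I: "finite I" by (simp add: I_def)
  have N: "real n * Dn n one j \<omega> = real (card I)" using n by (simp add: Dn_def Hs_one I_def)
  have Ine: "I \<noteq> {}"
  proof
    assume "I = {}"
    then have "real n * Dn n one j \<omega> = 0" unfolding N by simp
    then show False using n ph by simp
  qed
  have Fe: "Fn Xs Zs n (A j) k \<omega> t = real (card {i\<in>I. Xs i \<omega> $ k \<le> t}) / real (card I)" for k t
  proof -
    have "{i. i < n \<and> Xs i \<omega> $ k \<le> t \<and> Zs i \<omega> \<in> A j} = {i\<in>I. Xs i \<omega> $ k \<le> t}" by (auto simp: I_def)
    then show ?thesis using ph by (simp add: Fn_def phat_Dn sum_if_card N)
  qed
  define Q where "Q k v \<longleftrightarrow> 0 \<le> v \<and> v \<le> 1 \<and> (\<forall>i\<in>I. ereal (Xs i \<omega> $ k) \<le> ginv (Fn Xs Zs n (A j) k \<omega>) (u$k) \<longleftrightarrow> F j k (Xs i \<omega> $ k) \<le> v) \<and>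
    u$k * real (card I) \<le> real (card {i\<in>I. F j k (Xs i \<omega> $ k) \<le> v}) \<and> (\<forall>v'<v. real (card {i\<in>I. F j k (Xs i \<omega> $ k) \<le> v'}) \<le> u$k * real (card I))" for k v
  have ex: "\<exists>v. Q k v" for k
    unfolding Q_def
  proof (rule ginv_step[OF I Ine _ _ _ _ _ refl Fe])
    show "0 \<le> u$k" "u$k \<le> 1" using u by (auto simp: unit_cube_def)
    show "F j k s \<le> F j k t" if "s \<le> t" for s t by (rule F_mono[OF that])
  qed (use good in \<open>auto simp: F_bounds good_def I_def\<close>)
  then obtain v where Qv: "\<And>k. Q k (v k)" by metis
  have v: "\<And>k. 0 \<le> v k" "\<And>k. v k \<le> 1"
    "\<And>k i. i \<in> I \<Longrightarrow> ereal (Xs i \<omega> $ k) \<le> ginv (Fn Xs Zs n (A j) k \<omega>) (u$k) \<longleftrightarrow> F j k (Xs i \<omega> $ k) \<le> v k"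
    "\<And>k. u$k * real (card I) \<le> real (card {i\<in>I. F j k (Xs i \<omega> $ k) \<le> v k})"
    "\<And>k v'. v' < v k \<Longrightarrow> real (card {i\<in>I. F j k (Xs i \<omega> $ k) \<le> v'}) \<le> u$k * real (card I)"
    using Qv unfolding Q_def by blast+
  have T: "{i. i < n \<and> W i \<omega> \<in> Hs (upd one k c) j} = {i\<in>I. F j k (Xs i \<omega> $ k) \<le> c}" for k c
    unfolding Hs_margin by (auto simp: Ts_def I_def)
  have D1: "Dn n (upd one k c) j \<omega> = real (card {i\<in>I. F j k (Xs i \<omega> $ k) \<le> c}) / real n" for k c
    by (simp only: Dn_def T)
  have D2: "Dn n one j \<omega> * c = c * real (card I) / real n" for c using N n by (simp add: field_simps)
  show ?thesis
  proof (rule that[of "\<chi> k. v k"])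
    show "(\<chi> k. v k) \<in> unit_cube" using v by (simp add: unit_cube_def)
    have "{i. i < n \<and> (\<forall>k. ereal (Xs i \<omega> $ k) \<le> ginv (Fn Xs Zs n (A j) k \<omega>) (u$k)) \<and> Zs i \<omega> \<in> A j}
       = {i. i < n \<and> W i \<omega> \<in> Hs (\<chi> k. v k) j}"
      using v(3) by (auto simp: Hs_def I_def)
    then show "Cbar Xs Zs n (A j) \<omega> u = Dn n (\<chi> k. v k) j \<omega> / Dn n one j \<omega>"
      by (simp add: Cbar_def sum_if_card phat_Dn Dn_def)
    show "Dn n one j \<omega> * u$k \<le> Dn n (upd one k ((\<chi> k. v k)$k)) j \<omega>" for k
      unfolding D1 D2 vec_lambda_beta using v(4)[of k] by (rule divide_right_mono) simp
    show "Dn n (upd one k v') j \<omega> \<le> Dn n one j \<omega> * u$k" if "v' < (\<chi> k. v k)$k" for k v'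
      using v(5)[of v' k] that unfolding D1 D2 vec_lambda_beta by (intro divide_right_mono) auto
  qed
qed

lemma Gn_margin0: "0 < n \<Longrightarrow> good \<omega> \<Longrightarrow> Dn n (upd one k 0) j \<omega> = 0" "0 < n \<Longrightarrow> good \<omega> \<Longrightarrow> Gn n (upd one k 0) j \<omega> = 0"
proof -
  show *: "Dn n (upd one k 0) j \<omega> = 0" if "0 < n" "good \<omega>"
  proof -
    have "{i. i < n \<and> W i \<omega> \<in> Hs (upd one k 0) j} = {}"
      using that unfolding Hs_margin by (auto simp: Ts_def good_def not_le)
    then show ?thesis by (simp only: Dn_def) simp
  qed
  show "Gn n (upd one k 0) j \<omega> = 0" if "0 < n" "good \<omega>"
    using *[OF that] that D_margin[of 0 j k] by (simp add: Gn_Dn)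
qed

text \<open>The jumps of the empirical margin are bounded by the oscillation of Gn, so ties among the
  observations need not be excluded.\<close>
lemma coord_est:
  assumes n: "0 < n" and good: "good \<omega>" and d: "0 < \<delta>"
    and md: "\<And>a b. a \<in> unit_cube \<Longrightarrow> b \<in> unit_cube \<Longrightarrow> (\<And>i. \<bar>a$i - b$i\<bar> \<le> \<delta>) \<Longrightarrow> \<bar>Gn n a j \<omega> - Gn n b j \<omega>\<bar> \<le> e"
    and u: "0 \<le> u" "u \<le> 1" and v: "0 \<le> v" "v \<le> 1"
    and q1: "Dn n one j \<omega> * u \<le> Dn n (upd one k v) j \<omega>"
    and q2: "\<And>v'. v' < v \<Longrightarrow> Dn n (upd one k v') j \<omega> \<le> Dn n one j \<omega> * u"
  shows "\<bar>p j * (sqrt (real n) * (v - u)) + Gn n (upd one k v) j \<omega> - u * Gn n one j \<omega>\<bar> \<le> e"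
proof -
  let ?s = "sqrt (real n)" and ?D = "\<lambda>u. Dn n u j \<omega>" and ?G = "\<lambda>u. Gn n u j \<omega>"
  have s: "?s > 0" using n by simp
  have G1: "?s * ?D (upd one k c) = ?s * (p j * c) + ?G (upd one k c)" if "0 \<le> c" "c \<le> 1" for c
    using that n by (simp add: Gn_Dn D_margin algebra_simps)
  have G2: "?s * ?D one = ?s * p j + ?G one" using n by (simp add: Gn_Dn D_one algebra_simps)
  \<comment> \<open>Up to the factor sqrt n, E is the amount by which the empirical margin at v
    overshoots its target; it is nonnegative by \<open>q1\<close>, and only the upper bound needs
    the modulus.\<close>
  define E where "E = p j * (?s * (v - u)) + ?G (upd one k v) - u * ?G one"
  have E: "E = ?s * ?D (upd one k v) - ?s * (?D one * u)"
  proof -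
    have "?s * (?D one * u) = (?s * p j + ?G one) * u" by (simp add: G2[symmetric])
    then show ?thesis unfolding E_def G1[OF v] by (simp add: algebra_simps)
  qed
  have "0 \<le> E" unfolding E using mult_left_mono[OF q1, of ?s] s by simp
  have e0: "0 \<le> e" using md[OF one_cube one_cube] d by simp
  have "E \<le> e"
  proof (cases "v = 0")
    case True
    \<comment> \<open>At v = 0 there is no point to the left to compare with, but on
      \<open>good\<close> samples the empirical margin vanishes there.\<close>
    then have "?D (upd one k v) = 0" using Gn_margin0(1)[OF n good] by simp
    then have "E \<le> 0" using \<open>0 \<le> E\<close> q1 s unfolding E by (simp add: Dn_def[of n one] mult_nonneg_nonneg u)
    then show ?thesis using e0 by simp
  next
    case False
    then have v0: "0 < v" using v by simp
    show ?thesis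
    proof (rule field_le_epsilon)
      fix x :: real assume x: "0 < x"
      have ps: "0 < p j * ?s" using s pA_pos by simp
      \<comment> \<open>The step to the left stays within the modulus and within the cube, and the
        drift p s h it causes is at most the arbitrary slack x.\<close>
      define h where "h = min (min \<delta> v) (x / (p j * ?s))"
      have h: "0 < h" "h \<le> \<delta>" "h \<le> v" "h \<le> x / (p j * ?s)" using d v0 x ps by (auto simp: h_def)
      have hx: "p j * ?s * h \<le> x" using h(4) ps by (simp add: pos_le_divide_eq mult.commute)
      have vh: "0 \<le> v - h" "v - h \<le> 1" using h v by auto
      have "E \<le> ?s * ?D (upd one k v) - ?s * ?D (upd one k (v - h))"
        unfolding E using mult_left_mono[OF q2[of "v - h"], of ?s] s h by simp
      also have "\<dots> = p j * ?s * h + (?G (upd one k v) - ?G (upd one k (v - h)))"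
        unfolding G1[OF v] G1[OF vh] by (simp add: algebra_simps)
      also have "?G (upd one k v) - ?G (upd one k (v - h)) \<le> e"
      proof -
        have "\<bar>?G (upd one k v) - ?G (upd one k (v - h))\<bar> \<le> e"
          using h v vh d by (intro md upd_cube one_cube) (auto simp: upd_nth)
        then show ?thesis by simp
      qed
      finally show "E \<le> e + x" using hx by simp
    qed
  qed
  with \<open>0 \<le> E\<close> show ?thesis by (simp add: E_def)
qed

end

text \<open>Here ph is the empirical probability of A and (Dv + Gv / s) / ph the empirical copula.\<close>
lemma ratio_expansion:
  fixes s p ph Dv Du Gv Gu G1 T0 :: real
  assumes s: "0 < s" and p: "0 < p" "p \<le> 1" and ph: "ph = p + G1 / s" "p / 2 \<le> ph"
    and D: "0 \<le> Du" "Du \<le> p" and G1: "\<bar>G1\<bar> \<le> K"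
    and T: "\<bar>s * (Dv - Du) + Gv - T0\<bar> \<le> e" and T0: "\<bar>T0\<bar> \<le> b"
  shows "\<bar>s * ((Dv + Gv / s) / ph - Du / p) - (T0 / p - Du / p\<^sup>2 * G1)\<bar> \<le> 2 * e / p + (b + K) * (2 * K / (s * p\<^sup>2))"
proof -
  have php: "0 < ph" using p ph by linarith
  have K0: "0 \<le> K" using G1 by linarith
  have inv: "1 / ph - 1 / p = - G1 / (s * p * ph)"
  proof -
    have g: "G1 = s * (ph - p)" using s ph(1) by simp
    show ?thesis unfolding g using s p php by (simp add: field_simps)
  qed
  have invb: "\<bar>1 / ph - 1 / p\<bar> \<le> 2 * K / (s * p\<^sup>2)"
  proof -
    have "\<bar>1 / ph - 1 / p\<bar> = \<bar>G1\<bar> / (s * p * ph)" unfolding inv using s p php by (simp add: abs_divide abs_mult)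
    also have "\<dots> \<le> K / (s * p * (p / 2))"
      using G1 s p ph(2) K0 by (intro frac_le mult_left_mono) auto
    also have "\<dots> = 2 * K / (s * p\<^sup>2)" by (simp add: power2_eq_square mult_ac)
    finally show ?thesis .
  qed
  define T where "T = s * (Dv - Du) + Gv"
  have "s * (Dv + Gv / s) = T + s * Du" using s by (simp add: T_def algebra_simps)
  then have "s * ((Dv + Gv / s) / ph - Du / p) = (T + s * Du) / ph - s * Du / p" by (simp add: right_diff_distrib)
  also have "\<dots> = T * (1 / ph) + s * Du * (1 / ph - 1 / p)" by (simp add: add_divide_distrib right_diff_distrib)
  also have "s * Du * (1 / ph - 1 / p) = - (Du * G1 / p) * (1 / ph)" unfolding inv using s by simp
  finally have "s * ((Dv + Gv / s) / ph - Du / p) = T * (1 / ph) - (Du * G1 / p) * (1 / ph)" by simp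
  moreover have "T0 / p - Du / p\<^sup>2 * G1 = T0 * (1 / p) - (Du * G1 / p) * (1 / p)" by (simp add: power2_eq_square)
  moreover have "T * a - Q * a - (T0 * c - Q * c) = (T - T0) * a + T0 * (a - c) - Q * (a - c)" for a c Q by (simp add: algebra_simps)
  \<comment> \<open>Three errors: the numerator against T0 with the empirical denominator, and the
    change of the denominator from ph to p in each of the two terms.\<close>
  ultimately have eq: "s * ((Dv + Gv / s) / ph - Du / p) - (T0 / p - Du / p\<^sup>2 * G1)
      = (T - T0) * (1 / ph) + T0 * (1 / ph - 1 / p) - (Du * G1 / p) * (1 / ph - 1 / p)" by (simp only:)
  have a1: "\<bar>(T - T0) * (1 / ph)\<bar> \<le> e * (2 / p)"
    unfolding abs_mult
  proof (rule mult_mono)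
    show "\<bar>T - T0\<bar> \<le> e" using T by (simp add: T_def)
    have "1 / ph \<le> 1 / (p / 2)" using ph(2) p by (intro divide_left_mono) auto
    then show "\<bar>1 / ph\<bar> \<le> 2 / p" using php by simp
    show "0 \<le> e" using T by linarith
  qed auto
  have a2: "\<bar>T0 * (1 / ph - 1 / p)\<bar> \<le> b * (2 * K / (s * p\<^sup>2))"
    unfolding abs_mult using T0 invb by (intro mult_mono) auto
  have "\<bar>Du * G1 / p\<bar> \<le> K"
  proof -
    have "\<bar>Du * G1 / p\<bar> = (Du / p) * \<bar>G1\<bar>" using D p by (simp add: abs_mult)
    also have "\<dots> \<le> 1 * K" using D p G1 by (intro mult_mono) auto
    finally show ?thesis by simp
  qed
  then have a3: "\<bar>(Du * G1 / p) * (1 / ph - 1 / p)\<bar> \<le> K * (2 * K / (s * p\<^sup>2))"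
    unfolding abs_mult[of "Du * G1 / p"] using invb K0 by (intro mult_mono) auto
  have "2 * e / p = e * (2 / p)" by simp
  then show ?thesis unfolding eq distrib_right using a1 a2 a3 by linarith
qed

context emp_sample
begin

text \<open>The deterministic core, for one \<omega>: boundedness by K and a modulus e for G_n imply
  the expansion for all large n. The tolerance e depends on K and \<epsilon> but not on \<delta>, so
  \<delta> may be supplied afterwards by \<open>Gn_good_event\<close>.\<close>

lemma delta_estimate:
  fixes K :: real
  assumes K: "K > 0" and eps: "\<epsilon> > 0"
  shows "\<exists>e>0. \<forall>\<delta>>0. \<exists>n0. \<forall>n\<ge>n0. \<forall>\<omega>. good \<omega> \<longrightarrow> (\<forall>u\<in>unit_cube. \<bar>Gn n u j \<omega>\<bar> \<le> K) \<longrightarrow>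
    (\<forall>u\<in>unit_cube. \<forall>v\<in>unit_cube. (\<forall>i. \<bar>u$i - v$i\<bar> \<le> \<delta>) \<longrightarrow> \<bar>Gn n u j \<omega> - Gn n v j \<omega>\<bar> \<le> e) \<longrightarrow>
    (\<forall>u\<in>unit_cube. \<bar>sqrt (real n) * (Cbar Xs Zs n (A j) \<omega> u - Ccop P (A j) u) - Lop j (\<lambda>u. Gn n u j \<omega>) u\<bar> \<le> \<epsilon>)"
proof -
  let ?p = "p j" and ?c = "real CARD('p)"
  have p0: "0 < ?p" "?p \<le> 1" by (auto simp: pA_pos p_le1)
  have c0: "0 \<le> ?c" "1 \<le> ?c" by (auto simp: Suc_le_eq)
  \<comment> \<open>Collects the errors in units of e: 1 for G_n(v) against G_n(u) and, in each
    coordinate, the remainder of \<open>D_expand\<close> and 2 \<open>pDc\<close> for replacing p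
    \<Delta> by -\<gamma>.\<close>
  define C1 where "C1 = 1 + ?c * ((1 + 4 * (1 + pDc) + 2 * pDc) / ?p)"
  have C1: "C1 > 0" unfolding C1_def using p0 c0 pDc_ge by (intro add_pos_nonneg mult_nonneg_nonneg divide_nonneg_nonneg) auto
  define e where "e = min 1 (\<epsilon> * ?p / (4 * C1))"
  have e: "0 < e" "e \<le> 1" using eps p0 C1 by (auto simp: e_def)
  have eC: "2 * (C1 * e) / ?p \<le> \<epsilon> / 2"
  proof -
    have "e \<le> \<epsilon> * ?p / (4 * C1)" by (simp add: e_def)
    then show ?thesis using C1 p0 by (simp add: field_simps)
  qed
  define b where "b = K + ?c * (pDc * (2 * K) / ?p)"
  show ?thesis
  proof (intro exI[of _ e] conjI allI impI)
    show "0 < e" by fact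
    fix \<delta> :: real assume d: "0 < \<delta>"
    \<comment> \<open>Width of the boundary layer: within a of a face the modulus compares with the
      face itself, and a K \<le> e controls the term u_k G_n(1) or (1 - u_k) G_n(1).\<close>
    define a where "a = min \<delta> (e / K)"
    have a: "0 < a" "a \<le> \<delta>" "a * K \<le> e" using d e K by (auto simp: a_def min_def field_simps split: if_splits)
    \<comment> \<open>Chosen against \<bar>\<Delta>\<bar> \<le> (2 K + 1) / p, so that an inner
      coordinate contributes at most e / p.\<close>
    define e1 where "e1 = e / (2 * K + 1)"
    have e1: "0 < e1" "e1 * (2 * K + 1) = e" using e K by (auto simp: e1_def)
    obtain dE where dE: "0 < dE" "\<And>u v. u \<in> unit_cube \<Longrightarrow> v \<in> unit_cube \<Longrightarrow> (\<And>i. \<bar>u$i - v$i\<bar> \<le> dE) \<Longrightarrow>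
      \<bar>Dfun P (A j) v - Dfun P (A j) u - (\<Sum>i\<in>UNIV. pD P (A j) i u * (v$i - u$i))\<bar>
      \<le> (\<Sum>i\<in>UNIV. (if a \<le> u$i \<and> u$i \<le> 1 - a then e1 else 1 + pDc) * \<bar>v$i - u$i\<bar>)"
      using D_expand[OF a(1) e1(1), of j] by blast
    define d' where "d' = min \<delta> dE"
    have d': "0 < d'" using d dE by (simp add: d'_def)
    have lim: "(\<lambda>n. x / sqrt (real n)) \<longlonglongrightarrow> 0" for x
      by (intro tendsto_divide_0[OF tendsto_const] filterlim_at_top_imp_at_infinity filterlim_compose[OF sqrt_at_top filterlim_real_sequentially])
    have "\<forall>\<^sub>F n in sequentially. 0 < n \<and> ((2 * K + 1) / ?p) / sqrt (real n) < d' \<and> K / sqrt (real n) < ?p / 2 \<and>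
        ((b + K) * (2 * K / ?p\<^sup>2)) / sqrt (real n) < \<epsilon> / 2"
      using d' p0 eps by (intro eventually_conj eventually_gt_at_top order_tendstoD(2)[OF lim]) auto
    then obtain n0 where n0: "\<And>n. n \<ge> n0 \<Longrightarrow> 0 < n" "\<And>n. n \<ge> n0 \<Longrightarrow> ((2 * K + 1) / ?p) / sqrt (real n) < d'"
      "\<And>n. n \<ge> n0 \<Longrightarrow> K / sqrt (real n) < ?p / 2" "\<And>n. n \<ge> n0 \<Longrightarrow> ((b + K) * (2 * K / ?p\<^sup>2)) / sqrt (real n) < \<epsilon> / 2"
      unfolding eventually_sequentially by blast
    have main: "\<bar>sqrt (real n) * (Cbar Xs Zs n (A j) \<omega> u - Ccop P (A j) u) - Lop j (\<lambda>u. Gn n u j \<omega>) u\<bar> \<le> \<epsilon>"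
      if nn: "n \<ge> n0" and good: "good \<omega>" and bd: "\<forall>u\<in>unit_cube. \<bar>Gn n u j \<omega>\<bar> \<le> K"
        and md: "\<forall>u\<in>unit_cube. \<forall>v\<in>unit_cube. (\<forall>i. \<bar>u$i - v$i\<bar> \<le> \<delta>) \<longrightarrow> \<bar>Gn n u j \<omega> - Gn n v j \<omega>\<bar> \<le> e"
        and u: "u \<in> unit_cube" for n \<omega> u
    proof -
      define s where "s = sqrt (real n)"
      have n: "0 < n" by (rule n0(1)[OF nn])
      have s: "0 < s" using n by (simp add: s_def)
      let ?G = "\<lambda>u. Gn n u j \<omega>"
      have uk: "0 \<le> u$k" "u$k \<le> 1" for k using u by (auto simp: unit_cube_def)
      define ph where "ph = Dn n one j \<omega>"
      have phe: "ph = ?p + ?G one / s" using n s by (simp add: Gn_Dn D_one ph_def s_def)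
      have G1: "\<bar>?G one\<bar> \<le> K" using bd one_cube by blast
      have "\<bar>?G one / s\<bar> \<le> K / s" using G1 s by (simp add: abs_divide divide_right_mono)
      then have ph2: "?p / 2 \<le> ph" using n0(3)[OF nn] unfolding phe s_def by linarith
      then have php: "0 < Dn n one j \<omega>" using p0 by (simp add: ph_def)
      obtain v where v: "v \<in> unit_cube" and Cb: "Cbar Xs Zs n (A j) \<omega> u = Dn n v j \<omega> / Dn n one j \<omega>"
        and q1: "\<And>k. Dn n one j \<omega> * u$k \<le> Dn n (upd one k (v$k)) j \<omega>"
        and q2: "\<And>k v'. v' < v$k \<Longrightarrow> Dn n (upd one k v') j \<omega> \<le> Dn n one j \<omega> * u$k"
        using quantile_vec[OF n good php u] by blast
      have vk: "0 \<le> v$k" "v$k \<le> 1" for k using v by (auto simp: unit_cube_def)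
      have mdd: "\<bar>?G x - ?G y\<bar> \<le> e" if "x \<in> unit_cube" "y \<in> unit_cube" "\<And>i. \<bar>x$i - y$i\<bar> \<le> \<delta>" for x y
        using md that by blast
      define \<Delta> where "\<Delta> k = s * (v$k - u$k)" for k
      have A: "\<bar>?p * \<Delta> k + ?G (upd one k (v$k)) - u$k * ?G one\<bar> \<le> e" for k
        unfolding \<Delta>_def s_def by (rule coord_est[OF n good d mdd uk vk q1 q2])
      have uG: "\<bar>u$k * ?G one\<bar> \<le> K" for k
        using mult_mono[OF uk(2)[of k] G1] uk(1)[of k] K by (simp add: abs_mult)
      have mc: "upd one k t \<in> unit_cube" if "0 \<le> t" "t \<le> 1" for k t using that by (intro upd_cube one_cube)
      have B0: "?p * \<bar>\<Delta> k\<bar> \<le> 2 * K + 1" for k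
      proof -
        have "\<bar>?G (upd one k (v$k))\<bar> \<le> K" using bd mc[OF vk] by blast
        then have "\<bar>?p * \<Delta> k\<bar> \<le> 2 * K + 1" using A[of k] uG[of k] e by linarith
        then show ?thesis using p0 by (simp add: abs_mult)
      qed
      have B: "\<bar>\<Delta> k\<bar> \<le> (2 * K + 1) / ?p" for k using B0[of k] p0 by (simp add: pos_le_divide_eq mult.commute)
      have vu: "\<bar>u$k - v$k\<bar> \<le> d'" for k
      proof -
        have "\<bar>u$k - v$k\<bar> = \<bar>\<Delta> k\<bar> / s" using s by (simp add: \<Delta>_def abs_mult abs_minus_commute)
        also have "\<dots> \<le> ((2 * K + 1) / ?p) / s" using B s by (intro divide_right_mono) auto
        finally show ?thesis using n0(2)[OF nn] by (simp add: s_def)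
      qed
      then have vud: "\<bar>u$k - v$k\<bar> \<le> \<delta>" "\<bar>u$k - v$k\<bar> \<le> dE" for k by (auto simp: d'_def)
      \<comment> \<open>The bridge at u_k; up to 2 e it equals -p \<Delta> k.\<close>
      define \<gamma> where "\<gamma> k = ?G (upd one k (u$k)) - u$k * ?G one" for k
      have C: "\<bar>?p * \<Delta> k + \<gamma> k\<bar> \<le> 2 * e" for k
      proof -
        have "\<bar>?G (upd one k (v$k)) - ?G (upd one k (u$k))\<bar> \<le> e"
          using vud(1)[of k] d by (intro mdd mc uk vk) (auto simp: upd_nth abs_minus_commute)
        then show ?thesis using A[of k] unfolding \<gamma>_def by linarith
      qed
      \<comment> \<open>Near a face the bridge is small: at 0 both of its terms vanish on
        \<open>good\<close> samples, at 1 they cancel. Hence \<Delta> is small too, and there the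
        crude Lipschitz estimate of \<open>D_expand\<close> is enough.\<close>
      have gs: "\<bar>\<gamma> k\<bar> \<le> 2 * e" if "\<not> (a \<le> u$k \<and> u$k \<le> 1 - a)" for k
      proof (cases "a \<le> u$k")
        case False
        have "\<bar>?G (upd one k (u$k)) - ?G (upd one k 0)\<bar> \<le> e"
          using False a d uk[of k] by (intro mdd mc uk) (auto simp: upd_nth)
        moreover have "\<bar>u$k * ?G one\<bar> \<le> a * K"
          using mult_mono[of "u$k" a "\<bar>?G one\<bar>" K] False G1 uk(1)[of k] a by (simp add: abs_mult)
        ultimately show ?thesis using Gn_margin0(2)[OF n good, of k j] a(3) unfolding \<gamma>_def by linarith
      next
        case True
        then have ua: "1 - a < u$k" using that by auto
        have o: "upd one k 1 = one" by (simp add: upd_def vec_eq_iff)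
        have "\<bar>?G (upd one k (u$k)) - ?G (upd one k 1)\<bar> \<le> e"
          using ua a d uk[of k] by (intro mdd mc uk) (auto simp: upd_nth)
        moreover have "\<bar>(1 - u$k) * ?G one\<bar> \<le> a * K"
          using mult_mono[of "1 - u$k" a "\<bar>?G one\<bar>" K] ua G1 uk(2)[of k] a by (simp add: abs_mult)
        ultimately show ?thesis using a(3) unfolding \<gamma>_def o by (simp add: left_diff_distrib)
      qed
      have gK: "\<bar>\<gamma> k\<bar> \<le> 2 * K" for k
      proof -
        have "\<bar>?G (upd one k (u$k))\<bar> \<le> K" using bd mc[OF uk] by blast
        then show ?thesis using uG[of k] unfolding \<gamma>_def by linarith
      qed
      have ds: "\<bar>\<Delta> k\<bar> \<le> 4 * e / ?p" if "\<not> (a \<le> u$k \<and> u$k \<le> 1 - a)" for k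
      proof -
        have "\<bar>?p * \<Delta> k\<bar> \<le> 4 * e" using C[of k] gs[OF that] by linarith
        then show ?thesis using p0 by (simp add: abs_mult pos_le_divide_eq mult.commute)
      qed
      define S1 where "S1 = (\<Sum>i\<in>UNIV. pD P (A j) i u * \<Delta> i)"
      have E: "\<bar>s * (Dfun P (A j) v - Dfun P (A j) u) - S1\<bar> \<le> ?c * ((1 + 4 * (1 + pDc)) * e / ?p)"
      proof -
        have "s * (Dfun P (A j) v - Dfun P (A j) u) - S1 = s * (Dfun P (A j) v - Dfun P (A j) u - (\<Sum>i\<in>UNIV. pD P (A j) i u * (v$i - u$i)))"
          by (simp add: S1_def \<Delta>_def right_diff_distrib sum_distrib_left mult_ac)
        then have "\<bar>s * (Dfun P (A j) v - Dfun P (A j) u) - S1\<bar> = s * \<bar>Dfun P (A j) v - Dfun P (A j) u - (\<Sum>i\<in>UNIV. pD P (A j) i u * (v$i - u$i))\<bar>"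
          using s by (simp add: abs_mult)
        also have "\<dots> \<le> s * (\<Sum>i\<in>UNIV. (if a \<le> u$i \<and> u$i \<le> 1 - a then e1 else 1 + pDc) * \<bar>v$i - u$i\<bar>)"
          using s dE(2)[OF u v vud(2)] by (intro mult_left_mono) auto
        also have "\<dots> = (\<Sum>i\<in>UNIV. (if a \<le> u$i \<and> u$i \<le> 1 - a then e1 else 1 + pDc) * \<bar>\<Delta> i\<bar>)"
          using s by (simp add: sum_distrib_left \<Delta>_def abs_mult mult_ac)
        also have "\<dots> \<le> (\<Sum>i\<in>(UNIV::'p set). (1 + 4 * (1 + pDc)) * e / ?p)"
        proof (rule sum_mono)
          fix i
          show "(if a \<le> u$i \<and> u$i \<le> 1 - a then e1 else 1 + pDc) * \<bar>\<Delta> i\<bar> \<le> (1 + 4 * (1 + pDc)) * e / ?p"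
          proof (cases "a \<le> u$i \<and> u$i \<le> 1 - a")
            case True
            have "e1 * \<bar>\<Delta> i\<bar> \<le> e1 * ((2 * K + 1) / ?p)" using B e1 by (intro mult_left_mono) auto
            also have "\<dots> = 1 * e / ?p" using e1(2) by simp
            also have "\<dots> \<le> (1 + 4 * (1 + pDc)) * e / ?p" using e p0 pDc_ge by (intro divide_right_mono mult_right_mono) auto
            finally show ?thesis using True by simp
          next
            case False
            have "(1 + pDc) * \<bar>\<Delta> i\<bar> \<le> (1 + pDc) * (4 * e / ?p)" using ds[OF False] pDc_ge by (intro mult_left_mono) auto
            also have "\<dots> = (4 * (1 + pDc)) * e / ?p" by simp
            also have "\<dots> \<le> (1 + 4 * (1 + pDc)) * e / ?p" using e p0 pDc_ge by (intro divide_right_mono mult_right_mono) auto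
            finally show ?thesis unfolding if_not_P[OF False] .
          qed
        qed
        finally show ?thesis by simp
      qed
      define S2 where "S2 = (\<Sum>i\<in>UNIV. pD P (A j) i u / ?p * \<gamma> i)"
      have S12: "\<bar>S1 + S2\<bar> \<le> ?c * (2 * pDc * e / ?p)"
      proof -
        have "S1 + S2 = (\<Sum>i\<in>UNIV. pD P (A j) i u * ((?p * \<Delta> i + \<gamma> i) / ?p))"
          using p0 by (simp add: S1_def S2_def sum.distrib[symmetric] distrib_left add_divide_distrib)
        also have "\<bar>\<dots>\<bar> \<le> (\<Sum>i\<in>UNIV. \<bar>pD P (A j) i u * ((?p * \<Delta> i + \<gamma> i) / ?p)\<bar>)" by (rule sum_abs)
        also have "\<dots> \<le> (\<Sum>i\<in>(UNIV::'p set). pDc * (2 * e / ?p))"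
        proof (rule sum_mono)
          fix i
          have "\<bar>(?p * \<Delta> i + \<gamma> i) / ?p\<bar> \<le> 2 * e / ?p" using C[of i] p0 by (simp add: abs_divide divide_right_mono)
          then show "\<bar>pD P (A j) i u * ((?p * \<Delta> i + \<gamma> i) / ?p)\<bar> \<le> pDc * (2 * e / ?p)"
            unfolding abs_mult using pD_bound pDc_ge by (intro mult_mono) auto
        qed
        finally show ?thesis by (simp add: mult_ac)
      qed
      \<comment> \<open>The linearised, scaled increment of the numerator: the part of p times
        \<open>Lop\<close> without the correction for the estimated probability of A.\<close>
      define T0 where "T0 = ?G u - S2"
      have Gvu: "\<bar>?G v - ?G u\<bar> \<le> e"
        using vud(1) by (intro mdd u v) (auto simp: abs_minus_commute)
      have T: "\<bar>s * (Dfun P (A j) v - Dfun P (A j) u) + ?G v - T0\<bar> \<le> C1 * e"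
      proof -
        have "\<bar>s * (Dfun P (A j) v - Dfun P (A j) u) + ?G v - T0\<bar> \<le> ?c * ((1 + 4 * (1 + pDc)) * e / ?p) + ?c * (2 * pDc * e / ?p) + e"
          using E S12 Gvu unfolding T0_def by linarith
        also have "\<dots> = C1 * e" by (simp add: C1_def algebra_simps add_divide_distrib)
        finally show ?thesis .
      qed
      have T0b: "\<bar>T0\<bar> \<le> b"
      proof -
        have "\<bar>S2\<bar> \<le> (\<Sum>i\<in>UNIV. \<bar>pD P (A j) i u / ?p * \<gamma> i\<bar>)" unfolding S2_def by (rule sum_abs)
        also have "\<dots> \<le> (\<Sum>i\<in>(UNIV::'p set). pDc / ?p * (2 * K))"
        proof (rule sum_mono)
          fix i
          have "\<bar>pD P (A j) i u / ?p\<bar> \<le> pDc / ?p" using pD_bound[of j i u] p0 by (simp add: abs_divide divide_right_mono)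
          then show "\<bar>pD P (A j) i u / ?p * \<gamma> i\<bar> \<le> pDc / ?p * (2 * K)"
            unfolding abs_mult using gK pDc_ge p0 by (intro mult_mono) auto
        qed
        finally have "\<bar>S2\<bar> \<le> ?c * (pDc * (2 * K) / ?p)" by simp
        moreover have "\<bar>?G u\<bar> \<le> K" using bd u by blast
        ultimately show ?thesis unfolding T0_def b_def by linarith
      qed
      have Dv: "Dn n v j \<omega> = Dfun P (A j) v + ?G v / s" using n s by (simp add: Gn_Dn s_def)
      have L: "Lop j ?G u = T0 / ?p - Dfun P (A j) u / ?p\<^sup>2 * ?G one"
        by (simp add: Lop_def T0_def S2_def \<gamma>_def diff_divide_distrib sum_divide_distrib power2_eq_square)
      have Cc: "Ccop P (A j) u = Dfun P (A j) u / ?p" by (simp add: Ccop_def)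
      have "\<bar>s * ((Dfun P (A j) v + ?G v / s) / ph - Dfun P (A j) u / ?p) - (T0 / ?p - Dfun P (A j) u / ?p\<^sup>2 * ?G one)\<bar>
          \<le> 2 * (C1 * e) / ?p + (b + K) * (2 * K / (s * ?p\<^sup>2))"
        by (rule ratio_expansion[OF s p0 phe ph2 D_bounds G1 T T0b])
      also have "(b + K) * (2 * K / (s * ?p\<^sup>2)) = ((b + K) * (2 * K / ?p\<^sup>2)) / s" by (simp add: mult_ac)
      also have "2 * (C1 * e) / ?p + ((b + K) * (2 * K / ?p\<^sup>2)) / s \<le> \<epsilon>"
        using eC n0(4)[OF nn] by (simp add: s_def)
      finally show ?thesis unfolding Cb Cc L Dv ph_def s_def[symmetric] .
    qed
    then show "\<exists>n0. \<forall>n\<ge>n0. \<forall>\<omega>. good \<omega> \<longrightarrow> (\<forall>u\<in>unit_cube. \<bar>Gn n u j \<omega>\<bar> \<le> K) \<longrightarrow>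
      (\<forall>u\<in>unit_cube. \<forall>v\<in>unit_cube. (\<forall>i. \<bar>u$i - v$i\<bar> \<le> \<delta>) \<longrightarrow> \<bar>Gn n u j \<omega> - Gn n v j \<omega>\<bar> \<le> e) \<longrightarrow>
      (\<forall>u\<in>unit_cube. \<bar>sqrt (real n) * (Cbar Xs Zs n (A j) \<omega> u - Ccop P (A j) u) - Lop j (\<lambda>u. Gn n u j \<omega>) u\<bar> \<le> \<epsilon>)"
      by blast
  qed
qed

end

section \<open>Lipschitz functionals on the space of bounded functions\<close>

lemma Tset_nonempty: "(Tset :: ('m \<Rightarrow> real^'p) set) \<noteq> {}"
  by (auto simp: Tset_def unit_cube_def intro!: exI[of _ "\<lambda>_. 0"])

lemma lset_bound:
  assumes "f \<in> lset" obtains C where "\<And>t. t \<in> Tset \<Longrightarrow> norm (f t) \<le> C"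
  using assms unfolding lset_def bounded_iff by blast

lemma lset_zero: "(\<lambda>_. 0) \<in> lset" by (auto simp: lset_def intro!: boundedI[of _ 0])

lemma supdist_bdd:
  fixes f g :: "('m::finite \<Rightarrow> real^'p) \<Rightarrow> real^'m"
  assumes "f \<in> lset" "g \<in> lset"
  shows "bdd_above ((\<lambda>t. norm (f t - g t)) ` Tset)"
proof -
  obtain C where C: "\<And>t. t \<in> Tset \<Longrightarrow> norm (f t) \<le> C" using lset_bound[OF assms(1)] by blast
  obtain D where D: "\<And>t. t \<in> Tset \<Longrightarrow> norm (g t) \<le> D" using lset_bound[OF assms(2)] by blast
  show ?thesis
  proof (rule bdd_aboveI2)
    fix t :: "'m \<Rightarrow> real^'p" assume "t \<in> Tset"
    then show "norm (f t - g t) \<le> C + D" using C[of t] D[of t] norm_triangle_ineq4[of "f t" "g t"] by linarith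
  qed
qed

lemma supdist_upper:
  fixes f g :: "('m::finite \<Rightarrow> real^'p) \<Rightarrow> real^'m"
  assumes "f \<in> lset" "g \<in> lset" "t \<in> Tset"
  shows "norm (f t - g t) \<le> supdist f g"
  unfolding supdist_def by (rule cSUP_upper[OF assms(3) supdist_bdd[OF assms(1,2)]])

lemma supdist_least: "(\<And>t. t \<in> Tset \<Longrightarrow> norm (f t - g t) \<le> d) \<Longrightarrow> supdist f g \<le> d"
  unfolding supdist_def by (rule cSUP_least[OF Tset_nonempty])

lemma supdist_self[simp]: "supdist f f = 0"
  by (simp add: supdist_def cSUP_const[OF Tset_nonempty])

lemma supdist_commute: "supdist f g = supdist g f"
  by (simp add: supdist_def norm_minus_commute)

lemma supdist_nonneg:
  fixes f g :: "('m::finite \<Rightarrow> real^'p) \<Rightarrow> real^'m"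
  assumes "f \<in> lset" "g \<in> lset" shows "0 \<le> supdist f g"
proof -
  obtain t :: "'m \<Rightarrow> real^'p" where "t \<in> Tset" using Tset_nonempty by auto
  then show ?thesis using supdist_upper[OF assms] norm_ge_zero order_trans by blast
qed

lemma supdist_triangle:
  fixes f g h :: "('m::finite \<Rightarrow> real^'p) \<Rightarrow> real^'m"
  assumes "f \<in> lset" "g \<in> lset" "h \<in> lset" shows "supdist f h \<le> supdist f g + supdist g h"
proof (rule supdist_least)
  fix t :: "'m \<Rightarrow> real^'p" assume t: "t \<in> Tset"
  have "norm (f t - h t) \<le> norm (f t - g t) + norm (g t - h t)" using norm_triangle_ineq[of "f t - g t" "g t - h t"] by simp
  then show "norm (f t - h t) \<le> supdist f g + supdist g h"
    using supdist_upper[OF assms(1,2) t] supdist_upper[OF assms(2,3) t] by linarith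
qed

lemma supdist_eq_0:
  fixes f g :: "('m::finite \<Rightarrow> real^'p) \<Rightarrow> real^'m"
  assumes "f \<in> lset" "g \<in> lset" "supdist f g \<le> 0" shows "f = g"
proof
  fix t
  show "f t = g t"
  proof (cases "t \<in> Tset")
    case True
    then have "norm (f t - g t) \<le> 0" using supdist_upper[OF assms(1,2) True] assms(3) by linarith
    then show ?thesis by simp
  next
    case False
    then show ?thesis using assms by (simp add: lset_def)
  qed
qed

lemma linf_borel_space: "space linf_borel = lset" 
  and linf_open_sets: "linf_open S \<Longrightarrow> S \<in> sets linf_borel"
proof -
  have *: "{S. linf_open S} \<subseteq> Pow lset" by (auto simp: linf_open_def)
  show "space linf_borel = lset" unfolding linf_borel_def using * by (rule space_measure_of)
  show "linf_open S \<Longrightarrow> S \<in> sets linf_borel" unfolding linf_borel_def using * by (subst sets_measure_of) auto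
qed

text \<open>Sequential compactness implies closedness: a point outside S at distance zero would be
  the limit of a sequence in S, whose subsequential limit belongs to S.\<close>

lemma linf_compact_sets:
  fixes S :: "(('m::finite \<Rightarrow> real^'p) \<Rightarrow> real^'m) set"
  assumes S: "linf_compact S" shows "S \<in> sets linf_borel"
proof -
  have sub: "S \<subseteq> lset" using S by (simp add: linf_compact_def)
  have "linf_open (lset - S)"
    unfolding linf_open_def
  proof (intro conjI ballI)
    show "lset - S \<subseteq> lset" by auto
    fix f assume f: "f \<in> lset - S"
    show "\<exists>e>0. \<forall>g\<in>lset. supdist f g < e \<longrightarrow> g \<in> lset - S"
    proof (rule ccontr)
      assume "\<not> ?thesis"
      then have "\<forall>n::nat. \<exists>g\<in>lset. supdist f g < 1 / real (Suc n) \<and> g \<in> S"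
        by (metis Diff_iff of_nat_0_less_iff zero_less_Suc zero_less_divide_1_iff)
      then obtain s where s: "\<And>n. supdist f (s n) < 1 / real (Suc n)" "\<And>n. s n \<in> S" by metis
      then obtain r g where r: "strict_mono r" and g: "g \<in> S" "(\<lambda>n. supdist (s (r n)) g) \<longlonglongrightarrow> 0"
        using S unfolding linf_compact_def by metis
      have "(\<lambda>n. 1 / real (Suc (r n)) + supdist (s (r n)) g) \<longlonglongrightarrow> 0 + 0"
        using LIMSEQ_subseq_LIMSEQ[OF LIMSEQ_inverse_real_of_nat r]
        by (intro tendsto_add g(2)) (simp add: comp_def inverse_eq_divide)
      moreover have "supdist f g \<le> 1 / real (Suc (r n)) + supdist (s (r n)) g" for n
      proof -
        have "supdist f g \<le> supdist f (s (r n)) + supdist (s (r n)) g"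
          using f sub g s(2) by (intro supdist_triangle) auto
        then show ?thesis using s(1)[of "r n"] by linarith
      qed
      ultimately have "supdist f g \<le> 0" using LIMSEQ_le_const[of _ 0 "supdist f g"] by auto
      then have "f = g" using f g sub by (intro supdist_eq_0) auto
      then show False using f g by auto
    qed
  qed
  from sets.Diff[OF sets.top linf_open_sets[OF this]] show ?thesis
    using sub by (simp add: linf_borel_space Diff_Diff_Int Int_absorb1)
qed

text \<open>The Pasch-Hausdorff envelope of h: for bounded h and c \<ge> 0 it is the largest
  c-Lipschitz functional below h on \<open>lset\<close>.\<close>

definition infconv :: "real \<Rightarrow> ((('m::finite \<Rightarrow> real^'p) \<Rightarrow> real^'m) \<Rightarrow> real) \<Rightarrow> (('m \<Rightarrow> real^'p) \<Rightarrow> real^'m) \<Rightarrow> real" where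
  "infconv c h f = (INF g\<in>lset. h g + c * supdist f g)"

context
  fixes c :: real and h :: "(('m::finite \<Rightarrow> real^'p) \<Rightarrow> real^'m) \<Rightarrow> real" and B :: real
  assumes c: "0 \<le> c" and B: "\<And>f. f \<in> lset \<Longrightarrow> \<bar>h f\<bar> \<le> B"
begin

lemma infconv_ge: "f \<in> lset \<Longrightarrow> (\<And>g. g \<in> lset \<Longrightarrow> x \<le> h g + c * supdist f g) \<Longrightarrow> x \<le> infconv c h f"
  unfolding infconv_def using lset_zero by (intro cINF_greatest) auto

lemma infconv_le: "f \<in> lset \<Longrightarrow> g \<in> lset \<Longrightarrow> infconv c h f \<le> h g + c * supdist f g"
  unfolding infconv_def
proof (rule cINF_lower)
  assume f: "f \<in> lset"
  show "bdd_below ((\<lambda>g. h g + c * supdist f g) ` lset)"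
  proof (rule bdd_belowI2)
    fix g :: "('m \<Rightarrow> real^'p) \<Rightarrow> real^'m" assume g: "g \<in> lset"
    have "0 \<le> c * supdist f g" using c supdist_nonneg[OF f g] by simp
    then show "- B \<le> h g + c * supdist f g" using B[OF g] by linarith
  qed
qed auto

lemma infconv_le_self: "f \<in> lset \<Longrightarrow> infconv c h f \<le> h f"
  using infconv_le[of f f] by simp

lemma infconv_bound: "f \<in> lset \<Longrightarrow> \<bar>infconv c h f\<bar> \<le> B"
proof -
  assume f: "f \<in> lset"
  have "- B \<le> infconv c h f"
  proof (rule infconv_ge[OF f])
    fix g :: "('m \<Rightarrow> real^'p) \<Rightarrow> real^'m" assume g: "g \<in> lset"
    have "0 \<le> c * supdist f g" using c supdist_nonneg[OF f g] by simp
    then show "- B \<le> h g + c * supdist f g" using B[OF g] by linarith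
  qed
  then show ?thesis using infconv_le_self[OF f] B[OF f] by linarith
qed

lemma infconv_lipschitz:
  assumes "f \<in> lset" "f' \<in> lset" shows "\<bar>infconv c h f - infconv c h f'\<bar> \<le> c * supdist f f'"
proof -
  have *: "infconv c h a - c * supdist a b \<le> infconv c h b" if "a \<in> lset" "b \<in> lset" for a b
  proof (rule infconv_ge[OF that(2)])
    fix g :: "('m \<Rightarrow> real^'p) \<Rightarrow> real^'m" assume g: "g \<in> lset"
    have "c * supdist a g \<le> c * (supdist a b + supdist b g)" using c that g by (intro mult_left_mono supdist_triangle) auto
    then show "infconv c h a - c * supdist a b \<le> h g + c * supdist b g"
      using infconv_le[OF that(1) g] by (simp add: distrib_left)
  qed
  show ?thesis using *[OF assms] *[OF assms(2,1)] by (simp add: supdist_commute abs_le_iff)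
qed

end

text \<open>Within distance d of f the values of h are close to h f. Farther away the penalty n d
  eventually exceeds 2 B, so such g cannot lower the infimum below h f.\<close>

lemma infconv_tendsto:
  fixes h :: "(('m::finite \<Rightarrow> real^'p) \<Rightarrow> real^'m) \<Rightarrow> real"
  assumes h: "linf_bcont h" and f: "f \<in> lset"
  shows "(\<lambda>n. infconv (real n) h f) \<longlonglongrightarrow> h f"
proof (rule LIMSEQ_I)
  fix r :: real assume r: "0 < r"
  obtain B where B: "\<And>f. f \<in> lset \<Longrightarrow> \<bar>h f\<bar> \<le> B" using h unfolding linf_bcont_def by blast
  obtain d where d: "d > 0" "\<And>g. g \<in> lset \<Longrightarrow> supdist f g < d \<Longrightarrow> \<bar>h g - h f\<bar> < r/2"
    using h f r unfolding linf_bcont_def by (metis half_gt_zero)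
  obtain n0 :: nat where n0: "2 * B / d < real n0" using reals_Archimedean2 by blast
  have "norm (infconv (real n) h f - h f) < r" if n: "n \<ge> n0" for n
  proof -
    have nd: "2 * B \<le> real n * d" using n0 n d(1) by (simp add: pos_divide_less_eq) (meson less_imp_le mult_right_mono of_nat_le_iff order_trans)
    have "h f - r/2 \<le> infconv (real n) h f"
    proof (rule infconv_ge[OF _ B f])
      fix g :: "('m \<Rightarrow> real^'p) \<Rightarrow> real^'m" assume g: "g \<in> lset"
      show "h f - r/2 \<le> h g + real n * supdist f g"
      proof (cases "supdist f g < d")
        case True
        have "0 \<le> real n * supdist f g" using supdist_nonneg[OF f g] by simp
        then show ?thesis using d(2)[OF g True] by linarith
      next
        case False
        then have "real n * d \<le> real n * supdist f g" by (intro mult_left_mono) auto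
        then show ?thesis using nd B[OF f] B[OF g] r by linarith
      qed
    qed simp
    moreover have "infconv (real n) h f \<le> h f" by (rule infconv_le_self[OF _ B f]) simp
    ultimately show ?thesis using r by simp
  qed
  then show "\<exists>no. \<forall>n\<ge>no. norm (infconv (real n) h f - h f) < r" by blast
qed

lemma linf_bcont_uminus: "linf_bcont h \<Longrightarrow> linf_bcont (\<lambda>f. - h f)"
  unfolding linf_bcont_def by (auto simp: abs_minus_commute)

lemma infconv_indicator:
  fixes S :: "(('m::finite \<Rightarrow> real^'p) \<Rightarrow> real^'m) set"
  assumes S: "linf_open S" and f: "f \<in> lset"
  shows "0 < infconv 1 (indicator S) f \<longleftrightarrow> f \<in> S"
proof -
  have B: "\<bar>indicator S f :: real\<bar> \<le> 1" for f by (simp add: indicator_def)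
  show ?thesis
  proof
    assume "f \<in> S"
    then obtain e where e: "e > 0" "\<And>g. g \<in> lset \<Longrightarrow> supdist f g < e \<Longrightarrow> g \<in> S"
      using S unfolding linf_open_def by blast
    \<comment> \<open>Within the e-ball the indicator contributes 1, outside it the distance
      contributes e.\<close>
    have "min 1 e \<le> infconv 1 (indicator S) f"
    proof (rule infconv_ge[OF _ B f])
      fix g :: "('m \<Rightarrow> real^'p) \<Rightarrow> real^'m" assume g: "g \<in> lset"
      then show "min 1 e \<le> indicator S g + 1 * supdist f g"
        using e(2)[OF g] supdist_nonneg[OF f g] by (cases "supdist f g < e") (auto simp: indicator_def)
    qed simp
    then show "0 < infconv 1 (indicator S) f" using e(1) by (auto simp: min_def split: if_splits)
  next
    assume p: "0 < infconv 1 (indicator S) f"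
    have "infconv 1 (indicator S) f \<le> indicator S f" by (rule infconv_le_self[OF _ B f]) simp
    then show "f \<in> S" using p by (cases "f \<in> S") auto
  qed
qed

text \<open>Every open set is the positivity set of a Lipschitz functional, an inf-convolution of its indicator.\<close>
lemma measurable_linf_borelI:
  fixes \<Psi> :: "'a \<Rightarrow> ('m::finite \<Rightarrow> real^'p) \<Rightarrow> real^'m"
  assumes s: "\<And>x. x \<in> space M \<Longrightarrow> \<Psi> x \<in> lset"
    and m: "\<And>h c B. (\<And>f. f \<in> lset \<Longrightarrow> \<bar>h f\<bar> \<le> B) \<Longrightarrow> (\<And>f g. f \<in> lset \<Longrightarrow> g \<in> lset \<Longrightarrow> \<bar>h f - h g\<bar> \<le> c * supdist f g) \<Longrightarrow>
      (\<lambda>x. h (\<Psi> x)) \<in> borel_measurable M"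
  shows "\<Psi> \<in> measurable M linf_borel"
  unfolding linf_borel_def
proof (rule measurable_measure_of)
  show "{S. linf_open S} \<subseteq> Pow lset" by (auto simp: linf_open_def)
  show "\<Psi> \<in> space M \<rightarrow> lset" using s by auto
  fix S :: "(('m \<Rightarrow> real^'p) \<Rightarrow> real^'m) set" assume "S \<in> {S. linf_open S}"
  then have S: "linf_open S" by simp
  have B: "\<bar>indicator S f :: real\<bar> \<le> 1" for f by (simp add: indicator_def)
  have [measurable]: "(\<lambda>x. infconv 1 (indicator S) (\<Psi> x)) \<in> borel_measurable M"
    by (rule m[where B=1 and c=1]) (auto intro!: infconv_bound infconv_lipschitz[of 1 "indicator S", simplified] simp: B)
  have "\<Psi> -` S \<inter> space M = {x\<in>space M. 0 < infconv 1 (indicator S) (\<Psi> x)}"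
    using infconv_indicator[OF S s] by auto
  also have "\<dots> \<in> sets M" by measurable
  finally show "\<Psi> -` S \<inter> space M \<in> sets M" .
qed

lemma linf_bcont_measurable:
  fixes h :: "(('m::finite \<Rightarrow> real^'p) \<Rightarrow> real^'m) \<Rightarrow> real"
  assumes h: "linf_bcont h" shows "h \<in> borel_measurable linf_borel"
proof (rule borel_measurableI)
  fix U :: "real set" assume U: "open U"
  have "linf_open (h -` U \<inter> lset)"
    unfolding linf_open_def
  proof (intro conjI ballI)
    fix f assume f: "f \<in> h -` U \<inter> lset"
    then obtain e where e: "e > 0" "\<And>y. \<bar>y - h f\<bar> < e \<Longrightarrow> y \<in> U" using U unfolding open_dist dist_real_def by auto
    obtain d where d: "d > 0" "\<And>g. g \<in> lset \<Longrightarrow> supdist f g < d \<Longrightarrow> \<bar>h g - h f\<bar> < e"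
      using h f e(1) unfolding linf_bcont_def by blast
    then show "\<exists>e>0. \<forall>g\<in>lset. supdist f g < e \<longrightarrow> g \<in> h -` U \<inter> lset" using e(2) by auto
  qed auto
  then show "h -` U \<inter> space linf_borel \<in> sets linf_borel" unfolding linf_borel_space by (rule linf_open_sets)
qed

lemma lipschitz_linf_bcont:
  fixes h :: "(('m::finite \<Rightarrow> real^'p) \<Rightarrow> real^'m) \<Rightarrow> real"
  assumes B: "\<And>f. f \<in> lset \<Longrightarrow> \<bar>h f\<bar> \<le> B" and L: "\<And>f g. f \<in> lset \<Longrightarrow> g \<in> lset \<Longrightarrow> \<bar>h f - h g\<bar> \<le> c * supdist f g"
  shows "linf_bcont h"
  unfolding linf_bcont_def
proof (intro conjI ballI allI impI)
  show "\<exists>B. \<forall>f\<in>lset. \<bar>h f\<bar> \<le> B" using B by blast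
  fix f :: "('m \<Rightarrow> real^'p) \<Rightarrow> real^'m" and e :: real assume f: "f \<in> lset" and e: "0 < e"
  have "\<bar>h g - h f\<bar> < e" if g: "g \<in> lset" "supdist f g < e / (\<bar>c\<bar> + 1)" for g
  proof -
    have "\<bar>h g - h f\<bar> \<le> c * supdist f g" using L[OF g(1) f] by (simp add: supdist_commute)
    also have "\<dots> \<le> (\<bar>c\<bar> + 1) * supdist f g" using supdist_nonneg[OF f g(1)] by (intro mult_right_mono) auto
    also have "\<dots> < e" using g(2) by (simp add: pos_less_divide_eq mult.commute)
    finally show ?thesis .
  qed
  then show "\<exists>d>0. \<forall>g\<in>lset. supdist f g < d \<longrightarrow> \<bar>h g - h f\<bar> < e" using e by (intro exI[of _ "e / (\<bar>c\<bar> + 1)"]) auto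
qed

section \<open>Outer expectations of bounded functionals\<close>

lemma (in prob_space) outer_exp_approx:
  assumes [measurable]: "g \<in> borel_measurable M" "E \<in> sets M"
    and Y: "\<And>\<omega>. \<omega> \<in> space M \<Longrightarrow> \<bar>Y \<omega>\<bar> \<le> B" and g: "\<And>\<omega>. \<omega> \<in> space M \<Longrightarrow> \<bar>g \<omega>\<bar> \<le> B"
    and a: "\<And>\<omega>. \<omega> \<in> space M - E \<Longrightarrow> \<bar>Y \<omega> - g \<omega>\<bar> \<le> \<epsilon>" and e: "0 \<le> \<epsilon>"
  shows "\<bar>outer_exp M Y - (\<integral>\<omega>. g \<omega> \<partial>M)\<bar> \<le> \<epsilon> + 2 * B * prob E"
proof -
  let ?S = "{integral\<^sup>L M g | g. g \<in> borel_measurable M \<and> integrable M g \<and> (\<forall>\<omega>\<in>space M. Y \<omega> \<le> g \<omega>)}"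
  have gi: "integrable M g" using g by (intro integrable_const_bound[of _ B]) auto
  have iE: "integrable M (\<lambda>\<omega>. indicator E \<omega> :: real)" by (simp add: emeasure_eq_measure)
  have pw: "\<bar>Y \<omega> - g \<omega>\<bar> \<le> \<epsilon> + 2 * B * indicator E \<omega>" if "\<omega> \<in> space M" for \<omega>
    using a[of \<omega>] Y[OF that] g[OF that] that e by (cases "\<omega> \<in> E") (auto simp: indicator_def)
  have bdd: "bdd_below ?S"
  proof (rule bdd_belowI[of _ "-B"])
    fix x assume "x \<in> ?S"
    then obtain k where k: "x = integral\<^sup>L M k" "integrable M k" "\<forall>\<omega>\<in>space M. Y \<omega> \<le> k \<omega>" by auto
    have "(\<integral>\<omega>. - B \<partial>M) \<le> integral\<^sup>L M k"
    proof (rule integral_mono[OF _ k(2)])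
      fix \<omega> assume w: "\<omega> \<in> space M"
      show "- B \<le> k \<omega>" using Y[OF w] k(3) w by fastforce
    qed simp
    then show "- B \<le> x" by (simp add: k prob_space)
  qed
  have up: "integral\<^sup>L M g + \<epsilon> + 2 * B * prob E \<in> ?S"
  proof -
    have "(\<integral>\<omega>. g \<omega> + \<epsilon> + 2 * B * indicator E \<omega> \<partial>M) = integral\<^sup>L M g + \<epsilon> + 2 * B * prob E"
      using gi iE by (simp add: prob_space)
    moreover have "integrable M (\<lambda>\<omega>. g \<omega> + \<epsilon> + 2 * B * indicator E \<omega>)" using gi iE by simp
    moreover have "Y \<omega> \<le> g \<omega> + \<epsilon> + 2 * B * indicator E \<omega>" if "\<omega> \<in> space M" for \<omega> using pw[OF that] by linarith
    ultimately show ?thesis by (intro CollectI exI[of _ "\<lambda>\<omega>. g \<omega> + \<epsilon> + 2 * B * indicator E \<omega>"]) auto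
  qed
  have "outer_exp M Y \<le> integral\<^sup>L M g + \<epsilon> + 2 * B * prob E"
    unfolding outer_exp_def by (rule cInf_lower[OF up bdd])
  moreover have "integral\<^sup>L M g - \<epsilon> - 2 * B * prob E \<le> outer_exp M Y"
    unfolding outer_exp_def
  proof (rule cInf_greatest)
    show "?S \<noteq> {}" using up by blast
    fix x assume "x \<in> ?S"
    then obtain k where k: "x = integral\<^sup>L M k" "integrable M k" "\<forall>\<omega>\<in>space M. Y \<omega> \<le> k \<omega>" by auto
    have "(\<integral>\<omega>. g \<omega> - \<epsilon> - 2 * B * indicator E \<omega> \<partial>M) \<le> integral\<^sup>L M k"
    proof (rule integral_mono[OF _ k(2)])
      show "integrable M (\<lambda>\<omega>. g \<omega> - \<epsilon> - 2 * B * indicator E \<omega>)" using gi iE by simp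
      fix \<omega> assume w: "\<omega> \<in> space M"
      show "g \<omega> - \<epsilon> - 2 * B * indicator E \<omega> \<le> k \<omega>" using pw[OF w] k(3) w by fastforce
    qed
    moreover have "(\<integral>\<omega>. g \<omega> - \<epsilon> - 2 * B * indicator E \<omega> \<partial>M) = integral\<^sup>L M g - \<epsilon> - 2 * B * prob E"
      using gi iE by (simp add: prob_space)
    ultimately show "integral\<^sup>L M g - \<epsilon> - 2 * B * prob E \<le> x" by (simp add: k)
  qed
  ultimately show ?thesis by (simp add: abs_le_iff)
qed

text \<open>The uniform bound makes the sets of majorants nonempty and their integrals bounded
  below, without which an infimum in the reals carries no information.\<close>

lemma (in prob_space) outer_exp_mono:
  assumes "\<And>\<omega>. \<omega> \<in> space M \<Longrightarrow> Y \<omega> \<le> Y' \<omega>" "\<And>\<omega>. \<omega> \<in> space M \<Longrightarrow> \<bar>Y \<omega>\<bar> \<le> B" "\<And>\<omega>. \<omega> \<in> space M \<Longrightarrow> \<bar>Y' \<omega>\<bar> \<le> B"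
  shows "outer_exp M Y \<le> outer_exp M Y'"
  unfolding outer_exp_def
proof (rule cInf_superset_mono)
  show "{integral\<^sup>L M g | g. g \<in> borel_measurable M \<and> integrable M g \<and> (\<forall>\<omega>\<in>space M. Y' \<omega> \<le> g \<omega>)} \<noteq> {}"
    using assms(3) by (auto simp: abs_le_iff intro!: exI[of _ "\<lambda>_. B"])
  show "bdd_below {integral\<^sup>L M g | g. g \<in> borel_measurable M \<and> integrable M g \<and> (\<forall>\<omega>\<in>space M. Y \<omega> \<le> g \<omega>)}"
  proof (rule bdd_belowI[of _ "-B"])
    fix x assume "x \<in> {integral\<^sup>L M g | g. g \<in> borel_measurable M \<and> integrable M g \<and> (\<forall>\<omega>\<in>space M. Y \<omega> \<le> g \<omega>)}"
    then obtain k where k: "x = integral\<^sup>L M k" "integrable M k" "\<forall>\<omega>\<in>space M. Y \<omega> \<le> k \<omega>" by auto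
    have "(\<integral>\<omega>. - B \<partial>M) \<le> integral\<^sup>L M k"
    proof (rule integral_mono[OF _ k(2)])
      fix \<omega> assume w: "\<omega> \<in> space M"
      show "- B \<le> k \<omega>" using assms(2)[OF w] k(3) w by fastforce
    qed simp
    then show "- B \<le> x" by (simp add: k prob_space)
  qed
  show "{integral\<^sup>L M g | g. g \<in> borel_measurable M \<and> integrable M g \<and> (\<forall>\<omega>\<in>space M. Y' \<omega> \<le> g \<omega>)}
    \<subseteq> {integral\<^sup>L M g | g. g \<in> borel_measurable M \<and> integrable M g \<and> (\<forall>\<omega>\<in>space M. Y \<omega> \<le> g \<omega>)}"
    using assms(1) by (auto intro: order_trans)
qed

section \<open>The limit process\<close>

text \<open>The tails \<open>ceps\<close> of the chaining series make the values at successive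
  roundings Cauchy and bound the distance to their limit.\<close>

lemma tame_limit:
  fixes f :: "real^'p \<Rightarrow> real"
  assumes t: "\<And>k. k0 \<le> k \<Longrightarrow> tame f k" and u: "u \<in> unit_cube"
  shows "convergent (\<lambda>k. f (dy k u))" and "k0 \<le> k \<Longrightarrow> \<bar>lim (\<lambda>k. f (dy k u)) - f (dy k u)\<bar> \<le> ceps TYPE('p) k"
proof -
  have ch: "\<bar>f (dy l u) - f (dy k u)\<bar> \<le> ceps TYPE('p) k" if "k0 \<le> k" "k \<le> l" for k l
    using tame_chain[of k "l - k" f u] t u that by auto
  have "Cauchy (\<lambda>k. f (dy k u))"
  proof (rule CauchyI)
    fix r :: real assume "0 < r"
    then have "\<forall>\<^sub>F k in sequentially. ceps TYPE('p) k < r/2 \<and> k0 \<le> k"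
      by (intro eventually_conj order_tendstoD(2)[OF ceps_tendsto] eventually_ge_at_top) auto
    then obtain k where k: "ceps TYPE('p) k < r/2" "k0 \<le> k" by (auto simp: eventually_sequentially)
    have "norm (f (dy m u) - f (dy n u)) < r" if "m \<ge> k" "n \<ge> k" for m n
      using ch[OF k(2) that(1)] ch[OF k(2) that(2)] k(1) unfolding real_norm_def by linarith
    then show "\<exists>M. \<forall>m\<ge>M. \<forall>n\<ge>M. norm (f (dy m u) - f (dy n u)) < r" by blast
  qed
  then show conv: "convergent (\<lambda>k. f (dy k u))" by (rule Cauchy_convergent)
  show "\<bar>lim (\<lambda>k. f (dy k u)) - f (dy k u)\<bar> \<le> ceps TYPE('p) k" if k: "k0 \<le> k"
  proof (rule tendsto_upperbound)
    show "((\<lambda>l. \<bar>f (dy l u) - f (dy k u)\<bar>) \<longlongrightarrow> \<bar>lim (\<lambda>k. f (dy k u)) - f (dy k u)\<bar>) sequentially"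
      using conv by (intro tendsto_intros) (simp add: convergent_LIMSEQ_iff)
    show "\<forall>\<^sub>F l in sequentially. \<bar>f (dy l u) - f (dy k u)\<bar> \<le> ceps TYPE('p) k"
      using eventually_ge_at_top[of k] by eventually_elim (rule ch[OF k])
  qed simp
qed

lemma tame_limit_modulus:
  fixes f :: "real^'p \<Rightarrow> real"
  assumes t: "\<And>k. k0 \<le> k \<Longrightarrow> tame f k" and u: "u \<in> unit_cube" "v \<in> unit_cube" and k: "k0 \<le> k"
    and d: "\<And>i. \<bar>u$i - v$i\<bar> \<le> 1 / 2^k"
  shows "\<bar>lim (\<lambda>k. f (dy k u)) - lim (\<lambda>k. f (dy k v))\<bar> \<le> 3 * ceps TYPE('p) k"
proof (rule tendsto_upperbound)
  have "(\<lambda>k. f (dy k u)) \<longlonglongrightarrow> lim (\<lambda>k. f (dy k u))" "(\<lambda>k. f (dy k v)) \<longlonglongrightarrow> lim (\<lambda>k. f (dy k v))"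
    using tame_limit(1)[OF t u(1)] tame_limit(1)[OF t u(2)] by (auto simp: convergent_LIMSEQ_iff)
  then show "((\<lambda>l. \<bar>f (dy l u) - f (dy l v)\<bar>) \<longlongrightarrow> \<bar>lim (\<lambda>k. f (dy k u)) - lim (\<lambda>k. f (dy k v))\<bar>) sequentially"
    by (intro tendsto_intros)
  show "\<forall>\<^sub>F l in sequentially. \<bar>f (dy l u) - f (dy l v)\<bar> \<le> 3 * ceps TYPE('p) k"
    using eventually_ge_at_top[of k]
  proof eventually_elim
    case (elim l)
    show ?case by (rule tame_modulus[OF _ elim u d]) (use t k in auto)
  qed
qed simp

context cond_law
begin

text \<open>The Cholesky construction needs an index set enumerated by natural numbers; the process
  is built on these countably many points and then extended by limits along roundings.\<close>

definition dyadic_idx :: "((real^'p) \<times> 'm) set" where "dyadic_idx = (\<Union>k. grid k) \<times> UNIV"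

lemma dyadic_idx_countable: "countable dyadic_idx"
proof -
  have "countable (\<Union>k. grid k :: (real^'p) set)" by (rule countable_UN) (auto intro: countable_finite finite_grid)
  then show ?thesis unfolding dyadic_idx_def by (rule countable_SIGMA) (rule countable_finite[OF finite])
qed

definition gcov :: "nat \<Rightarrow> nat \<Rightarrow> real" where
  "gcov i i' = Gam P A (from_nat_into dyadic_idx i) (from_nat_into dyadic_idx i')"

lemma gcov_sym: "gcov i i' = gcov i' i" by (simp add: gcov_def Gam_sym)

lemma gcov_psd: "0 \<le> qform gcov n c"
  unfolding qform_def gcov_def Gam_quad by simp

definition bq :: "real^'p \<Rightarrow> 'm \<Rightarrow> (nat \<Rightarrow> real) \<Rightarrow> real" where
  "bq u j \<omega> = gproc gcov (to_nat_on dyadic_idx (u,j)) \<omega>"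

lemma bq_meas[measurable]: "bq u j \<in> borel_measurable gauss_space"
  unfolding bq_def[abs_def] gproc_def by measurable

lemma bq_comb:
  assumes I: "finite I" and f: "\<And>s. s \<in> I \<Longrightarrow> f s \<in> dyadic_idx"
  obtains n d where "\<And>\<omega>. (\<Sum>s\<in>I. c s * bq (fst (f s)) (snd (f s)) \<omega>) = gcomb n d \<omega>"
    "(\<Sum>k<n. (d k)\<^sup>2) = (\<Sum>s\<in>I. \<Sum>s'\<in>I. c s * c s' * Gam P A (f s) (f s'))"
proof -
  obtain n d where nd: "\<And>\<omega>. (\<Sum>s\<in>I. c s * gproc gcov (to_nat_on dyadic_idx (f s)) \<omega>) = gcomb n d \<omega>"
    "(\<Sum>k<n. (d k)\<^sup>2) = (\<Sum>s\<in>I. \<Sum>s'\<in>I. c s * c s' * gcov (to_nat_on dyadic_idx (f s)) (to_nat_on dyadic_idx (f s')))"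
    using gproc_comb[OF gcov_sym gcov_psd I, of c "\<lambda>s. to_nat_on dyadic_idx (f s)"] by blast
  have "gcov (to_nat_on dyadic_idx (f s)) (to_nat_on dyadic_idx (f s')) = Gam P A (f s) (f s')" if "s \<in> I" "s' \<in> I" for s s'
    using f that dyadic_idx_countable by (simp add: gcov_def)
  then have "(\<Sum>k<n. (d k)\<^sup>2) = (\<Sum>s\<in>I. \<Sum>s'\<in>I. c s * c s' * Gam P A (f s) (f s'))"
    unfolding nd(2) by (intro sum.cong refl) simp
  then show ?thesis using nd(1) by (intro that) (simp_all add: bq_def)
qed

text \<open>The Gaussian increment has the same variance as the centred indicators, so
  \<open>cen_incr\<close> applies; no relation between k and a sample size enters, and all levels
  are available.\<close>

lemma bq_incr_mgf: "incr_mgf gauss_space bq k"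
  unfolding incr_mgf_def
proof (intro allI impI)
  fix j :: 'm and v w :: "real^'p" and s :: real assume nr: "near k v w" and s: "s \<in> {-1, 1}"
  define f where "f i = (if i = (0::nat) then (v,j) else (w,j))" for i
  define c where "c i = (if i = (0::nat) then 1 else -1 :: real)" for i
  have "f i \<in> dyadic_idx" for i using nr by (auto simp: f_def dyadic_idx_def near_def)
  then obtain n d where nd: "\<And>\<omega>. (\<Sum>i\<in>{0,1}. c i * bq (fst (f i)) (snd (f i)) \<omega>) = gcomb n d \<omega>"
    "(\<Sum>k<n. (d k)\<^sup>2) = (\<Sum>i\<in>{0,1}. \<Sum>i'\<in>{0,1}. c i * c i' * Gam P A (f i) (f i'))"
    using bq_comb[of "{0,1}" f c] by blast
  have e: "bq v j \<omega> - bq w j \<omega> = gcomb n d \<omega>" for \<omega> using nd(1)[of \<omega>] by (simp add: f_def c_def)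
  have "(\<Sum>k<n. (d k)\<^sup>2) = (\<integral>x. (cen (v,j) x - cen (w,j) x)\<^sup>2 \<partial>P)"
    unfolding nd(2) Gam_quad by (simp add: f_def c_def)
  also have "\<dots> \<le> real CARD('p) / 2^k" using order_trans[OF cen_incr near_l1[OF nr]] .
  finally have "(s * lam k)\<^sup>2 * (\<Sum>k<n. (d k)\<^sup>2) / 2 \<le> (lam k)\<^sup>2 * (real CARD('p) / 2^k) / 2"
    using s by (intro divide_right_mono mult_mono) (auto simp: power_mult_distrib sum_nonneg)
  also have "\<dots> \<le> real CARD('p)" by (simp add: lam_sq)
  finally show "integrable gauss_space (\<lambda>\<omega>. exp (s * lam k * (bq v j \<omega> - bq w j \<omega>))) \<and>
     (\<integral>\<omega>. exp (s * lam k * (bq v j \<omega> - bq w j \<omega>)) \<partial>gauss_space) \<le> exp (real CARD('p))"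
    unfolding e gcomb_mgf(2) using gcomb_mgf(1) by simp
qed

lemma bq_tail:
  assumes u: "u \<in> grid k"
  shows "measure gauss_space {\<omega>\<in>space gauss_space. \<bar>bq u j \<omega>\<bar> > x} \<le> 2 * exp (1 - x / 2)"
proof -
  interpret G: prob_space gauss_space by (rule prob_space_gauss)
  have "(u,j) \<in> dyadic_idx" using u by (auto simp: dyadic_idx_def)
  then obtain n d where nd: "\<And>\<omega>. (\<Sum>i\<in>{0::nat}. 1 * bq (fst (u,j)) (snd (u,j)) \<omega>) = gcomb n d \<omega>"
    "(\<Sum>k<n. (d k)\<^sup>2) = (\<Sum>i\<in>{0::nat}. \<Sum>i'\<in>{0::nat}. 1 * 1 * Gam P A (u,j) (u,j))"
    using bq_comb[of "{0::nat}" "\<lambda>_. (u,j)" "\<lambda>_. 1"] by blast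
  have e: "bq u j \<omega> = gcomb n d \<omega>" for \<omega> using nd(1)[of \<omega>] by simp
  have "Gam P A (u,j) (u,j) \<le> 1"
  proof -
    have "Gam P A (u,j) (u,j) \<le> measure P (Hx (u,j) \<inter> Hx (u,j))" unfolding Gam_Hx by simp
    also have "\<dots> \<le> 1" by simp
    finally show ?thesis .
  qed
  then have v: "(\<Sum>k<n. (d k)\<^sup>2) \<le> 1" using nd(2) by simp
  have *: "integrable gauss_space (\<lambda>\<omega>. exp (1/2 * (s * bq u j \<omega>)))" "(\<integral>\<omega>. exp (1/2 * (s * bq u j \<omega>)) \<partial>gauss_space) \<le> exp 1"
    if s: "s \<in> {-1,1}" for s
  proof -
    have r: "1/2 * (s * bq u j \<omega>) = (s/2) * gcomb n d \<omega>" for \<omega> by (simp add: e)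
    have "(s/2)\<^sup>2 * (\<Sum>k<n. (d k)\<^sup>2) / 2 \<le> 1" using s v by (auto simp: power_divide)
    then show "(\<integral>\<omega>. exp (1/2 * (s * bq u j \<omega>)) \<partial>gauss_space) \<le> exp 1" unfolding r gcomb_mgf(2) by simp
    show "integrable gauss_space (\<lambda>\<omega>. exp (1/2 * (s * bq u j \<omega>)))" unfolding r by (rule gcomb_mgf)
  qed
  have "G.prob {\<omega>\<in>space gauss_space. \<bar>bq u j \<omega>\<bar> > x} \<le> G.prob ({\<omega>\<in>space gauss_space. 1 * bq u j \<omega> > x} \<union> {\<omega>\<in>space gauss_space. -1 * bq u j \<omega> > x})"
    by (intro G.finite_measure_mono) auto
  also have "\<dots> \<le> G.prob {\<omega>\<in>space gauss_space. 1 * bq u j \<omega> > x} + G.prob {\<omega>\<in>space gauss_space. -1 * bq u j \<omega> > x}"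
    by (intro measure_Un_le) auto
  also have "\<dots> \<le> exp (1 - 1/2 * x) + exp (1 - 1/2 * x)"
    using *[of 1] *[of "-1"] by (intro add_mono G.exp_tail) auto
  finally show ?thesis by simp
qed

definition cbad :: real where "cbad = 2 * real CARD('m) * exp (real CARD('p))"

lemma bq_bad: "bad gauss_space bq k \<in> sets gauss_space" "measure gauss_space (bad gauss_space bq k) \<le> cbad * exp (- real (Suc k))"
proof -
  interpret G: prob_space gauss_space by (rule prob_space_gauss)
  show "bad gauss_space bq k \<in> sets gauss_space" "measure gauss_space (bad gauss_space bq k) \<le> cbad * exp (- real (Suc k))"
    using G.bad_prob[OF bq_incr_mgf[of k] bq_meas] by (auto simp: cbad_def)
qed

definition nice :: "(nat \<Rightarrow> real) \<Rightarrow> bool" where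
  "nice \<omega> \<longleftrightarrow> (\<exists>k0. \<forall>k\<ge>k0. \<forall>j. tame (\<lambda>u. bq u j \<omega>) k)"

lemma bad_iff: "\<omega> \<in> space gauss_space \<Longrightarrow> \<omega> \<in> bad gauss_space bq k \<longleftrightarrow> \<not> (\<forall>j. tame (\<lambda>u. bq u j \<omega>) k)"
  by (auto simp: bad_def)

lemma nice_meas[measurable]: "Measurable.pred gauss_space nice"
proof -
  have [measurable]: "bad gauss_space bq k \<in> sets gauss_space" for k by (rule bq_bad)
  have "Measurable.pred gauss_space (\<lambda>\<omega>. \<exists>k0. \<forall>k. k0 \<le> k \<longrightarrow> \<omega> \<notin> bad gauss_space bq k)" by measurable
  then show ?thesis by (subst measurable_cong[where g="\<lambda>\<omega>. \<exists>k0. \<forall>k. k0 \<le> k \<longrightarrow> \<omega> \<notin> bad gauss_space bq k"]) (auto simp: nice_def bad_iff)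
qed

text \<open>The probabilities of the bad events are summable, so by Borel-Cantelli almost every path
  is tame from some level on.\<close>

lemma AE_nice: "AE \<omega> in gauss_space. nice \<omega>"
proof -
  interpret G: prob_space gauss_space by (rule prob_space_gauss)
  have "summable (\<lambda>k. G.prob (bad gauss_space bq k))"
    by (rule summable_comparison_test'[OF summable_exp_neg[of cbad]]) (use bq_bad in auto)
  then have "AE \<omega> in gauss_space. \<forall>\<^sub>F k in sequentially. \<omega> \<in> space gauss_space - bad gauss_space bq k"
    by (intro borel_cantelli_AE1) (auto simp: bq_bad G.emeasure_eq_measure)
  then show ?thesis
  proof (rule AE_mp, intro AE_I2 impI)
    fix \<omega> assume w: "\<omega> \<in> space gauss_space" "\<forall>\<^sub>F k in sequentially. \<omega> \<in> space gauss_space - bad gauss_space bq k"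
    then show "nice \<omega>" unfolding nice_def eventually_sequentially using bad_iff[OF w(1)] by blast
  qed
qed

text \<open>The value 0 off \<open>nice\<close> makes every path bounded, not only almost every one,
  so \<open>Cinf_vec\<close> takes values in \<open>lset\<close> everywhere.\<close>

definition Bp :: "(nat \<Rightarrow> real) \<Rightarrow> real^'p \<Rightarrow> 'm \<Rightarrow> real" where
  "Bp \<omega> u j = (if nice \<omega> then lim (\<lambda>k. bq (dy k u) j \<omega>) else 0)"

lemma Bp_meas[measurable]: "(\<lambda>\<omega>. Bp \<omega> u j) \<in> borel_measurable gauss_space"
  unfolding Bp_def by measurable

lemma Bp_props:
  obtains k0 where "\<And>u j k. u \<in> unit_cube \<Longrightarrow> k0 \<le> k \<Longrightarrow> \<bar>Bp \<omega> u j - Bp \<omega> (dy k u) j\<bar> \<le> 3 * ceps TYPE('p) k"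
    "\<And>j. \<exists>C. \<forall>u\<in>unit_cube. \<bar>Bp \<omega> u j\<bar> \<le> C"
proof (cases "nice \<omega>")
  case True
  then obtain k0 where t: "\<And>k j. k0 \<le> k \<Longrightarrow> tame (\<lambda>u. bq u j \<omega>) k" by (auto simp: nice_def)
  show ?thesis
  proof (rule that[of k0])
    show "\<bar>Bp \<omega> u j - Bp \<omega> (dy k u) j\<bar> \<le> 3 * ceps TYPE('p) k" if "u \<in> unit_cube" "k0 \<le> k" for u j k
    proof -
      have "\<bar>u$i - dy k u $ i\<bar> \<le> 1 / 2^k" for i using dy_bounds[of u i k] by simp
      then show ?thesis unfolding Bp_def using True
        by (simp add: tame_limit_modulus[where f="\<lambda>u. bq u j \<omega>", OF t that(1) dy_cube[OF that(1)] that(2)])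
    qed
    fix j
    define C where "C = (\<Sum>v\<in>grid k0. \<bar>bq v j \<omega>\<bar>) + ceps TYPE('p) k0"
    have "\<bar>Bp \<omega> u j\<bar> \<le> C" if u: "u \<in> unit_cube" for u
    proof -
      have "\<bar>Bp \<omega> u j - bq (dy k0 u) j \<omega>\<bar> \<le> ceps TYPE('p) k0"
        using tame_limit(2)[where f="\<lambda>u. bq u j \<omega>", OF t u order_refl] True by (simp add: Bp_def)
      moreover have "\<bar>bq (dy k0 u) j \<omega>\<bar> \<le> (\<Sum>v\<in>grid k0. \<bar>bq v j \<omega>\<bar>)"
        using dy_grid[OF u] finite_grid by (intro member_le_sum) auto
      ultimately show ?thesis unfolding C_def by linarith
    qed
    then show "\<exists>C. \<forall>u\<in>unit_cube. \<bar>Bp \<omega> u j\<bar> \<le> C" by blast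
  qed
next
  case False
  have c: "0 \<le> ceps TYPE('p) k" for k using order_trans[OF cx_nonneg cx_le_ceps[OF order_refl, where 'p='p]] .
  show ?thesis by (rule that[of 0]) (auto simp: Bp_def False c)
qed

lemma Bp_disc: "\<exists>k0. \<forall>k\<ge>k0. \<forall>u\<in>unit_cube. \<forall>j. \<bar>Bp \<omega> u j - Bp \<omega> (dy k u) j\<bar> \<le> 3 * ceps TYPE('p) k"
  by (rule Bp_props[of \<omega>]) blast

lemma Bp_bounded: "\<exists>C. \<forall>u\<in>unit_cube. \<bar>Bp \<omega> u j\<bar> \<le> C"
  by (rule Bp_props[of \<omega>]) blast

text \<open>The characteristic functions of the values at roundings have two limits: by dominated
  convergence that of the process, and by continuity of \<open>Gam\<close> the Gaussian one.\<close>

lemma Bp_char: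
  assumes I: "finite I" and f: "\<And>s. s \<in> I \<Longrightarrow> fst (f s) \<in> unit_cube"
  shows "char (distr gauss_space borel (\<lambda>\<omega>. \<Sum>s\<in>I. c s * Bp \<omega> (fst (f s)) (snd (f s)))) t
    = exp (- complex_of_real (t\<^sup>2 * (\<Sum>s\<in>I. \<Sum>s'\<in>I. c s * c s' * Gam P A (f s) (f s')) / 2))"
proof -
  interpret G: prob_space gauss_space by (rule prob_space_gauss)
  define S where "S k \<omega> = (\<Sum>s\<in>I. c s * bq (dy k (fst (f s))) (snd (f s)) \<omega>)" for k \<omega>
  define S' where "S' \<omega> = (\<Sum>s\<in>I. c s * Bp \<omega> (fst (f s)) (snd (f s)))" for \<omega>
  have [measurable]: "S k \<in> borel_measurable gauss_space" "S' \<in> borel_measurable gauss_space" for k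
    unfolding S_def[abs_def] S'_def[abs_def] by measurable
  define g where "g k s = (dy k (fst (f s)), snd (f s))" for k s
  have ck: "char (distr gauss_space borel (S k)) t = exp (- complex_of_real (t\<^sup>2 * (\<Sum>s\<in>I. \<Sum>s'\<in>I. c s * c s' * Gam P A (g k s) (g k s')) / 2))" for k
  proof -
    have "g k s \<in> dyadic_idx" if "s \<in> I" for s using dy_grid[OF f[OF that], of k] by (auto simp: g_def dyadic_idx_def)
    then obtain n d where nd: "\<And>\<omega>. (\<Sum>s\<in>I. c s * bq (fst (g k s)) (snd (g k s)) \<omega>) = gcomb n d \<omega>"
      "(\<Sum>k<n. (d k)\<^sup>2) = (\<Sum>s\<in>I. \<Sum>s'\<in>I. c s * c s' * Gam P A (g k s) (g k s'))"
      using bq_comb[OF I, of "g k" c] by blast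
    have "S k = gcomb n d" by (rule ext) (simp add: S_def nd(1)[symmetric] g_def)
    then show ?thesis by (simp only: char_gcomb nd(2))
  qed
  have l1: "(\<lambda>k. char (distr gauss_space borel (S k)) t) \<longlonglongrightarrow> exp (- complex_of_real (t\<^sup>2 * (\<Sum>s\<in>I. \<Sum>s'\<in>I. c s * c s' * Gam P A (f s) (f s')) / 2))"
  proof -
    have "(\<lambda>k. Gam P A (g k s) (g k s')) \<longlonglongrightarrow> Gam P A (f s) (f s')" for s s'
      using Gam_cont[OF dy_tendsto dy_tendsto, of "fst (f s)" "snd (f s)" "fst (f s')" "snd (f s')"] by (simp add: g_def)
    then show ?thesis unfolding ck by (intro tendsto_intros) auto
  qed
  have l2: "(\<lambda>k. char (distr gauss_space borel (S k)) t) \<longlonglongrightarrow> char (distr gauss_space borel S') t"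
  proof -
    have "(\<lambda>k. \<integral>\<omega>. iexp (t * S k \<omega>) \<partial>gauss_space) \<longlonglongrightarrow> (\<integral>\<omega>. iexp (t * S' \<omega>) \<partial>gauss_space)"
    proof (rule integral_dominated_convergence[where w="\<lambda>_. 1"])
      show "AE \<omega> in gauss_space. (\<lambda>k. iexp (t * S k \<omega>)) \<longlonglongrightarrow> iexp (t * S' \<omega>)"
        using AE_nice
      proof eventually_elim
        case (elim \<omega>)
        then obtain k0 where tm: "\<And>k j. k0 \<le> k \<Longrightarrow> tame (\<lambda>u. bq u j \<omega>) k" by (auto simp: nice_def)
        have "(\<lambda>k. bq (dy k u) j \<omega>) \<longlonglongrightarrow> Bp \<omega> u j" if "u \<in> unit_cube" for u j
          using tame_limit(1)[where f="\<lambda>u. bq u j \<omega>", OF tm that] elim by (simp add: Bp_def convergent_LIMSEQ_iff)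
        then have "(\<lambda>k. S k \<omega>) \<longlonglongrightarrow> S' \<omega>" unfolding S_def S'_def using f by (intro tendsto_intros) auto
        then show ?case by (intro tendsto_intros)
      qed
    qed auto
    then show ?thesis unfolding char_def by (simp add: integral_distr)
  qed
  have "char (distr gauss_space borel S') t = exp (- complex_of_real (t\<^sup>2 * (\<Sum>s\<in>I. \<Sum>s'\<in>I. c s * c s' * Gam P A (f s) (f s')) / 2))"
    by (rule LIMSEQ_unique[OF l2 l1])
  then show ?thesis by (simp only: S'_def[abs_def])
qed

section \<open>The limit map as a Lipschitz map of paths, and its discretisation\<close>

lemma Cinf_comp: "uv \<in> Tset \<Longrightarrow> Cinf_vec P A B uv $ j = Lop j (\<lambda>u. B u j) (uv j)"
  by (simp add: Cinf_vec_def Lop_def Let_def)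

text \<open>In component j, B(u) / p and the last term each contribute 1 / p, the latter because D
  \<le> p; every bridge contributes 2 times the bound on its coefficient. The sum over j comes from
  bounding the Euclidean norm by the l1 norm.\<close>

definition Cinf_lip :: real where
  "Cinf_lip = (\<Sum>j\<in>UNIV. 2 / p j + real CARD('p) * (pDc / (p j)\<^sup>2 * 2))"

lemma Cinf_lip_nonneg: "0 \<le> Cinf_lip"
  unfolding Cinf_lip_def using pA_pos pDc_ge by (intro sum_nonneg add_nonneg_nonneg mult_nonneg_nonneg divide_nonneg_nonneg) (auto simp: less_imp_le)

lemma Lop_diff:
  assumes d: "\<And>u. u \<in> unit_cube \<Longrightarrow> \<bar>B u - B' u\<bar> \<le> d" and u: "u \<in> unit_cube"
  shows "\<bar>Lop j B u - Lop j B' u\<bar> \<le> (2 / p j + real CARD('p) * (pDc / (p j)\<^sup>2 * 2)) * d"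
proof -
  have p0: "0 < p j" by (rule pA_pos)
  have d0: "0 \<le> d" using d[OF u] by linarith
  define x where "x u = B u - B' u" for u
  have x1: "\<bar>x one\<bar> \<le> d" using d[OF one_cube] by (simp add: x_def)
  have uk: "0 \<le> u$k" "u$k \<le> 1" for k using u by (auto simp: unit_cube_def)
  let ?y = "\<lambda>i. x (upd one i (u$i)) - u$i * x one"
  have y: "\<bar>?y i\<bar> \<le> 2 * d" for i
  proof -
    have "\<bar>x (upd one i (u$i))\<bar> \<le> d" unfolding x_def by (rule d[OF upd_cube[OF one_cube uk]])
    moreover have "\<bar>u$i * x one\<bar> \<le> 1 * d" unfolding abs_mult using uk[of i] x1 by (intro mult_mono) auto
    ultimately show ?thesis by linarith
  qed
  have "Lop j B u - Lop j B' u = x u / p j - (\<Sum>i\<in>UNIV. pD P (A j) i u / (p j)\<^sup>2 * ?y i) - Dfun P (A j) u / (p j)\<^sup>2 * x one"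
    by (simp add: Lop_def x_def algebra_simps diff_divide_distrib sum_subtractf sum.distrib)
  moreover have "\<bar>x u / p j\<bar> \<le> d / p j" using d[OF u] p0 by (simp add: x_def abs_divide divide_right_mono)
  moreover have "\<bar>\<Sum>i\<in>UNIV. pD P (A j) i u / (p j)\<^sup>2 * ?y i\<bar> \<le> real CARD('p) * (pDc / (p j)\<^sup>2 * (2 * d))"
  proof -
    have "\<bar>\<Sum>i\<in>UNIV. pD P (A j) i u / (p j)\<^sup>2 * ?y i\<bar> \<le> (\<Sum>i\<in>UNIV. \<bar>pD P (A j) i u / (p j)\<^sup>2 * ?y i\<bar>)" by (rule sum_abs)
    also have "\<dots> \<le> (\<Sum>i\<in>(UNIV::'p set). pDc / (p j)\<^sup>2 * (2 * d))"
    proof (rule sum_mono)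
      fix i
      have "\<bar>pD P (A j) i u / (p j)\<^sup>2\<bar> \<le> pDc / (p j)\<^sup>2" using pD_bound[of j i u] by (simp add: abs_divide divide_right_mono)
      then show "\<bar>pD P (A j) i u / (p j)\<^sup>2 * ?y i\<bar> \<le> pDc / (p j)\<^sup>2 * (2 * d)"
        unfolding abs_mult[of "pD P (A j) i u / (p j)\<^sup>2"] using y pDc_ge by (intro mult_mono) auto
    qed
    finally show ?thesis by simp
  qed
  moreover have "\<bar>Dfun P (A j) u / (p j)\<^sup>2 * x one\<bar> \<le> 1 / p j * d"
  proof -
    have "Dfun P (A j) u / (p j)\<^sup>2 \<le> p j / (p j)\<^sup>2" using D_bounds(2) by (intro divide_right_mono) auto
    also have "\<dots> = 1 / p j" by (simp add: power2_eq_square)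
    finally have "\<bar>Dfun P (A j) u / (p j)\<^sup>2\<bar> \<le> 1 / p j" using D_bounds(1)[of j u] by simp
    then show ?thesis unfolding abs_mult using x1 p0 by (intro mult_mono) auto
  qed
  ultimately have "\<bar>Lop j B u - Lop j B' u\<bar> \<le> d / p j + real CARD('p) * (pDc / (p j)\<^sup>2 * (2 * d)) + 1 / p j * d" by linarith
  also have "\<dots> = (2 / p j + real CARD('p) * (pDc / (p j)\<^sup>2 * 2)) * d" by (simp add: algebra_simps add_divide_distrib)
  finally show ?thesis .
qed

lemma Cinf_diff:
  assumes d: "\<And>u j. u \<in> unit_cube \<Longrightarrow> \<bar>B u j - B' u j\<bar> \<le> d" and uv: "uv \<in> Tset"
  shows "norm (Cinf_vec P A B uv - Cinf_vec P A B' uv) \<le> Cinf_lip * d"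
proof -
  have "norm (Cinf_vec P A B uv - Cinf_vec P A B' uv) \<le> (\<Sum>j\<in>UNIV. \<bar>(Cinf_vec P A B uv - Cinf_vec P A B' uv) $ j\<bar>)"
    by (rule norm_le_l1_cart)
  also have "\<dots> \<le> (\<Sum>j\<in>UNIV. (2 / p j + real CARD('p) * (pDc / (p j)\<^sup>2 * 2)) * d)"
  proof (rule sum_mono)
    fix j
    have "uv j \<in> unit_cube" using uv by (auto simp: Tset_def)
    then show "\<bar>(Cinf_vec P A B uv - Cinf_vec P A B' uv) $ j\<bar> \<le> (2 / p j + real CARD('p) * (pDc / (p j)\<^sup>2 * 2)) * d"
      using Lop_diff[of "\<lambda>u. B u j" "\<lambda>u. B' u j" d "uv j" j] d by (simp add: Cinf_comp[OF uv])
  qed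
  finally show ?thesis by (simp add: Cinf_lip_def sum_distrib_right)
qed

lemma Cinf_lset:
  assumes "\<And>j. \<exists>C. \<forall>u\<in>unit_cube. \<bar>B u j\<bar> \<le> C"
  shows "Cinf_vec P A B \<in> lset"
proof -
  obtain C where C: "\<And>u j. u \<in> unit_cube \<Longrightarrow> \<bar>B u j\<bar> \<le> C j" using assms by metis
  have b: "\<bar>B u j - 0\<bar> \<le> (\<Sum>j\<in>UNIV. \<bar>C j\<bar>)" if "u \<in> unit_cube" for u j
  proof -
    have "\<bar>C j\<bar> \<le> (\<Sum>j\<in>UNIV. \<bar>C j\<bar>)" by (rule member_le_sum) auto
    then show ?thesis using C[OF that, of j] by linarith
  qed
  have z: "Cinf_vec P A (\<lambda>u j. 0) uv = 0" if "uv \<in> Tset" for uv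
    using that by (simp add: vec_eq_iff Cinf_comp Lop_def)
  have "norm (Cinf_vec P A B uv) \<le> Cinf_lip * (\<Sum>j\<in>UNIV. \<bar>C j\<bar>)" if uv: "uv \<in> Tset" for uv
    using Cinf_diff[of B "\<lambda>u j. 0", OF b uv] z[OF uv] by simp
  then show ?thesis unfolding lset_def by (auto simp: Cinf_vec_def intro!: boundedI)
qed

lemma Cinf_supdist:
  assumes "\<And>u j. u \<in> unit_cube \<Longrightarrow> \<bar>B u j - B' u j\<bar> \<le> d"
  shows "supdist (Cinf_vec P A B) (Cinf_vec P A B') \<le> Cinf_lip * d"
  by (rule supdist_least) (rule Cinf_diff[OF assms])

definition gidx :: "nat \<Rightarrow> nat \<Rightarrow> (real^'p) \<times> 'm" where
  "gidx k i = from_nat_into (grid k \<times> UNIV) i"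

definition gnum :: "nat \<Rightarrow> nat" where "gnum k = card ((grid k :: (real^'p) set) \<times> (UNIV :: 'm set))"

text \<open>The limit functional applied to the path frozen on dyadic cells of side 1 / 2^k, as a function of
  its finitely many values.\<close>
definition psi :: "nat \<Rightarrow> (nat \<Rightarrow> real) \<Rightarrow> ('m \<Rightarrow> real^'p) \<Rightarrow> real^'m" where
  "psi k x = Cinf_vec P A (\<lambda>u j. x (to_nat_on (grid k \<times> UNIV) (dy k u, j)))"

lemma gfin: "finite ((grid k :: (real^'p) set) \<times> (UNIV :: 'm set))"
  by (intro finite_cartesian_product finite_grid finite)

lemma gnum_lt: "(u::real^'p) \<in> unit_cube \<Longrightarrow> to_nat_on (grid k \<times> (UNIV::'m set)) (dy k u, j) < gnum k"
proof -
  assume "u \<in> unit_cube"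
  then have "(dy k u, j) \<in> grid k \<times> UNIV" using dy_grid by auto
  from bij_betw_apply[OF to_nat_on_finite[OF gfin] this] show ?thesis by (simp add: gnum_def)
qed

lemma gidx_cube: "fst (gidx k i) \<in> unit_cube"
proof -
  have "(grid k :: (real^'p) set) \<times> (UNIV :: 'm set) \<noteq> {}" using dy_grid[OF one_cube, of k] by auto
  then have "gidx k i \<in> grid k \<times> UNIV" unfolding gidx_def by (rule from_nat_into)
  then show ?thesis using grid_cube by auto
qed

lemma psi_disc: "psi k (\<lambda>i. B (fst (gidx k i)) (snd (gidx k i))) = Cinf_vec P A (\<lambda>u j. B (dy k u) j)"
proof -
  have "supdist (psi k (\<lambda>i. B (fst (gidx k i)) (snd (gidx k i)))) (Cinf_vec P A (\<lambda>u j. B (dy k u) j)) \<le> Cinf_lip * 0"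
    unfolding psi_def
  proof (rule Cinf_supdist)
    fix u :: "real^'p" and j :: 'm assume "u \<in> unit_cube"
    then have "(dy k u, j) \<in> grid k \<times> UNIV" using dy_grid by auto
    then have "gidx k (to_nat_on (grid k \<times> UNIV) (dy k u, j)) = (dy k u, j)"
      unfolding gidx_def using countable_finite[OF gfin] by simp
    then show "\<bar>B (fst (gidx k (to_nat_on (grid k \<times> UNIV) (dy k u, j)))) (snd (gidx k (to_nat_on (grid k \<times> UNIV) (dy k u, j)))) - B (dy k u) j\<bar> \<le> 0" by simp
  qed
  moreover have fb: "\<exists>C. \<forall>u\<in>unit_cube. \<bar>g (dy k u)\<bar> \<le> C" for g :: "real^'p \<Rightarrow> real"
  proof (intro exI ballI)
    fix u :: "real^'p" assume "u \<in> unit_cube"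
    then show "\<bar>g (dy k u)\<bar> \<le> (\<Sum>v\<in>grid k. \<bar>g v\<bar>)" using dy_grid finite_grid by (intro member_le_sum) auto
  qed
  ultimately show ?thesis
    by (intro supdist_eq_0) (auto simp: psi_def intro!: Cinf_lset fb[of "\<lambda>v. _ v"])
qed

lemma psi_lset: "psi k x \<in> lset"
  unfolding psi_def
proof (rule Cinf_lset, intro exI ballI)
  fix j :: 'm and u :: "real^'p" assume "u \<in> unit_cube"
  then show "\<bar>x (to_nat_on (grid k \<times> UNIV) (dy k u, j))\<bar> \<le> (\<Sum>i<gnum k. \<bar>x i\<bar>)"
    using gnum_lt by (intro member_le_sum) auto
qed

lemma psi_lipschitz: "supdist (psi k x) (psi k y) \<le> Cinf_lip * (\<Sum>i<gnum k. \<bar>x i - y i\<bar>)"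
  unfolding psi_def
proof (rule Cinf_supdist)
  fix j :: 'm and u :: "real^'p" assume "u \<in> unit_cube"
  then show "\<bar>x (to_nat_on (grid k \<times> UNIV) (dy k u, j)) - y (to_nat_on (grid k \<times> UNIV) (dy k u, j))\<bar> \<le> (\<Sum>i<gnum k. \<bar>x i - y i\<bar>)"
    using gnum_lt member_le_sum[of "to_nat_on (grid k \<times> UNIV) (dy k u, j)" "{..<gnum k}" "\<lambda>i. \<bar>x i - y i\<bar>"] by auto
qed

lemma hpsi_lipschitz:
  assumes L: "\<And>f g. f \<in> lset \<Longrightarrow> g \<in> lset \<Longrightarrow> \<bar>h f - h g\<bar> \<le> c * supdist f g" and c: "0 \<le> c"
  shows "\<bar>h (psi k x) - h (psi k y)\<bar> \<le> (c * Cinf_lip) * (\<Sum>i<gnum k. \<bar>x i - y i\<bar>)"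
proof -
  have "\<bar>h (psi k x) - h (psi k y)\<bar> \<le> c * supdist (psi k x) (psi k y)" by (rule L[OF psi_lset psi_lset])
  also have "\<dots> \<le> c * (Cinf_lip * (\<Sum>i<gnum k. \<bar>x i - y i\<bar>))" by (rule mult_left_mono[OF psi_lipschitz c])
  finally show ?thesis by (simp add: mult.assoc)
qed

lemma Bp_lset: "Cinf_vec P A (Bp \<omega>) \<in> lset"
  by (rule Cinf_lset[OF Bp_bounded])

text \<open>Each path of \<open>Bp\<close> is uniformly close to its frozen version, and the limit
  map is Lipschitz. This gives both the measurability of h along the limit and the last step of the
  approximation in \<open>lip_conv\<close>.\<close>

lemma disc_conv:
  assumes L: "\<And>f g. f \<in> lset \<Longrightarrow> g \<in> lset \<Longrightarrow> \<bar>h f - h g\<bar> \<le> c * supdist f g" and c: "0 \<le> c"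
  shows "(\<lambda>k. h (psi k (\<lambda>i. Bp \<omega> (fst (gidx k i)) (snd (gidx k i))))) \<longlonglongrightarrow> h (Cinf_vec P A (Bp \<omega>))"
proof -
  obtain k0 where k0: "\<And>u j k. u \<in> unit_cube \<Longrightarrow> k0 \<le> k \<Longrightarrow> \<bar>Bp \<omega> u j - Bp \<omega> (dy k u) j\<bar> \<le> 3 * ceps TYPE('p) k"
    using Bp_disc by blast
  have "(\<lambda>k. c * (Cinf_lip * (3 * ceps TYPE('p) k))) \<longlonglongrightarrow> c * (Cinf_lip * (3 * 0))" by (intro tendsto_intros ceps_tendsto)
  then have l: "(\<lambda>k. c * (Cinf_lip * (3 * ceps TYPE('p) k))) \<longlonglongrightarrow> 0" by simp
  have "(\<lambda>k. h (psi k (\<lambda>i. Bp \<omega> (fst (gidx k i)) (snd (gidx k i)))) - h (Cinf_vec P A (Bp \<omega>))) \<longlonglongrightarrow> 0"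
  proof (rule Lim_null_comparison[OF _ l])
    show "\<forall>\<^sub>F k in sequentially. norm (h (psi k (\<lambda>i. Bp \<omega> (fst (gidx k i)) (snd (gidx k i)))) - h (Cinf_vec P A (Bp \<omega>))) \<le> c * (Cinf_lip * (3 * ceps TYPE('p) k))"
      using eventually_ge_at_top[of k0]
    proof eventually_elim
      case (elim k)
      have "\<bar>h (psi k (\<lambda>i. Bp \<omega> (fst (gidx k i)) (snd (gidx k i)))) - h (Cinf_vec P A (Bp \<omega>))\<bar>
        \<le> c * supdist (psi k (\<lambda>i. Bp \<omega> (fst (gidx k i)) (snd (gidx k i)))) (Cinf_vec P A (Bp \<omega>))"
        by (rule L[OF psi_lset Bp_lset])
      also have "\<dots> \<le> c * (Cinf_lip * (3 * ceps TYPE('p) k))"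
        unfolding psi_disc using k0[OF _ elim] by (intro mult_left_mono[OF Cinf_supdist c]) (simp add: abs_minus_commute)
      finally show ?case by simp
    qed
  qed
  then show ?thesis by (simp add: LIM_zero_iff)
qed

lemma hpsi_meas:
  assumes L: "\<And>f g. f \<in> lset \<Longrightarrow> g \<in> lset \<Longrightarrow> \<bar>h f - h g\<bar> \<le> c * supdist f g" and c: "0 \<le> c"
    and Y: "\<And>i. Y i \<in> borel_measurable M"
  shows "(\<lambda>\<omega>. h (psi k (\<lambda>i. Y i \<omega>))) \<in> borel_measurable M"
proof -
  have "(\<lambda>x. h (psi k x)) \<in> borel_measurable borel"
    by (rule borel_measurable_continuous_onI[OF lipschitz_coords_continuous[OF hpsi_lipschitz[OF L c]]])
  moreover have "(\<lambda>\<omega> i. Y i \<omega>) \<in> measurable M borel" using Y by (intro measurable_coordinatewise_then_product) auto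
  ultimately show ?thesis by (rule measurable_compose[rotated])
qed

lemma hCinf_meas:
  assumes L: "\<And>f g. f \<in> lset \<Longrightarrow> g \<in> lset \<Longrightarrow> \<bar>h f - h g\<bar> \<le> c * supdist f g" and c: "0 \<le> c"
  shows "(\<lambda>\<omega>. h (Cinf_vec P A (Bp \<omega>))) \<in> borel_measurable gauss_space"
  by (rule borel_measurable_LIMSEQ_real[OF disc_conv[OF L c] hpsi_meas[OF L c]]) auto

lemma CinfBp_meas: "(\<lambda>\<omega>. Cinf_vec P A (Bp \<omega>)) \<in> measurable gauss_space linf_borel"
proof (rule measurable_linf_borelI[OF Bp_lset])
  fix h :: "(('m \<Rightarrow> real^'p) \<Rightarrow> real^'m) \<Rightarrow> real" and c B
  assume B: "\<And>f. f \<in> lset \<Longrightarrow> \<bar>h f\<bar> \<le> B" and L: "\<And>f g. f \<in> lset \<Longrightarrow> g \<in> lset \<Longrightarrow> \<bar>h f - h g\<bar> \<le> c * supdist f g"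
  \<comment> \<open>The constant supplied here carries no sign, whereas \<open>hCinf_meas\<close>
    wants a nonnegative one.\<close>
  have "\<bar>h f - h g\<bar> \<le> \<bar>c\<bar> * supdist f g" if "f \<in> lset" "g \<in> lset" for f g
    using L[OF that] mult_right_mono[OF abs_ge_self[of c] supdist_nonneg[OF that]] by linarith
  then show "(\<lambda>\<omega>. h (Cinf_vec P A (Bp \<omega>))) \<in> borel_measurable gauss_space" by (rule hCinf_meas) simp_all
qed

end

section \<open>Tightness and weak convergence\<close>

lemma exp_tail_small:
  assumes "0 \<le> N" "0 < (r::real)" shows "\<exists>x. N * (2 * exp (1 - x / 2)) \<le> r"
proof -
  define y where "y = r / (2 * (N + 1))"
  have y: "0 < y" using assms by (simp add: y_def)
  have "(2 * (1 - ln y)) / 2 = 1 - ln y" by (rule nonzero_mult_div_cancel_left) simp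
  then have "1 - (2 * (1 - ln y)) / 2 = 1 - (1 - ln y)" by (simp only:)
  then have "exp (1 - (2 * (1 - ln y)) / 2) = y" using y by simp
  then have "N * (2 * exp (1 - (2 * (1 - ln y)) / 2)) = (2 * N * r) / (2 * (N + 1))" by (simp only: y_def) simp
  also have "\<dots> \<le> r" using assms by (subst pos_divide_le_eq) (auto simp: algebra_simps)
  finally show ?thesis by blast
qed

text \<open>A bounded continuous h is squeezed between the Lipschitz functionals infconv m h and
  - infconv m (- h), which converge to h pointwise.\<close>
lemma linf_weak_conv_lipschitzI:
  fixes Y :: "nat \<Rightarrow> 'a \<Rightarrow> ('m::finite \<Rightarrow> real^'p) \<Rightarrow> real^'m" and \<Psi> :: "'b \<Rightarrow> ('m \<Rightarrow> real^'p) \<Rightarrow> real^'m"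
  assumes M: "prob_space M" and G: "prob_space G" and Y: "\<And>n \<omega>. \<omega> \<in> space M \<Longrightarrow> Y n \<omega> \<in> lset"
    and \<Psi>: "\<Psi> \<in> measurable G linf_borel"
    and lip: "\<And>h c B. 0 \<le> c \<Longrightarrow> (\<And>f. f \<in> lset \<Longrightarrow> \<bar>h f\<bar> \<le> B) \<Longrightarrow>
      (\<And>f g. f \<in> lset \<Longrightarrow> g \<in> lset \<Longrightarrow> \<bar>h f - h g\<bar> \<le> c * supdist f g) \<Longrightarrow>
      (\<lambda>n. outer_exp M (\<lambda>\<omega>. h (Y n \<omega>))) \<longlonglongrightarrow> (\<integral>\<omega>. h (\<Psi> \<omega>) \<partial>G)"
  shows "linf_weak_conv M Y (distr G linf_borel \<Psi>)"
  unfolding linf_weak_conv_def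
proof (intro allI impI)
  fix h :: "(('m \<Rightarrow> real^'p) \<Rightarrow> real^'m) \<Rightarrow> real" assume h: "linf_bcont h"
  interpret M: prob_space M by fact
  interpret G: prob_space G by fact
  obtain B where B: "\<And>f. f \<in> lset \<Longrightarrow> \<bar>h f\<bar> \<le> B" using h unfolding linf_bcont_def by blast
  have \<Psi>l: "\<Psi> \<omega> \<in> lset" if "\<omega> \<in> space G" for \<omega> using measurable_space[OF \<Psi> that] by (simp add: linf_borel_space)
  have low: "\<exists>m. \<bar>(\<integral>\<omega>. infconv (real m) k (\<Psi> \<omega>) \<partial>G) - (\<integral>\<omega>. k (\<Psi> \<omega>) \<partial>G)\<bar> < r"
    if k: "linf_bcont k" "\<And>f. f \<in> lset \<Longrightarrow> \<bar>k f\<bar> \<le> B" and r: "0 < r" for k r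
  proof -
    have [measurable]: "(\<lambda>\<omega>. k (\<Psi> \<omega>)) \<in> borel_measurable G" by (rule measurable_compose[OF \<Psi> linf_bcont_measurable[OF k(1)]])
    have [measurable]: "(\<lambda>\<omega>. infconv (real m) k (\<Psi> \<omega>)) \<in> borel_measurable G" for m
      by (rule measurable_compose[OF \<Psi> linf_bcont_measurable[OF lipschitz_linf_bcont[OF infconv_bound infconv_lipschitz]]]) (auto intro: k)
    have "(\<lambda>m. \<integral>\<omega>. infconv (real m) k (\<Psi> \<omega>) \<partial>G) \<longlonglongrightarrow> (\<integral>\<omega>. k (\<Psi> \<omega>) \<partial>G)"
    proof (rule integral_dominated_convergence[where w="\<lambda>_. B"])
      show "AE \<omega> in G. (\<lambda>m. infconv (real m) k (\<Psi> \<omega>)) \<longlonglongrightarrow> k (\<Psi> \<omega>)"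
        by (intro AE_I2 infconv_tendsto[OF k(1)] \<Psi>l)
      show "AE \<omega> in G. norm (infconv (real m) k (\<Psi> \<omega>)) \<le> B" for m
        unfolding real_norm_def by (intro AE_I2 infconv_bound[OF _ k(2)] \<Psi>l) auto
    qed auto
    from LIMSEQ_D[OF this r] show ?thesis by (metis order_refl real_norm_def)
  qed
  have "(\<lambda>n. outer_exp M (\<lambda>\<omega>. h (Y n \<omega>))) \<longlonglongrightarrow> (\<integral>\<omega>. h (\<Psi> \<omega>) \<partial>G)"
  proof (rule LIMSEQ_I)
    fix r :: real assume r: "0 < r"
    obtain m1 where m1: "\<bar>(\<integral>\<omega>. infconv (real m1) h (\<Psi> \<omega>) \<partial>G) - (\<integral>\<omega>. h (\<Psi> \<omega>) \<partial>G)\<bar> < r/2"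
      using low[OF h B, of "r/2"] r by auto
    define h' where "h' f = - h f" for f
    have h': "linf_bcont h'" "\<And>f. f \<in> lset \<Longrightarrow> \<bar>h' f\<bar> \<le> B" unfolding h'_def[abs_def] using linf_bcont_uminus[OF h] B by auto
    obtain m2 where m2: "\<bar>(\<integral>\<omega>. infconv (real m2) h' (\<Psi> \<omega>) \<partial>G) - (\<integral>\<omega>. h' (\<Psi> \<omega>) \<partial>G)\<bar> < r/2"
      using low[OF h', of "r/2"] r by auto
    have c1: "(\<lambda>n. outer_exp M (\<lambda>\<omega>. infconv (real m1) h (Y n \<omega>))) \<longlonglongrightarrow> (\<integral>\<omega>. infconv (real m1) h (\<Psi> \<omega>) \<partial>G)"
      by (rule lip[of "real m1" _ B]) (auto intro!: infconv_bound infconv_lipschitz B)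
    have c2: "(\<lambda>n. outer_exp M (\<lambda>\<omega>. - infconv (real m2) h' (Y n \<omega>))) \<longlonglongrightarrow> (\<integral>\<omega>. - infconv (real m2) h' (\<Psi> \<omega>) \<partial>G)"
    proof (rule lip[of "real m2" _ B])
      show "\<bar>- infconv (real m2) h' f\<bar> \<le> B" if "f \<in> lset" for f using infconv_bound[where c="real m2" and h=h' and B=B, OF _ h'(2) that] by simp
      show "\<bar>- infconv (real m2) h' f - - infconv (real m2) h' g\<bar> \<le> real m2 * supdist f g" if "f \<in> lset" "g \<in> lset" for f g
        using infconv_lipschitz[where c="real m2" and h=h' and B=B, OF _ h'(2) that] by (simp add: abs_minus_commute)
    qed simp
    have e1: "\<forall>\<^sub>F n in sequentially. outer_exp M (\<lambda>\<omega>. infconv (real m1) h (Y n \<omega>)) > (\<integral>\<omega>. h (\<Psi> \<omega>) \<partial>G) - r"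
      using m1 r by (intro order_tendstoD(1)[OF c1]) linarith
    have e2: "\<forall>\<^sub>F n in sequentially. outer_exp M (\<lambda>\<omega>. - infconv (real m2) h' (Y n \<omega>)) < (\<integral>\<omega>. h (\<Psi> \<omega>) \<partial>G) + r"
    proof (rule order_tendstoD(2)[OF c2])
      have i1: "(\<integral>\<omega>. - infconv (real m2) h' (\<Psi> \<omega>) \<partial>G) = - (\<integral>\<omega>. infconv (real m2) h' (\<Psi> \<omega>) \<partial>G)"
        and i2: "(\<integral>\<omega>. h' (\<Psi> \<omega>) \<partial>G) = - (\<integral>\<omega>. h (\<Psi> \<omega>) \<partial>G)" by (simp_all add: h'_def)
      show "(\<integral>\<omega>. - infconv (real m2) h' (\<Psi> \<omega>) \<partial>G) < (\<integral>\<omega>. h (\<Psi> \<omega>) \<partial>G) + r"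
        using m2 r unfolding i1 i2 by linarith
    qed
    have "\<forall>\<^sub>F n in sequentially. norm (outer_exp M (\<lambda>\<omega>. h (Y n \<omega>)) - (\<integral>\<omega>. h (\<Psi> \<omega>) \<partial>G)) < r"
      using e1 e2
    proof eventually_elim
      case (elim n)
      have "outer_exp M (\<lambda>\<omega>. infconv (real m1) h (Y n \<omega>)) \<le> outer_exp M (\<lambda>\<omega>. h (Y n \<omega>))"
        by (rule M.outer_exp_mono[where B=B]) (auto intro!: infconv_le_self infconv_bound B Y)
      moreover have "outer_exp M (\<lambda>\<omega>. h (Y n \<omega>)) \<le> outer_exp M (\<lambda>\<omega>. - infconv (real m2) h' (Y n \<omega>))"
      proof (rule M.outer_exp_mono[where B=B])
        fix \<omega> assume "\<omega> \<in> space M"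
        then have y: "Y n \<omega> \<in> lset" by (rule Y)
        show "h (Y n \<omega>) \<le> - infconv (real m2) h' (Y n \<omega>)" using infconv_le_self[where c="real m2" and h=h' and B=B, OF _ h'(2) y] by (simp add: h'_def)
        show "\<bar>h (Y n \<omega>)\<bar> \<le> B" by (rule B[OF y])
        show "\<bar>- infconv (real m2) h' (Y n \<omega>)\<bar> \<le> B" using infconv_bound[where c="real m2" and h=h' and B=B, OF _ h'(2) y] by simp
      qed
      ultimately show ?case using elim by simp
    qed
    then show "\<exists>no. \<forall>n\<ge>no. norm (outer_exp M (\<lambda>\<omega>. h (Y n \<omega>)) - (\<integral>\<omega>. h (\<Psi> \<omega>) \<partial>G)) < r" by (simp add: eventually_sequentially)
  qed
  then show "(\<lambda>n. outer_exp M (\<lambda>\<omega>. h (Y n \<omega>))) \<longlonglongrightarrow> integral\<^sup>L (distr G linf_borel \<Psi>) h"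
    using \<Psi> linf_bcont_measurable[OF h] by (simp add: integral_distr)
qed

context cond_law
begin

text \<open>A uniformly bounded family with a common modulus of continuity, in the form in which the
  chaining delivers it.\<close>

definition path_class :: "real \<Rightarrow> nat \<Rightarrow> (real^'p \<Rightarrow> 'm \<Rightarrow> real) set" where
  "path_class R k0 = {B. (\<forall>j. \<forall>u\<in>unit_cube. \<bar>B u j\<bar> \<le> R) \<and> (\<forall>j. \<forall>k\<ge>k0. \<forall>u\<in>unit_cube. \<forall>v\<in>unit_cube.
     (\<forall>i. \<bar>u$i - v$i\<bar> \<le> 1 / 2^k) \<longrightarrow> \<bar>B u j - B v j\<bar> \<le> 3 * ceps TYPE('p) k)}"

lemma path_class_bounded: "B \<in> path_class R k0 \<Longrightarrow> \<exists>C. \<forall>u\<in>unit_cube. \<bar>B u j\<bar> \<le> C"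
  unfolding path_class_def by blast

text \<open>Arzela-Ascoli is applied to the paths B and not to their images, which need not be
  continuous in u. The bounds defining the class survive uniform limits, and the Lipschitz limit map
  carries the convergence over.\<close>

lemma path_class_compact: "linf_compact (Cinf_vec P A ` path_class R k0)"
  unfolding linf_compact_def
proof (intro conjI allI impI)
  show "Cinf_vec P A ` path_class R k0 \<subseteq> lset"
  proof
    fix f assume "f \<in> Cinf_vec P A ` path_class R k0"
    then obtain B where "f = Cinf_vec P A B" "B \<in> path_class R k0" by blast
    then show "f \<in> lset" using Cinf_lset[OF path_class_bounded] by simp
  qed
  fix s :: "nat \<Rightarrow> ('m \<Rightarrow> real^'p) \<Rightarrow> real^'m" assume "\<forall>n. s n \<in> Cinf_vec P A ` path_class R k0"
  then have "\<forall>n. \<exists>B. B \<in> path_class R k0 \<and> s n = Cinf_vec P A B" by blast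
  then obtain B where B: "\<And>n. B n \<in> path_class R k0" "\<And>n. s n = Cinf_vec P A (B n)" by metis
  define F where "F n u = (\<chi> j. B n u j)" for n u
  have bd: "\<bar>B n u j\<bar> \<le> R" if "u \<in> unit_cube" for n u j using B(1)[of n] that by (auto simp: path_class_def)
  have md: "\<bar>B n u j - B n v j\<bar> \<le> 3 * ceps TYPE('p) k" if "k0 \<le> k" "u \<in> unit_cube" "v \<in> unit_cube" "\<And>i. \<bar>u$i - v$i\<bar> \<le> 1 / 2^k" for n u v j k
    using B(1)[of n] that unfolding path_class_def by blast
  obtain g r where gr: "continuous_on unit_cube g" "strict_mono (r :: nat \<Rightarrow> nat)"
    "\<And>e. 0 < e \<Longrightarrow> \<exists>N. \<forall>n x. n \<ge> N \<and> x \<in> unit_cube \<longrightarrow> norm (F (r n) x - g x) < e"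
  proof (rule Arzela_Ascoli[OF compact_unit_cube, of F "real CARD('m) * R"])
    show "norm (F n u) \<le> real CARD('m) * R" if "u \<in> unit_cube" for n u
    proof -
      have "norm (F n u) \<le> (\<Sum>j\<in>UNIV. \<bar>F n u $ j\<bar>)" by (rule norm_le_l1_cart)
      also have "\<dots> \<le> (\<Sum>j\<in>(UNIV::'m set). R)" using bd[OF that] by (intro sum_mono) (simp add: F_def)
      finally show ?thesis by simp
    qed
    fix x :: "real^'p" and e :: real assume x: "x \<in> unit_cube" and e: "0 < e"
    have "(\<lambda>k. real CARD('m) * (3 * ceps TYPE('p) k)) \<longlonglongrightarrow> real CARD('m) * (3 * 0)" by (intro tendsto_intros ceps_tendsto)
    then have "\<forall>\<^sub>F k in sequentially. real CARD('m) * (3 * ceps TYPE('p) k) < e \<and> k0 \<le> k"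
      using e by (intro eventually_conj order_tendstoD(2) eventually_ge_at_top) auto
    then obtain k where k: "real CARD('m) * (3 * ceps TYPE('p) k) < e" "k0 \<le> k" by (auto simp: eventually_sequentially)
    have "norm (F n x - F n y) < e" if y: "y \<in> unit_cube" "norm (x - y) < 1 / 2^k" for n y
    proof -
      have "\<bar>x$i - y$i\<bar> \<le> 1 / 2^k" for i using component_le_norm_cart[of "x - y" i] y by simp
      then have m: "\<bar>B n x j - B n y j\<bar> \<le> 3 * ceps TYPE('p) k" for j by (intro md k x y)
      have "norm (F n x - F n y) \<le> (\<Sum>j\<in>UNIV. \<bar>(F n x - F n y) $ j\<bar>)" by (rule norm_le_l1_cart)
      also have "\<dots> \<le> (\<Sum>j\<in>(UNIV::'m set). 3 * ceps TYPE('p) k)" using m by (intro sum_mono) (simp add: F_def)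
      finally show ?thesis using k by simp
    qed
    then show "\<exists>d>0. \<forall>n y. y \<in> unit_cube \<and> norm (x - y) < d \<longrightarrow> norm (F n x - F n y) < e"
      by (intro exI[of _ "1 / 2^k"]) auto
  qed blast
  define B' where "B' u j = g u $ j" for u j
  have uc: "\<exists>N. \<forall>n\<ge>N. \<forall>u\<in>unit_cube. \<forall>j. \<bar>B (r n) u j - B' u j\<bar> < e" if e: "0 < e" for e
  proof -
    obtain N where N: "\<And>n x. n \<ge> N \<Longrightarrow> x \<in> unit_cube \<Longrightarrow> norm (F (r n) x - g x) < e" using gr(3)[OF e] by blast
    have "\<bar>B (r n) u j - B' u j\<bar> < e" if "n \<ge> N" "u \<in> unit_cube" for n u j
      using component_le_norm_cart[of "F (r n) u - g u" j] N[OF that] by (simp add: F_def B'_def)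
    then show ?thesis by blast
  qed
  have pt: "(\<lambda>n. B (r n) u j) \<longlonglongrightarrow> B' u j" if "u \<in> unit_cube" for u j
    by (rule LIMSEQ_I) (use uc that in \<open>force\<close>)
  have "B' \<in> path_class R k0"
    unfolding path_class_def
  proof (intro CollectI conjI allI ballI impI)
    show "\<bar>B' u j\<bar> \<le> R" if "u \<in> unit_cube" for u j
      by (rule tendsto_upperbound[OF tendsto_rabs[OF pt[OF that]]]) (simp_all add: bd[OF that])
    show "\<bar>B' u j - B' v j\<bar> \<le> 3 * ceps TYPE('p) k" if "k0 \<le> k" "u \<in> unit_cube" "v \<in> unit_cube" "\<forall>i. \<bar>u$i - v$i\<bar> \<le> 1 / 2^k" for u v j k
    proof -
      have "\<bar>B n u j - B n v j\<bar> \<le> 3 * ceps TYPE('p) k" for n using that by (intro md) auto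
      then show ?thesis
        by (intro tendsto_upperbound[OF tendsto_rabs[OF tendsto_diff[OF pt[OF that(2)] pt[OF that(3)]]]]) simp_all
    qed
  qed
  moreover have "(\<lambda>n. supdist (s (r n)) (Cinf_vec P A B')) \<longlonglongrightarrow> 0"
  proof (rule LIMSEQ_I)
    fix e :: real assume e: "0 < e"
    have L: "0 < Cinf_lip + 1" using Cinf_lip_nonneg by simp
    obtain N where N: "\<And>n u j. n \<ge> N \<Longrightarrow> u \<in> unit_cube \<Longrightarrow> \<bar>B (r n) u j - B' u j\<bar> < e / (Cinf_lip + 1)"
      using uc[of "e / (Cinf_lip + 1)"] e L by auto
    have "norm (supdist (s (r n)) (Cinf_vec P A B') - 0) < e" if "n \<ge> N" for n
    proof -
      have "supdist (s (r n)) (Cinf_vec P A B') \<le> Cinf_lip * (e / (Cinf_lip + 1))"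
        unfolding B(2) using N[OF that] by (intro Cinf_supdist) (simp add: less_imp_le)
      also have "\<dots> < e" using e L by (simp add: pos_divide_less_eq mult.commute distrib_left)
      finally have "supdist (s (r n)) (Cinf_vec P A B') < e" .
      moreover have "0 \<le> supdist (s (r n)) (Cinf_vec P A B')"
        unfolding B(2) by (intro supdist_nonneg Cinf_lset path_class_bounded[OF B(1)] path_class_bounded[OF \<open>B' \<in> path_class R k0\<close>])
      ultimately show ?thesis by simp
    qed
    then show "\<exists>no. \<forall>n\<ge>no. norm (supdist (s (r n)) (Cinf_vec P A B') - 0) < e" by blast
  qed
  ultimately show "\<exists>(r::nat \<Rightarrow> nat) g. strict_mono r \<and> g \<in> Cinf_vec P A ` path_class R k0 \<and> (\<lambda>n. supdist (s (r n)) g) \<longlonglongrightarrow> 0"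
    using gr(2) by blast
qed

lemma limit_tight: "linf_tight (distr gauss_space linf_borel (\<lambda>\<omega>. Cinf_vec P A (Bp \<omega>)))"
  unfolding linf_tight_def
proof (intro allI impI)
  fix e :: real assume e: "0 < e"
  interpret G: prob_space gauss_space by (rule prob_space_gauss)
  have "\<forall>\<^sub>F k in sequentially. ceta cbad k < e/2" using e by (intro order_tendstoD(2)[OF ceta_tendsto]) auto
  then obtain k0 where k0: "ceta cbad k0 < e/2" by (auto simp: eventually_sequentially)
  let ?I = "(grid k0 :: (real^'p) set) \<times> (UNIV :: 'm set)"
  obtain x where x: "real (card ?I) * (2 * exp (1 - x / 2)) \<le> e/2" using exp_tail_small[of "real (card ?I)" "e/2"] e by auto
  let ?B = "\<Union>i. bad gauss_space bq (i + k0)"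
  let ?T = "\<lambda>s. {\<omega>\<in>space gauss_space. \<bar>bq (fst s) (snd s) \<omega>\<bar> > x}"
  \<comment> \<open>The radius combines x, a bound for the values on the grid of level k0, with
    \<open>ceps\<close>, the oscillation beyond that level.\<close>
  let ?S = "Cinf_vec P A ` path_class (x + ceps TYPE('p) k0) k0"
  have bb: "G.prob (bad gauss_space bq (i + k0)) \<le> cbad * exp (- real (Suc (i + k0)))" for i by (rule bq_bad)
  have s2: "summable (\<lambda>i. cbad * exp (- real (Suc (i + k0))))" by (rule summable_ignore_initial_segment[OF summable_exp_neg])
  have sm: "summable (\<lambda>i. G.prob (bad gauss_space bq (i + k0)))"
    by (rule summable_comparison_test'[OF s2, of 0]) (simp only: real_norm_def abs_of_nonneg[OF measure_nonneg] bb)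
  have "G.prob ?B \<le> (\<Sum>i. G.prob (bad gauss_space bq (i + k0)))"
    using bq_bad(1) sm by (intro G.finite_measure_subadditive_countably) auto
  also have "\<dots> \<le> ceta cbad k0" unfolding ceta_def
    by (rule suminf_le[OF bb sm s2])
  finally have PB: "G.prob ?B \<le> e/2" using k0 by simp
  have "G.prob (\<Union>s\<in>?I. ?T s) \<le> (\<Sum>s\<in>?I. G.prob (?T s))" using gfin by (intro measure_UNION_le) auto
  also have "\<dots> \<le> (\<Sum>s\<in>?I. 2 * exp (1 - x / 2))" by (intro sum_mono bq_tail) auto
  finally have PT: "G.prob (\<Union>s\<in>?I. ?T s) \<le> e/2" using x by simp
  have sB: "?B \<in> sets gauss_space" using bq_bad(1) by auto
  have sT: "(\<Union>s\<in>?I. ?T s) \<in> sets gauss_space" using gfin by (intro sets.finite_UN) auto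
  have PU: "G.prob (?B \<union> (\<Union>s\<in>?I. ?T s)) \<le> e" using measure_Un_le[OF sB sT] PB PT by linarith
  have in_S: "Cinf_vec P A (Bp \<omega>) \<in> ?S" if w: "\<omega> \<in> space gauss_space - (?B \<union> (\<Union>s\<in>?I. ?T s))" for \<omega>
  proof -
    have t: "tame (\<lambda>u. bq u j \<omega>) k" if "k0 \<le> k" for k j
    proof -
      have "\<omega> \<notin> bad gauss_space bq ((k - k0) + k0)" using w by blast
      then show ?thesis using w that by (simp add: bad_iff)
    qed
    then have n: "nice \<omega>" unfolding nice_def by blast
    have gb: "\<bar>bq v j \<omega>\<bar> \<le> x" if "v \<in> grid k0" for v j using w that by (auto simp: not_less)
    have "Bp \<omega> \<in> path_class (x + ceps TYPE('p) k0) k0"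
      unfolding path_class_def
    proof (intro CollectI conjI allI ballI impI)
      fix j and u :: "real^'p" assume u: "u \<in> unit_cube"
      have "\<bar>Bp \<omega> u j - bq (dy k0 u) j \<omega>\<bar> \<le> ceps TYPE('p) k0"
        using tame_limit(2)[where f="\<lambda>u. bq u j \<omega>", OF t u order_refl] n by (simp add: Bp_def)
      then show "\<bar>Bp \<omega> u j\<bar> \<le> x + ceps TYPE('p) k0" using gb[OF dy_grid[OF u], of j] by linarith
    next
      fix j k and u v :: "real^'p" assume "k0 \<le> k" "u \<in> unit_cube" "v \<in> unit_cube" "\<forall>i. \<bar>u$i - v$i\<bar> \<le> 1 / 2^k"
      then have "\<bar>lim (\<lambda>k. bq (dy k u) j \<omega>) - lim (\<lambda>k. bq (dy k v) j \<omega>)\<bar> \<le> 3 * ceps TYPE('p) k"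
        by (intro tame_limit_modulus[where f="\<lambda>u. bq u j \<omega>", OF t]) auto
      then show "\<bar>Bp \<omega> u j - Bp \<omega> v j\<bar> \<le> 3 * ceps TYPE('p) k" using n by (simp add: Bp_def)
    qed
    then show ?thesis by blast
  qed
  have Ss: "?S \<in> sets linf_borel" by (rule linf_compact_sets[OF path_class_compact])
  have "1 - e \<le> G.prob (space gauss_space - (?B \<union> (\<Union>s\<in>?I. ?T s)))"
    using PU sB sT by (subst G.prob_compl) auto
  also have "\<dots> \<le> G.prob ((\<lambda>\<omega>. Cinf_vec P A (Bp \<omega>)) -` ?S \<inter> space gauss_space)"
    using in_S measurable_sets[OF CinfBp_meas Ss] by (intro G.finite_measure_mono) auto
  also have "\<dots> = measure (distr gauss_space linf_borel (\<lambda>\<omega>. Cinf_vec P A (Bp \<omega>))) ?S"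
    by (rule measure_distr[OF CinfBp_meas Ss, symmetric])
  finally show "\<exists>S. linf_compact S \<and> S \<in> sets (distr gauss_space linf_borel (\<lambda>\<omega>. Cinf_vec P A (Bp \<omega>))) \<and>
      1 - e \<le> measure (distr gauss_space linf_borel (\<lambda>\<omega>. Cinf_vec P A (Bp \<omega>))) S"
    using path_class_compact Ss by (intro exI[of _ ?S]) simp
qed

text \<open>The law of B lives on bounded paths, with the largest sigma-algebra that makes the path map
  Bp measurable; functionals of B are then measurable as soon as their composition with Bp is.\<close>
definition path_alg :: "(real^'p \<Rightarrow> 'm \<Rightarrow> real) measure" where
  "path_alg = sigma {B. \<forall>j. \<exists>C. \<forall>u\<in>unit_cube. \<bar>B u j\<bar> \<le> C}
     {S. S \<subseteq> {B. \<forall>j. \<exists>C. \<forall>u\<in>unit_cube. \<bar>B u j\<bar> \<le> C} \<and> Bp -` S \<inter> space gauss_space \<in> sets gauss_space}"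

definition limit_law :: "(real^'p \<Rightarrow> 'm \<Rightarrow> real) measure" where "limit_law = distr gauss_space path_alg Bp"

lemma path_space: "space path_alg = {B. \<forall>j. \<exists>C. \<forall>u\<in>unit_cube. \<bar>B u j\<bar> \<le> C}"
  unfolding path_alg_def by (rule space_measure_of) auto

lemma path_sets: "S \<subseteq> space path_alg \<Longrightarrow> Bp -` S \<inter> space gauss_space \<in> sets gauss_space \<Longrightarrow> S \<in> sets path_alg"
  unfolding path_space unfolding path_alg_def by (subst sets_measure_of) auto

lemma Bp_path: "Bp \<in> measurable gauss_space path_alg"
proof -
  have "Bp \<omega> \<in> space path_alg" for \<omega> unfolding path_space using Bp_bounded by blast
  then show ?thesis unfolding path_space unfolding path_alg_def by (intro measurable_measure_of) auto
qed

lemma path_measurableI: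
  assumes "\<And>B. B \<in> space path_alg \<Longrightarrow> \<phi> B \<in> space K" and m: "(\<lambda>\<omega>. \<phi> (Bp \<omega>)) \<in> measurable gauss_space K"
  shows "\<phi> \<in> measurable path_alg K"
proof (rule measurableI[OF assms(1)])
  fix T assume T: "T \<in> sets K"
  show "\<phi> -` T \<inter> space path_alg \<in> sets path_alg"
  proof (rule path_sets)
    have "Bp -` (\<phi> -` T \<inter> space path_alg) \<inter> space gauss_space = (\<lambda>\<omega>. \<phi> (Bp \<omega>)) -` T \<inter> space gauss_space"
      using measurable_space[OF Bp_path] by auto
    then show "Bp -` (\<phi> -` T \<inter> space path_alg) \<inter> space gauss_space \<in> sets gauss_space" using measurable_sets[OF m T] by simp
  qed auto
qed

lemma limit_law_distr: "\<phi> \<in> measurable path_alg K \<Longrightarrow> distr limit_law K \<phi> = distr gauss_space K (\<lambda>\<omega>. \<phi> (Bp \<omega>))"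
  unfolding limit_law_def using Bp_path by (subst distr_distr) (auto simp: comp_def)

lemma limit_law_sets: "sets limit_law = sets path_alg" "space limit_law = space path_alg"
  by (simp_all add: limit_law_def)

lemma eval_path: "(\<lambda>B. B u j) \<in> borel_measurable path_alg"
  by (rule path_measurableI) (auto intro: Bp_meas)

lemma limit_law_gaussian: "gaussian_B P A limit_law"
  unfolding gaussian_B_def
proof (intro conjI ballI allI impI)
  show "prob_space limit_law" unfolding limit_law_def by (rule prob_space.prob_space_distr[OF prob_space_gauss Bp_path])
  show "(\<lambda>B. B u j) \<in> borel_measurable limit_law" for u j
    using eval_path by (simp add: measurable_cong_sets[OF limit_law_sets(1) refl])
  fix I :: "((real^'p) \<times> 'm) set" and c t assume I: "finite I \<and> I \<subseteq> unit_cube \<times> UNIV"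
  have "(\<lambda>B. \<Sum>s\<in>I. c s * B (fst s) (snd s)) \<in> borel_measurable path_alg" using eval_path by measurable
  note m = limit_law_distr[OF this]
  show "char (distr limit_law borel (\<lambda>B. \<Sum>s\<in>I. c s * B (fst s) (snd s))) t =
             exp (- complex_of_real (t\<^sup>2 * (\<Sum>s\<in>I. \<Sum>s'\<in>I. c s * c s' * Gam P A s s') / 2))"
    unfolding m by (rule Bp_char[where f="\<lambda>s. s"]) (use I in auto)
qed

lemma Cinf_path: "Cinf_vec P A \<in> measurable path_alg linf_borel"
  by (rule path_measurableI[OF _ CinfBp_meas]) (auto simp: linf_borel_space path_space intro!: Cinf_lset)

end

section \<open>Weak convergence of the copula process\<close>

context emp_sample
begin

text \<open>A crude bound depending on n is enough: the count in the numerator is at most n, and a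
  zero denominator yields 0. It places the process in \<open>lset\<close> for every \<omega>, where
  the test functionals are controlled.\<close>

lemma Cn_lset: "Cn_vec P A Xs Zs n \<omega> \<in> lset"
proof -
  have cb: "\<bar>Cbar Xs Zs n (A j) \<omega> u\<bar> \<le> real n" for j u
  proof -
    define a where "a = card {i. i < n \<and> (\<forall>k. ereal (Xs i \<omega> $ k) \<le> ginv (Fn Xs Zs n (A j) k \<omega>) (u $ k)) \<and> Zs i \<omega> \<in> A j}"
    define b where "b = card {i. i < n \<and> Zs i \<omega> \<in> A j}"
    have "Cbar Xs Zs n (A j) \<omega> u = real a / (real n * (real b / real n))"
      unfolding Cbar_def phat_def sum_if_card a_def b_def ..
    then have e: "Cbar Xs Zs n (A j) \<omega> u = (if n = 0 then 0 else real a / real b)" by simp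
    have "a \<le> card {..<n}" unfolding a_def by (intro card_mono) auto
    then have an: "real a \<le> real n" by simp
    have "real a / real b \<le> real a" by (cases "b = 0") (auto simp: divide_le_eq mult_le_cancel_left1)
    then show ?thesis unfolding e using an by auto
  qed
  have cc: "\<bar>Ccop P (A j) u\<bar> \<le> 1" for j u
    using D_bounds[of j u] pA_pos[of j] by (simp add: Ccop_def)
  have "norm (Cn_vec P A Xs Zs n \<omega> uv) \<le> (\<Sum>j\<in>(UNIV::'m set). sqrt (real n) * (real n + 1))" if uv: "uv \<in> Tset" for uv
  proof -
    have "norm (Cn_vec P A Xs Zs n \<omega> uv) \<le> (\<Sum>j\<in>UNIV. \<bar>Cn_vec P A Xs Zs n \<omega> uv $ j\<bar>)" by (rule norm_le_l1_cart)
    also have "\<dots> \<le> (\<Sum>j\<in>(UNIV::'m set). sqrt (real n) * (real n + 1))"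
    proof (rule sum_mono)
      fix j
      have "\<bar>Cbar Xs Zs n (A j) \<omega> (uv j) - Ccop P (A j) (uv j)\<bar> \<le> real n + 1"
        using cb[of j "uv j"] cc[of j "uv j"] by linarith
      then show "\<bar>Cn_vec P A Xs Zs n \<omega> uv $ j\<bar> \<le> sqrt (real n) * (real n + 1)"
        using uv by (simp add: Cn_vec_def abs_mult mult_left_mono)
    qed
    finally show ?thesis .
  qed
  then show ?thesis unfolding lset_def by (auto simp: Cn_vec_def intro!: boundedI)
qed

lemma Gn_findim:
  assumes B: "\<And>f. f \<in> lset \<Longrightarrow> \<bar>h f\<bar> \<le> B" and L: "\<And>f g. f \<in> lset \<Longrightarrow> g \<in> lset \<Longrightarrow> \<bar>h f - h g\<bar> \<le> c * supdist f g" and c: "0 \<le> c"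
  shows "(\<lambda>n. \<integral>\<omega>. h (psi k (\<lambda>i. Gn n (fst (gidx k i)) (snd (gidx k i)) \<omega>)) \<partial>M)
    \<longlonglongrightarrow> (\<integral>\<omega>. h (psi k (\<lambda>i. Bp \<omega> (fst (gidx k i)) (snd (gidx k i)))) \<partial>gauss_space)"
proof (rule findim_conv[OF prob_M prob_space_gauss, where d="gnum k" and B=B and L="c * Cinf_lip" and \<phi>="\<lambda>x. h (psi k x)"
      and Y="\<lambda>n i. Gn n (fst (gidx k i)) (snd (gidx k i))" and Y'="\<lambda>i \<omega>. Bp \<omega> (fst (gidx k i)) (snd (gidx k i))"])
  fix t :: "nat \<Rightarrow> real"
  let ?S = "\<lambda>n \<omega>. \<Sum>i<gnum k. t i * Gn n (fst (gidx k i)) (snd (gidx k i)) \<omega>"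
  let ?S' = "\<lambda>\<omega>. \<Sum>i<gnum k. t i * Bp \<omega> (fst (gidx k i)) (snd (gidx k i))"
  have m: "?S n \<in> borel_measurable M" "?S' \<in> borel_measurable gauss_space" for n by measurable
  have "(\<lambda>n. char (distr M borel (?S n)) 1) \<longlonglongrightarrow> char (distr gauss_space borel ?S') 1"
    using Gn_comb_char[where d="gnum k" and t=t and s="gidx k"] Bp_char[where I="{..<gnum k}" and f="gidx k" and c=t and t=1] gidx_cube by simp
  moreover have "char (distr M borel (?S n)) 1 = (\<integral>\<omega>. iexp (?S n \<omega>) \<partial>M)" for n
    unfolding char_def by (subst integral_distr[OF m(1)]) auto
  moreover have "char (distr gauss_space borel ?S') 1 = (\<integral>\<omega>. iexp (?S' \<omega>) \<partial>gauss_space)"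
    unfolding char_def by (subst integral_distr[OF m(2)]) auto
  ultimately show "(\<lambda>n. \<integral>\<omega>. iexp (?S n \<omega>) \<partial>M) \<longlonglongrightarrow> (\<integral>\<omega>. iexp (?S' \<omega>) \<partial>gauss_space)"
    by (simp only:)
qed (auto intro: B psi_lset hpsi_lipschitz[OF L c])

text \<open>The parameters are chosen in the order in which they depend on each other: K from
  \<eta>, then the tolerance from K and \<epsilon> (the minimum over the finitely many j, and e2),
  then \<delta> from \<open>Gn_good_event\<close>, and n0 last.\<close>

lemma approx_event:
  assumes eta: "0 < \<eta>" and eps: "0 < \<epsilon>" "0 < e2"
  obtains \<delta> n0 where "0 < \<delta>" "\<And>n. n \<ge> n0 \<Longrightarrow> \<exists>E\<in>sets M. M.prob E \<le> \<eta> \<and> (\<forall>\<omega>\<in>space M - E.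
      (\<forall>j. \<exists>C. \<forall>u\<in>unit_cube. \<bar>Gn n u j \<omega>\<bar> \<le> C) \<and>
      supdist (Cn_vec P A Xs Zs n \<omega>) (Cinf_vec P A (\<lambda>u j. Gn n u j \<omega>)) \<le> \<epsilon> \<and>
      (\<forall>j. \<forall>u\<in>unit_cube. \<forall>v\<in>unit_cube. (\<forall>i. \<bar>u$i - v$i\<bar> \<le> \<delta>) \<longrightarrow> \<bar>Gn n u j \<omega> - Gn n v j \<omega>\<bar> \<le> e2))"
proof -
  let ?m = "real CARD('m)"
  have em: "0 < \<epsilon> / ?m" using eps by simp
  obtain K where K: "K > 0" and ge: "\<And>\<epsilon>. \<epsilon> > 0 \<Longrightarrow> \<exists>\<delta>>0. \<exists>n0. \<forall>n\<ge>n0. \<exists>E\<in>sets M. M.prob E \<le> \<eta> \<and>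
    (\<forall>\<omega>\<in>space M - E. (\<forall>j. \<forall>u\<in>unit_cube. \<bar>Gn n u j \<omega>\<bar> \<le> K) \<and>
      (\<forall>j. \<forall>u\<in>unit_cube. \<forall>v\<in>unit_cube. (\<forall>i. \<bar>u$i - v$i\<bar> \<le> \<delta>) \<longrightarrow> \<bar>Gn n u j \<omega> - Gn n v j \<omega>\<bar> \<le> \<epsilon>))"
    using Gn_good_event[OF eta] by blast
  define Q where "Q j e \<delta> n0 \<longleftrightarrow> (\<forall>n\<ge>n0. \<forall>\<omega>. good \<omega> \<longrightarrow> (\<forall>u\<in>unit_cube. \<bar>Gn n u j \<omega>\<bar> \<le> K) \<longrightarrow>
    (\<forall>u\<in>unit_cube. \<forall>v\<in>unit_cube. (\<forall>i. \<bar>u$i - v$i\<bar> \<le> \<delta>) \<longrightarrow> \<bar>Gn n u j \<omega> - Gn n v j \<omega>\<bar> \<le> e) \<longrightarrow>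
    (\<forall>u\<in>unit_cube. \<bar>sqrt (real n) * (Cbar Xs Zs n (A j) \<omega> u - Ccop P (A j) u) - Lop j (\<lambda>u. Gn n u j \<omega>) u\<bar> \<le> \<epsilon> / ?m))" for j e \<delta> n0
  have "\<forall>j. \<exists>e>0. \<forall>\<delta>>0. \<exists>n0. Q j e \<delta> n0" unfolding Q_def using delta_estimate[OF K em] by blast
  then obtain ej where ej: "\<And>j. ej j > 0" "\<And>j \<delta>. \<delta> > 0 \<Longrightarrow> \<exists>n0. Q j (ej j) \<delta> n0" by metis
  define e where "e = min e2 (Min (range ej))"
  have "Min (range ej) > 0" using ej(1) by (subst Min_gr_iff) auto
  then have e: "e > 0" "e \<le> e2" "\<And>j. e \<le> ej j" using eps by (auto simp: e_def min_le_iff_disj)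
  obtain \<delta> n1 where \<delta>: "\<delta> > 0" and n1: "\<And>n. n \<ge> n1 \<Longrightarrow> \<exists>E\<in>sets M. M.prob E \<le> \<eta> \<and>
    (\<forall>\<omega>\<in>space M - E. (\<forall>j. \<forall>u\<in>unit_cube. \<bar>Gn n u j \<omega>\<bar> \<le> K) \<and>
      (\<forall>j. \<forall>u\<in>unit_cube. \<forall>v\<in>unit_cube. (\<forall>i. \<bar>u$i - v$i\<bar> \<le> \<delta>) \<longrightarrow> \<bar>Gn n u j \<omega> - Gn n v j \<omega>\<bar> \<le> e))"
    using ge[OF e(1)] by blast
  obtain nj where nj: "\<And>j. Q j (ej j) \<delta> (nj j)" using ej(2)[OF \<delta>] by metis
  define n0 where "n0 = max n1 (Max (range nj))"
  have njn: "nj j \<le> n0" for j by (auto simp: n0_def le_max_iff_disj)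
  \<comment> \<open>Measurability of \<open>good\<close> is not established, so its exceptional set
    is enclosed in a null set.\<close>
  obtain N0 where N0: "N0 \<in> null_sets M" "{\<omega>\<in>space M. \<not> good \<omega>} \<subseteq> N0"
    using AE_good_sample by (auto elim!: AE_E simp: null_sets_def)
  show ?thesis
  proof (rule that[OF \<delta>, of n0])
    fix n assume n: "n \<ge> n0"
    then have "n \<ge> n1" by (simp add: n0_def)
    from n1[OF this] obtain E where E: "E \<in> sets M" "M.prob E \<le> \<eta>"
      and Eb: "\<And>\<omega> j u. \<omega> \<in> space M - E \<Longrightarrow> u \<in> unit_cube \<Longrightarrow> \<bar>Gn n u j \<omega>\<bar> \<le> K"
      and Em: "\<And>\<omega> j u v. \<omega> \<in> space M - E \<Longrightarrow> u \<in> unit_cube \<Longrightarrow> v \<in> unit_cube \<Longrightarrow> (\<And>i. \<bar>u$i - v$i\<bar> \<le> \<delta>) \<Longrightarrow> \<bar>Gn n u j \<omega> - Gn n v j \<omega>\<bar> \<le> e"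
      by blast
    have "M.prob (E \<union> N0) \<le> \<eta>" using E N0(1) by (simp add: measure_Un_null_set)
    moreover have "(\<forall>j. \<exists>C. \<forall>u\<in>unit_cube. \<bar>Gn n u j \<omega>\<bar> \<le> C) \<and>
      supdist (Cn_vec P A Xs Zs n \<omega>) (Cinf_vec P A (\<lambda>u j. Gn n u j \<omega>)) \<le> \<epsilon> \<and>
      (\<forall>j. \<forall>u\<in>unit_cube. \<forall>v\<in>unit_cube. (\<forall>i. \<bar>u$i - v$i\<bar> \<le> \<delta>) \<longrightarrow> \<bar>Gn n u j \<omega> - Gn n v j \<omega>\<bar> \<le> e2)"
      if w: "\<omega> \<in> space M - (E \<union> N0)" for \<omega>
    proof (intro conjI)
      have wE: "\<omega> \<in> space M - E" and gd: "good \<omega>" using w N0(2) by auto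
      show "\<forall>j. \<exists>C. \<forall>u\<in>unit_cube. \<bar>Gn n u j \<omega>\<bar> \<le> C" using Eb[OF wE] by blast
      show "\<forall>j. \<forall>u\<in>unit_cube. \<forall>v\<in>unit_cube. (\<forall>i. \<bar>u$i - v$i\<bar> \<le> \<delta>) \<longrightarrow> \<bar>Gn n u j \<omega> - Gn n v j \<omega>\<bar> \<le> e2"
        using Em[OF wE] e(2) by (meson order_trans)
      have cmp: "\<bar>sqrt (real n) * (Cbar Xs Zs n (A j) \<omega> u - Ccop P (A j) u) - Lop j (\<lambda>u. Gn n u j \<omega>) u\<bar> \<le> \<epsilon> / ?m"
        if "u \<in> unit_cube" for j u
      proof -
        have "nj j \<le> n" using njn[of j] n by simp
        moreover have "\<forall>u\<in>unit_cube. \<forall>v\<in>unit_cube. (\<forall>i. \<bar>u$i - v$i\<bar> \<le> \<delta>) \<longrightarrow> \<bar>Gn n u j \<omega> - Gn n v j \<omega>\<bar> \<le> ej j"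
          using Em[OF wE] e(3)[of j] by (meson order_trans)
        ultimately show ?thesis using nj[of j] gd Eb[OF wE] that unfolding Q_def by blast
      qed
      show "supdist (Cn_vec P A Xs Zs n \<omega>) (Cinf_vec P A (\<lambda>u j. Gn n u j \<omega>)) \<le> \<epsilon>"
      proof (rule supdist_least)
        fix uv :: "'m \<Rightarrow> real^'p" assume uv: "uv \<in> Tset"
        let ?d = "Cn_vec P A Xs Zs n \<omega> uv - Cinf_vec P A (\<lambda>u j. Gn n u j \<omega>) uv"
        have "norm ?d \<le> (\<Sum>j\<in>UNIV. \<bar>?d $ j\<bar>)" by (rule norm_le_l1_cart)
        also have "\<dots> \<le> (\<Sum>j\<in>(UNIV::'m set). \<epsilon> / ?m)"
        proof (rule sum_mono)
          fix j
          have "uv j \<in> unit_cube" using uv by (auto simp: Tset_def)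
          then show "\<bar>?d $ j\<bar> \<le> \<epsilon> / ?m" using cmp[of "uv j" j] uv by (simp add: Cn_vec_def Cinf_comp)
        qed
        finally show "norm ?d \<le> \<epsilon>" by simp
      qed
    qed
    ultimately show "\<exists>E\<in>sets M. M.prob E \<le> \<eta> \<and> (\<forall>\<omega>\<in>space M - E.
      (\<forall>j. \<exists>C. \<forall>u\<in>unit_cube. \<bar>Gn n u j \<omega>\<bar> \<le> C) \<and>
      supdist (Cn_vec P A Xs Zs n \<omega>) (Cinf_vec P A (\<lambda>u j. Gn n u j \<omega>)) \<le> \<epsilon> \<and>
      (\<forall>j. \<forall>u\<in>unit_cube. \<forall>v\<in>unit_cube. (\<forall>i. \<bar>u$i - v$i\<bar> \<le> \<delta>) \<longrightarrow> \<bar>Gn n u j \<omega> - Gn n v j \<omega>\<bar> \<le> e2))"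
      using E(1) N0(1) by (intro bexI[of _ "E \<union> N0"] conjI ballI) auto
  qed
qed

lemma lip_conv:
  assumes c: "0 \<le> c" and B: "\<And>f. f \<in> lset \<Longrightarrow> \<bar>h f\<bar> \<le> B"
    and L: "\<And>f g. f \<in> lset \<Longrightarrow> g \<in> lset \<Longrightarrow> \<bar>h f - h g\<bar> \<le> c * supdist f g"
  shows "(\<lambda>n. outer_exp M (\<lambda>\<omega>. h (Cn_vec P A Xs Zs n \<omega>))) \<longlonglongrightarrow> (\<integral>\<omega>. h (Cinf_vec P A (Bp \<omega>)) \<partial>gauss_space)"
proof (rule LIMSEQ_I)
  fix r :: real assume r: "0 < r"
  interpret G: prob_space gauss_space by (rule prob_space_gauss)
  have B0: "0 \<le> B" using B[OF lset_zero] by linarith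
  let ?H = "\<lambda>k \<omega>. h (psi k (\<lambda>i. Bp \<omega> (fst (gidx k i)) (snd (gidx k i))))"
  let ?Hn = "\<lambda>n k \<omega>. h (psi k (\<lambda>i. Gn n (fst (gidx k i)) (snd (gidx k i)) \<omega>))"
  let ?I = "\<integral>\<omega>. h (Cinf_vec P A (Bp \<omega>)) \<partial>gauss_space"
  \<comment> \<open>The summands 1 here and in the next two definitions avoid division by zero; each
    product then used is at most r / 8 by \<open>fr\<close>.\<close>
  define \<eta> where "\<eta> = r / (8 * (B + 1))"
  define \<epsilon> where "\<epsilon> = r / (8 * (c + 1))"
  define e2 where "e2 = r / (8 * (c * Cinf_lip + 1))"
  have cL: "0 \<le> c * Cinf_lip" using c Cinf_lip_nonneg by simp
  have pos: "0 < \<eta>" "0 < \<epsilon>" "0 < e2" using r B0 c cL by (auto simp: \<eta>_def \<epsilon>_def e2_def)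
  have fr: "x * (r / (8 * (x + 1))) \<le> r / 8" if "0 \<le> x" for x
  proof -
    have "x * (r / (8 * (x + 1))) = (x * r) / (8 * (x + 1))" by simp
    also have "\<dots> \<le> r / 8" using that r by (subst pos_divide_le_eq) (auto simp: algebra_simps)
    finally show ?thesis .
  qed
  obtain \<delta> n1 where \<delta>: "0 < \<delta>" and n1: "\<And>n. n \<ge> n1 \<Longrightarrow> \<exists>E\<in>sets M. M.prob E \<le> \<eta> \<and> (\<forall>\<omega>\<in>space M - E.
      (\<forall>j. \<exists>C. \<forall>u\<in>unit_cube. \<bar>Gn n u j \<omega>\<bar> \<le> C) \<and>
      supdist (Cn_vec P A Xs Zs n \<omega>) (Cinf_vec P A (\<lambda>u j. Gn n u j \<omega>)) \<le> \<epsilon> \<and>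
      (\<forall>j. \<forall>u\<in>unit_cube. \<forall>v\<in>unit_cube. (\<forall>i. \<bar>u$i - v$i\<bar> \<le> \<delta>) \<longrightarrow> \<bar>Gn n u j \<omega> - Gn n v j \<omega>\<bar> \<le> e2))"
    using approx_event[OF pos] by blast
  have "(\<lambda>k. \<integral>\<omega>. ?H k \<omega> \<partial>gauss_space) \<longlonglongrightarrow> ?I"
    by (rule integral_dominated_convergence[where w="\<lambda>_. B"])
       (auto intro!: disc_conv[OF L c] hpsi_meas[OF L c] hCinf_meas[OF L c] B psi_lset)
  then have ev: "\<forall>\<^sub>F k in sequentially. dist (\<integral>\<omega>. ?H k \<omega> \<partial>gauss_space) ?I < r/4" using r by (intro tendstoD) auto
  have "(\<lambda>k. 1 / 2^k :: real) \<longlonglongrightarrow> 0" using LIMSEQ_divide_realpow_zero[of 2 1] by simp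
  then have "\<forall>\<^sub>F k in sequentially. 1 / 2^k < \<delta>" using \<delta> by (intro order_tendstoD) auto
  \<comment> \<open>\<delta> does not depend on n, so one mesh 1 / 2^k < \<delta> serves all large
    n, and the dimension stays fixed while n grows.\<close>
  from eventually_conj[OF ev this] obtain k where k: "\<bar>(\<integral>\<omega>. ?H k \<omega> \<partial>gauss_space) - ?I\<bar> < r/4" "1 / 2^k < \<delta>"
    by (auto simp: eventually_sequentially dist_real_def)
  obtain n2 where n2: "\<And>n. n \<ge> n2 \<Longrightarrow> \<bar>(\<integral>\<omega>. ?Hn n k \<omega> \<partial>M) - (\<integral>\<omega>. ?H k \<omega> \<partial>gauss_space)\<bar> < r/4"
    using LIMSEQ_D[OF Gn_findim[OF B L c, of k], of "r/4"] r by auto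
  have "norm (outer_exp M (\<lambda>\<omega>. h (Cn_vec P A Xs Zs n \<omega>)) - ?I) < r" if n: "n \<ge> max n1 n2" for n
  proof -
    have "n \<ge> n1" using n by simp
    from n1[OF this] obtain E where E: "E \<in> sets M" "M.prob E \<le> \<eta>" and EE: "\<forall>\<omega>\<in>space M - E.
      (\<forall>j. \<exists>C. \<forall>u\<in>unit_cube. \<bar>Gn n u j \<omega>\<bar> \<le> C) \<and>
      supdist (Cn_vec P A Xs Zs n \<omega>) (Cinf_vec P A (\<lambda>u j. Gn n u j \<omega>)) \<le> \<epsilon> \<and>
      (\<forall>j. \<forall>u\<in>unit_cube. \<forall>v\<in>unit_cube. (\<forall>i. \<bar>u$i - v$i\<bar> \<le> \<delta>) \<longrightarrow> \<bar>Gn n u j \<omega> - Gn n v j \<omega>\<bar> \<le> e2)"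
      by blast
    have Eb: "\<exists>C. \<forall>u\<in>unit_cube. \<bar>Gn n u j \<omega>\<bar> \<le> C" if "\<omega> \<in> space M - E" for \<omega> j using EE that by blast
    have Es: "supdist (Cn_vec P A Xs Zs n \<omega>) (Cinf_vec P A (\<lambda>u j. Gn n u j \<omega>)) \<le> \<epsilon>" if "\<omega> \<in> space M - E" for \<omega>
      using EE that by blast
    have Em: "\<bar>Gn n u j \<omega> - Gn n v j \<omega>\<bar> \<le> e2"
      if "\<omega> \<in> space M - E" "u \<in> unit_cube" "v \<in> unit_cube" "\<And>i. \<bar>u$i - v$i\<bar> \<le> \<delta>" for \<omega> j u v
      using EE that by blast
    have "\<bar>h (Cn_vec P A Xs Zs n \<omega>) - ?Hn n k \<omega>\<bar> \<le> r/4" if w: "\<omega> \<in> space M - E" for \<omega>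
    proof -
      let ?C = "Cinf_vec P A (\<lambda>u j. Gn n u j \<omega>)"
      have Cl: "?C \<in> lset" by (rule Cinf_lset[OF Eb[OF w]])
      have "\<bar>h (Cn_vec P A Xs Zs n \<omega>) - h ?C\<bar> \<le> c * supdist (Cn_vec P A Xs Zs n \<omega>) ?C" by (rule L[OF Cn_lset Cl])
      also have "\<dots> \<le> c * \<epsilon>" by (rule mult_left_mono[OF Es[OF w] c])
      also have "\<dots> \<le> r/8" unfolding \<epsilon>_def by (rule fr[OF c])
      finally have 1: "\<bar>h (Cn_vec P A Xs Zs n \<omega>) - h ?C\<bar> \<le> r/8" .
      have "\<bar>h ?C - ?Hn n k \<omega>\<bar> \<le> c * supdist ?C (psi k (\<lambda>i. Gn n (fst (gidx k i)) (snd (gidx k i)) \<omega>))"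
        by (rule L[OF Cl psi_lset])
      also have "\<dots> \<le> c * (Cinf_lip * e2)"
        unfolding psi_disc[where B="\<lambda>u j. Gn n u j \<omega>"]
      proof (intro mult_left_mono[OF Cinf_supdist c] Em[OF w] dy_cube)
        show "\<bar>u$i - dy k u $ i\<bar> \<le> \<delta>" for u :: "real^'p" and i using dy_bounds[of u i k] k(2) by simp
      qed
      also have "\<dots> \<le> r/8" unfolding e2_def using fr[OF cL] by (simp add: mult.assoc)
      finally show ?thesis using 1 by linarith
    qed
    then have "\<bar>outer_exp M (\<lambda>\<omega>. h (Cn_vec P A Xs Zs n \<omega>)) - (\<integral>\<omega>. ?Hn n k \<omega> \<partial>M)\<bar> \<le> r/4 + 2 * B * M.prob E"
      using E(1) r by (intro M.outer_exp_approx) (auto intro!: hpsi_meas[OF L c] B psi_lset Cn_lset)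
    moreover have "2 * B * M.prob E \<le> r/4"
    proof -
      have "2 * B * M.prob E \<le> 2 * B * \<eta>" using E(2) B0 by (intro mult_left_mono) auto
      also have "\<dots> = 2 * (B * (r / (8 * (B + 1))))" by (simp only: \<eta>_def mult.assoc)
      also have "\<dots> \<le> 2 * (r/8)" by (intro mult_left_mono fr B0) simp
      finally show ?thesis by simp
    qed
    moreover have "\<bar>(\<integral>\<omega>. ?Hn n k \<omega> \<partial>M) - (\<integral>\<omega>. ?H k \<omega> \<partial>gauss_space)\<bar> < r/4" using n by (intro n2) simp
    ultimately show ?thesis using k(1) unfolding real_norm_def by linarith
  qed
  then show "\<exists>no. \<forall>n\<ge>no. norm (outer_exp M (\<lambda>\<omega>. h (Cn_vec P A Xs Zs n \<omega>)) - ?I) < r" by blast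
qed

lemma weak_convergence: "linf_weak_conv M (Cn_vec P A Xs Zs) (distr limit_law linf_borel (Cinf_vec P A))"
  unfolding limit_law_distr[OF Cinf_path]
  by (rule linf_weak_conv_lipschitzI[OF prob_M prob_space_gauss Cn_lset CinfBp_meas lip_conv])

end

theorem theorem3:
  fixes M :: "'a measure"
    and X :: "nat \<Rightarrow> 'a \<Rightarrow> real^'p"
    and Z :: "nat \<Rightarrow> 'a \<Rightarrow> real^'q"
    and A :: "('m::finite) \<Rightarrow> (real^'q) set"
  defines "P \<equiv> distr M borel (\<lambda>\<omega>. (X 0 \<omega>, Z 0 \<omega>))"
  assumes "prob_space M"
    and "prob_space.indep_vars M (\<lambda>_. borel) (\<lambda>i \<omega>. (X i \<omega>, Z i \<omega>)) UNIV"
    and "\<And>i. distr M borel (\<lambda>\<omega>. (X i \<omega>, Z i \<omega>)) = P"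
    and "\<And>j. A j \<in> sets borel"
    and "\<And>j. pA P (A j) > 0"
    and "\<And>j k. continuous_on UNIV (condF P (A j) k)"
    and "\<And>j. condition_C P (A j)"
  shows "\<exists>N :: (real^'p \<Rightarrow> 'm \<Rightarrow> real) measure.
           gaussian_B P A N \<and>
           (\<forall>B\<in>space N. Cinf_vec P A B \<in> lset) \<and>
           Cinf_vec P A \<in> measurable N linf_borel \<and>
           linf_tight (distr N linf_borel (Cinf_vec P A)) \<and>
           linf_weak_conv M (Cn_vec P A X Z) (distr N linf_borel (Cinf_vec P A))"
proof -
  interpret M: prob_space M by fact
  have W: "(\<lambda>\<omega>. (X 0 \<omega>, Z 0 \<omega>)) \<in> measurable M borel"
    using assms(3) unfolding M.indep_vars_def by simp
  have pP: "prob_space P" unfolding P_def by (rule M.prob_space_distr[OF W])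
  have sP: "sets P = sets borel" by (simp add: P_def)
  interpret emp_sample P A M "\<lambda>i \<omega>. (X i \<omega>, Z i \<omega>)"
    by (intro emp_sample.intro cond_law_C.intro cond_law.intro cond_law_C_axioms.intro emp_sample_axioms.intro)
       (rule pP sP assms)+
  have s: "space limit_law = space path_alg" by (rule limit_law_sets)
  show ?thesis
  proof (intro exI[of _ limit_law] conjI ballI)
    show "gaussian_B P A limit_law" by (rule limit_law_gaussian)
    \<comment> \<open>The space of \<open>limit_law\<close> consists of bounded paths by
      construction, so this holds for every path.\<close>
    show "Cinf_vec P A B \<in> lset" if "B \<in> space limit_law" for B
      using that unfolding s path_space by (auto intro!: Cinf_lset)
    show "Cinf_vec P A \<in> measurable limit_law linf_borel"
      using Cinf_path by (simp add: measurable_cong_sets[OF limit_law_sets(1) refl])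
    show "linf_tight (distr limit_law linf_borel (Cinf_vec P A))"
      unfolding limit_law_distr[OF Cinf_path] by (rule limit_tight)
    show "linf_weak_conv M (Cn_vec P A X Z) (distr limit_law linf_borel (Cinf_vec P A))"
      using weak_convergence by simp
  qed
qed


end
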